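(* If $W$ is the exceptional complex reflection group $G_4$, then $B/(P,P)$ is a Bieberbach group of dimension $4$. If $W$ is the exceptional complex reflection group $G_6$, then $B/(P,P)$ is a Bieberbach group of dimension $10$. Both have for holonomy group the alternating group $\mathfrak{A}_4$. Here $B$ and $P$ denote the braid group and pure braid group of $W$.
   Context: A complex reflection group is a finite subgroup $W<\mathrm{GL}_n(\mathbf{C})$ generated by (pseudo-)reflections, i.e. elements $\neq 1$ fixing pointwise a hyperplane. $\mathcal{A}$ is the set of reflecting hyperplanes of $W$, and $X=\mathbf{C}^n\setminus\bigcup\mathcal{A}$. The group $W$ acts freely on $X$; $P=\pi_1(X)$ (pure braid group) and $B=\pi_1(X/W)$ (braid group), so there is an exact sequence $1\to P\to B\to W\to 1$. $(P,P)$ is the commutator subgroup of $P$. $G_4$ and $G_6$ refer to the Shephard–Todd classification: they are the primitive irreducible complex reflection groups in $\mathrm{GL}_2(\mathbf{C})$ (i.e. irreducible and not preserving any decomposition of $\mathbf{C}^2$ as a sum of two lines) with invariant degrees $4,6$ for $G_4$ (order $24$) and $4,12$ for $G_6$ (order $48$). $G_4$ has presentation $\langle s,t\mid s^3=t^3=1,\ sts=tst\rangle$ and $G_6$ has presentation $\langle s,t\mid s^2=t^3=1,\ ststst=tststs\rangle$, with $s,t$ acting as reflections. A group $\Gamma$ is crystallographic of dimension $N$ with holonomy group $\Phi$ if there is an exact sequence $1\to\mathbf{Z}^N\to\Gamma\to\Phi\to1$ with $\Phi$ finite and $\mathbf{Z}^N$ maximal abelian in $\Gamma$ (equivalently, $\Phi$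 finite and the induced action $\Phi\to\mathrm{Aut}(\mathbf{Z}^N)$ faithful). A Bieberbach group is a torsion-free crystallographic group. *)

theory Defs
  imports
    "HOL-Analysis.Analysis"
    "HOL-Algebra.Group_Action"
    "HOL-Algebra.Product_Groups"
    "HOL-Algebra.Sym_Groups"
begin

section \<open>Complex reflection groups\<close>

definition GL :: "(complex^'n^'n) monoid" where
  "GL = \<lparr>carrier = {A. invertible A}, mult = (**), one = mat 1\<rparr>"

text \<open>Here \<open>vec\<close> is the complex vector space structure on \<open>complex^'n\<close>, so that dimensions
  and subspaces are complex ones.\<close>

definition hyperplane :: "(complex^'n) set \<Rightarrow> bool" where
  "hyperplane H \<longleftrightarrow> vec.subspace H \<and> vec.dim H = CARD('n) - 1"

definition reflection_along :: "complex^'n^'n \<Rightarrow> (complex^'n) set \<Rightarrow> bool" where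
  "reflection_along r H \<longleftrightarrow> invertible r \<and> r \<noteq> mat 1 \<and> hyperplane H \<and> (\<forall>v\<in>H. r *v v = v)"

definition reflection :: "complex^'n^'n \<Rightarrow> bool" where
  "reflection r \<longleftrightarrow> (\<exists>H. reflection_along r H)"

definition complex_reflection_group :: "(complex^'n^'n) set \<Rightarrow> bool" where
  "complex_reflection_group W \<longleftrightarrow>
     subgroup W GL \<and> finite W \<and> generate GL {r \<in> W. reflection r} = W"

definition reflecting_hyperplanes :: "(complex^'n^'n) set \<Rightarrow> (complex^'n) set set" where
  "reflecting_hyperplanes W = {H. \<exists>r\<in>W. reflection_along r H}"

definition hyperplane_complement :: "(complex^'n^'n) set \<Rightarrow> (complex^'n) set" where
  "hyperplane_complement W = UNIV - \<Union>(reflecting_hyperplanes W)"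

definition irreducible_linear_group :: "(complex^'n^'n) set \<Rightarrow> bool" where
  "irreducible_linear_group W \<longleftrightarrow>
     (\<forall>V. vec.subspace V \<and> (\<forall>w\<in>W. (*v) w ` V \<subseteq> V) \<longrightarrow> V = {0} \<or> V = UNIV)"

text \<open>An imprimitive group may exchange the two lines of the decomposition.\<close>

definition primitive_rank2 :: "(complex^2^2) set \<Rightarrow> bool" where
  "primitive_rank2 W \<longleftrightarrow>
     \<not> (\<exists>L L'. vec.subspace L \<and> vec.dim L = 1 \<and> vec.subspace L' \<and> vec.dim L' = 1
             \<and> L \<inter> L' = {0} \<and> (\<forall>w\<in>W. {(*v) w ` L, (*v) w ` L'} = {L, L'}))"


section \<open>Invariant degrees in rank 2\<close>

text \<open>Since the complex numbers are an infinite field, the algebra of polynomials in two variables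
  is identified with the algebra of polynomial functions on \<open>complex^2\<close>.\<close>

definition polyfun2 :: "(complex^2 \<Rightarrow> complex) \<Rightarrow> bool" where
  "polyfun2 f \<longleftrightarrow> (\<exists>n c. \<forall>v. f v = (\<Sum>i\<le>n. \<Sum>j\<le>n. c i j * (v$1)^i * (v$2)^j))"

definition form2 :: "nat \<Rightarrow> (complex^2 \<Rightarrow> complex) \<Rightarrow> bool" where
  "form2 d f \<longleftrightarrow> (\<exists>c. \<forall>v. f v = (\<Sum>i\<le>d. c i * (v$1)^i * (v$2)^(d - i)))"

definition invariant_function :: "(complex^'n^'n) set \<Rightarrow> (complex^'n \<Rightarrow> complex) \<Rightarrow> bool" where
  "invariant_function W f \<longleftrightarrow> (\<forall>w\<in>W. \<forall>v. f (w *v v) = f v)"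

text \<open>The invariant algebra of \<open>W\<close> is a polynomial algebra on homogeneous generators \<open>f\<close>, \<open>g\<close>
  of degrees \<open>d\<close>, \<open>e\<close>: they are algebraically independent, and each invariant is a polynomial
  in them.\<close>

definition has_invariant_degrees :: "(complex^2^2) set \<Rightarrow> nat \<Rightarrow> nat \<Rightarrow> bool" where
  "has_invariant_degrees W d e \<longleftrightarrow>
     (\<exists>f g. form2 d f \<and> form2 e g \<and> invariant_function W f \<and> invariant_function W g
        \<and> (\<forall>q. polyfun2 q \<and> (\<forall>v. q (vector [f v, g v]) = 0) \<longrightarrow> (\<forall>u. q u = 0))
        \<and> (\<forall>h. polyfun2 h \<and> invariant_function W h
               \<longrightarrow> (\<exists>q. polyfun2 q \<and> (\<forall>v. h v = q (vector [f v, g v])))))"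


section \<open>The exceptional groups \<open>G\<^sub>4\<close> and \<open>G\<^sub>6\<close>\<close>

text \<open>Shephard--Todd data (primitive, irreducible, degrees) together with the presentation on
  generating reflections \<open>s\<close>, \<open>t\<close>.  The presented groups have order 24 and 48, so a group of that
  order generated by elements that satisfy the relations is given by the presentation.
  The Shephard--Todd data alone already determine \<open>W\<close> up to conjugation in \<open>GL\<close>, and so do the
  reflections, relations and order; they are the same group, so recording both adds no
  restriction.\<close>

definition is_G4 :: "(complex^2^2) set \<Rightarrow> bool" where
  "is_G4 W \<longleftrightarrow>
     complex_reflection_group W \<and> irreducible_linear_group W \<and> primitive_rank2 W
     \<and> has_invariant_degrees W 4 6 \<and> card W = 24
     \<and> (\<exists>s t. reflection s \<and> reflection t \<and> generate GL {s, t} = W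
          \<and> s ** s ** s = mat 1 \<and> t ** t ** t = mat 1
          \<and> s ** t ** s = t ** s ** t)"

definition is_G6 :: "(complex^2^2) set \<Rightarrow> bool" where
  "is_G6 W \<longleftrightarrow>
     complex_reflection_group W \<and> irreducible_linear_group W \<and> primitive_rank2 W
     \<and> has_invariant_degrees W 4 12 \<and> card W = 48
     \<and> (\<exists>s t. reflection s \<and> reflection t \<and> generate GL {s, t} = W
          \<and> s ** s = mat 1 \<and> t ** t ** t = mat 1
          \<and> s ** t ** s ** t ** s ** t = t ** s ** t ** s ** t ** s)"


section \<open>The fundamental group of a topological space\<close>

definition loops :: "'a topology \<Rightarrow> 'a \<Rightarrow> (real \<Rightarrow> 'a) set" where
  "loops T a = {p. pathin T p \<and> p 0 = a \<and> p 1 = a}"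

definition loop_class :: "'a topology \<Rightarrow> 'a \<Rightarrow> (real \<Rightarrow> 'a) \<Rightarrow> (real \<Rightarrow> 'a) set" where
  "loop_class T a p =
     {q \<in> loops T a. homotopic_with (\<lambda>h. h 0 = a \<and> h 1 = a) (top_of_set {0..1}) T p q}"

text \<open>The library's \<open>joinpaths\<close> requires a type class topology on the codomain, which the orbit
  space below does not have.\<close>

definition concat_paths :: "(real \<Rightarrow> 'a) \<Rightarrow> (real \<Rightarrow> 'a) \<Rightarrow> real \<Rightarrow> 'a" where
  "concat_paths p q = (\<lambda>t. if t \<le> 1/2 then p (2 * t) else q (2 * t - 1))"

definition fundamental_group :: "'a topology \<Rightarrow> 'a \<Rightarrow> (real \<Rightarrow> 'a) set monoid" where
  "fundamental_group T a =
     \<lparr>carrier = loop_class T a ` loops T a,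
      mult = (\<lambda>C D. \<Union>p\<in>C. \<Union>q\<in>D. loop_class T a (concat_paths p q)),
      one = loop_class T a (\<lambda>_. a)\<rparr>"

definition induced_map ::
    "'b topology \<Rightarrow> ('a \<Rightarrow> 'b) \<Rightarrow> 'a \<Rightarrow> (real \<Rightarrow> 'a) set \<Rightarrow> (real \<Rightarrow> 'b) set" where
  "induced_map T' f a C = (\<Union>p\<in>C. loop_class T' (f a) (f \<circ> p))"


section \<open>Braid groups\<close>

definition quotient_topology :: "'a topology \<Rightarrow> ('a \<Rightarrow> 'b) \<Rightarrow> 'b topology" where
  "quotient_topology T q =
     topology (\<lambda>U. U \<subseteq> q ` topspace T \<and> openin T {x \<in> topspace T. q x \<in> U})"

lemma openin_quotient_topology:
  "openin (quotient_topology T q) U \<longleftrightarrow>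
     U \<subseteq> q ` topspace T \<and> openin T {x \<in> topspace T. q x \<in> U}"
proof -
  have "istopology (\<lambda>U. U \<subseteq> q ` topspace T \<and> openin T {x \<in> topspace T. q x \<in> U})"
    unfolding istopology_def
  proof (intro conjI allI impI)
    fix U V
    assume U: "U \<subseteq> q ` topspace T \<and> openin T {x \<in> topspace T. q x \<in> U}"
      and V: "V \<subseteq> q ` topspace T \<and> openin T {x \<in> topspace T. q x \<in> V}"
    show "U \<inter> V \<subseteq> q ` topspace T" using U by auto
    have "{x \<in> topspace T. q x \<in> U \<inter> V}
        = {x \<in> topspace T. q x \<in> U} \<inter> {x \<in> topspace T. q x \<in> V}" by auto
    then show "openin T {x \<in> topspace T. q x \<in> U \<inter> V}"
      using U V by (simp only: openin_Int)
  next
    fix K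
    assume K: "\<forall>U\<in>K. U \<subseteq> q ` topspace T \<and> openin T {x \<in> topspace T. q x \<in> U}"
    show "\<Union>K \<subseteq> q ` topspace T" using K by auto
    have eq: "{x \<in> topspace T. q x \<in> \<Union>K} = \<Union>((\<lambda>U. {x \<in> topspace T. q x \<in> U}) ` K)"
      by blast
    show "openin T {x \<in> topspace T. q x \<in> \<Union>K}"
      unfolding eq using K by (intro openin_Union) blast
  qed
  from topology_inverse'[OF this] show ?thesis
    unfolding quotient_topology_def by (rule fun_cong)
qed

lemma topspace_quotient_topology [simp]:
  "topspace (quotient_topology T q) = q ` topspace T"
proof (rule antisym)
  show "topspace (quotient_topology T q) \<subseteq> q ` topspace T"
    by (rule openin_quotient_topology[THEN iffD1, OF openin_topspace, THEN conjunct1])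
  have "{x \<in> topspace T. q x \<in> q ` topspace T} = topspace T" by auto
  then have "openin (quotient_topology T q) (q ` topspace T)"
    by (simp only: openin_quotient_topology openin_topspace subset_refl simp_thms)
  then show "q ` topspace T \<subseteq> topspace (quotient_topology T q)"
    by (rule openin_subset)
qed

lemma quotient_map_quotient_topology: "quotient_map T (quotient_topology T q) q"
  by (simp add: quotient_map_def openin_quotient_topology)

abbreviation orbit_map :: "(complex^'n^'n) set \<Rightarrow> complex^'n \<Rightarrow> (complex^'n) set" where
  "orbit_map W \<equiv> orbit (GL\<lparr>carrier := W\<rparr>) (*v)"

definition orbit_space :: "(complex^'n^'n) set \<Rightarrow> (complex^'n) set topology" where
  "orbit_space W = quotient_topology (top_of_set (hyperplane_complement W)) (orbit_map W)"

definition pure_braid_group ::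
    "(complex^'n^'n) set \<Rightarrow> complex^'n \<Rightarrow> (real \<Rightarrow> complex^'n) set monoid" where
  "pure_braid_group W x = fundamental_group (top_of_set (hyperplane_complement W)) x"

definition braid_group ::
    "(complex^'n^'n) set \<Rightarrow> complex^'n \<Rightarrow> (real \<Rightarrow> (complex^'n) set) set monoid" where
  "braid_group W x = fundamental_group (orbit_space W) (orbit_map W x)"

text \<open>\<open>P\<close> is regarded as a subgroup of \<open>B\<close> through the injection induced by the covering of
  \<open>X/W\<close> by \<open>X\<close>.\<close>

definition pure_to_braid ::
    "(complex^'n^'n) set \<Rightarrow> complex^'n \<Rightarrow> (real \<Rightarrow> complex^'n) set
       \<Rightarrow> (real \<Rightarrow> (complex^'n) set) set" where
  "pure_to_braid W x = induced_map (orbit_space W) (orbit_map W) x"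

definition braid_mod_pure_commutators ::
    "(complex^'n^'n) set \<Rightarrow> complex^'n \<Rightarrow> (real \<Rightarrow> (complex^'n) set) set set monoid" where
  "braid_mod_pure_commutators W x =
     braid_group W x Mod
       (pure_to_braid W x ` derived (pure_braid_group W x) (carrier (pure_braid_group W x)))"


section \<open>Crystallographic and Bieberbach groups\<close>

definition maximal_abelian_subgroup :: "('a, 'm) monoid_scheme \<Rightarrow> 'a set \<Rightarrow> bool" where
  "maximal_abelian_subgroup G A \<longleftrightarrow>
     subgroup A G \<and> comm_group (G\<lparr>carrier := A\<rparr>)
     \<and> (\<forall>A'. subgroup A' G \<and> comm_group (G\<lparr>carrier := A'\<rparr>) \<and> A \<subseteq> A' \<longrightarrow> A' = A)"

definition int_power_group :: "nat \<Rightarrow> (nat \<Rightarrow> int) monoid" where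
  "int_power_group N = product_group {..<N} (\<lambda>_. integer_group)"

definition crystallographic_group ::
    "('a, 'm) monoid_scheme \<Rightarrow> nat \<Rightarrow> ('b, 'k) monoid_scheme \<Rightarrow> bool" where
  "crystallographic_group \<Gamma> N \<Phi> \<longleftrightarrow>
     group \<Gamma> \<and> group \<Phi> \<and> finite (carrier \<Phi>)
     \<and> (\<exists>i p. i \<in> mon (int_power_group N) \<Gamma> \<and> p \<in> epi \<Gamma> \<Phi>
          \<and> i ` carrier (int_power_group N) = kernel \<Gamma> \<Phi> p
          \<and> maximal_abelian_subgroup \<Gamma> (i ` carrier (int_power_group N)))"

definition torsion_free :: "('a, 'm) monoid_scheme \<Rightarrow> bool" where
  "torsion_free G \<longleftrightarrow> (\<forall>g\<in>carrier G. \<forall>n::nat. n > 0 \<and> g [^]\<^bsub>G\<^esub> n = \<one>\<^bsub>G\<^esub> \<longrightarrow> g = \<one>\<^bsub>G\<^esub>)"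

definition bieberbach_group ::
    "('a, 'm) monoid_scheme \<Rightarrow> nat \<Rightarrow> ('b, 'k) monoid_scheme \<Rightarrow> bool" where
  "bieberbach_group \<Gamma> N \<Phi> \<longleftrightarrow> crystallographic_group \<Gamma> N \<Phi> \<and> torsion_free \<Gamma>"

end

theory Submission
  imports
    Defs
    "HOL-Complex_Analysis.Complex_Analysis"
    "HOL-Algebra.Multiplicative_Group"
begin

text \<open>
  A braid is represented by a path in the complement \<open>X\<close> of the reflecting lines, from the base
  point \<open>x\<close> to one of its images \<open>w x\<close>.  For each reflecting line \<open>H\<close>, with linear form \<open>\<alpha>\<close>, the path
  makes a complex number of turns around \<open>H\<close>, the winding number of \<open>\<alpha>\<close> along it.  The matrix \<open>w\<close>
  and the turns depend only on the braid, because \<open>W\<close> acts freely on \<open>X\<close> and homotopies lift.  They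
  define a homomorphism from \<open>B\<close> to the semidirect product of \<open>W\<close> with the complex functions on the
  set of lines (lemma \<open>monodromy_hom\<close>), and its kernel is \<open>(P, P)\<close> (lemma \<open>kernel_monodromy\<close>).  So
  \<open>B / (P, P)\<close> is a concrete group of pairs \<open>(w, f)\<close>.

  The substance of the kernel lemma is that a loop in \<open>X\<close> with vanishing winding numbers is a product
  of commutators.  With one line moved to infinity, \<open>X\<close> is the product of a punctured complex line
  and a complex line with finitely many punctures (lemma \<open>null_windings_imp_in_derived\<close>).  In a
  convex region with punctures, a cut between the punctures and the generation half of the van
  Kampen theorem reduce the claim to a single puncture, where the winding number determines the
  homotopy class (lemma \<open>null_winding_imp_in_derived\<close>).

  Let \<open>m\<close> be the number of scalars in \<open>W\<close>.  The pairs over scalars form a lattice, spanned by the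
  constant function \<open>1 / m\<close> (from the path that rotates \<open>x\<close>) and by the unit vectors (from the
  meridians), of rank the number of lines.  An element that commutes with all unit vectors fixes
  all lines and is therefore over a scalar, so the lattice is maximal abelian and the holonomy group
  is \<open>W\<close> modulo scalars (lemma \<open>crystallographic_image_group\<close>).

  For torsion-freeness, the sum of all turns is additive and so vanishes on a torsion element
  \<open>(w, f)\<close>.  Hence the product of all linear forms takes the same value at \<open>x\<close> and \<open>w x\<close>.  This product
  is a semi-invariant with character the determinant (lemma \<open>discriminant_character\<close>), so \<open>w\<close> has
  determinant one.  In the groups considered here this implies that the order of \<open>w\<close> is a power of
  two, so that a nontrivial \<open>w\<close> has a power equal to \<open>- 1\<close>.  But over \<open>- 1\<close> all turns are half-integers,
  and no such element is torsion (lemma \<open>torsion_free_image_group\<close>).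

  Both \<open>G\<^sub>4\<close> and \<open>G\<^sub>6\<close> permute the four lines of their reflections of order three.  An element that
  preserves them all is scalar, the degrees bound the number of scalars, and the generators act by
  even permutations; the order of the group then forces the image to be the alternating group (lemma
  \<open>even_action\<close>).  The key to the remaining facts is lemma \<open>cube_one_fixes_line_pointwise\<close>: an
  element with cube one fixes one of the four lines pointwise.  So there is no element of order
  three with determinant one, and a reflection of order three has its line among the four.  All
  reflections of \<open>G\<^sub>4\<close> are of this kind, which gives rank 4.  In \<open>G\<^sub>6\<close> there are in addition six
  involutive reflections, with six further lines, which gives rank 10.
\<close>

section \<open>The fundamental group of an arbitrary space\<close>

definition loop_homotopic :: "'a topology \<Rightarrow> 'a \<Rightarrow> (real \<Rightarrow> 'a) \<Rightarrow> (real \<Rightarrow> 'a) \<Rightarrow> bool" where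
  "loop_homotopic T a p q \<longleftrightarrow>
     homotopic_with (\<lambda>h. h 0 = a \<and> h 1 = a) (top_of_set {0..1}) T p q"

lemma loop_homotopic_iff:
  "loop_homotopic T a p q \<longleftrightarrow>
     (\<exists>k :: real \<times> real \<Rightarrow> 'a. continuous_map (top_of_set ({0..1} \<times> {0..1})) T k
        \<and> (\<forall>t\<in>{0..1}. k (0, t) = p t) \<and> (\<forall>t\<in>{0..1}. k (1, t) = q t)
        \<and> (\<forall>s\<in>{0..1}. k (s, 0) = a \<and> k (s, 1) = a))"
  unfolding loop_homotopic_def
  by (subst homotopic_with)
     (simp_all add: prod_topology_subtopology_eu)

lemma loop_homotopic_refl: "p \<in> loops T a \<Longrightarrow> loop_homotopic T a p p"
  by (simp add: loop_homotopic_def loops_def pathin_def)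

lemma loop_homotopic_sym: "loop_homotopic T a p q \<Longrightarrow> loop_homotopic T a q p"
  by (simp add: loop_homotopic_def homotopic_with_symD)

lemma loop_homotopic_trans:
  "loop_homotopic T a p q \<Longrightarrow> loop_homotopic T a q r \<Longrightarrow> loop_homotopic T a p r"
  unfolding loop_homotopic_def by (rule homotopic_with_trans)

lemma loop_class_eq:
  "loop_class T a p = {q \<in> loops T a. loop_homotopic T a p q}"
  by (simp add: loop_class_def loop_homotopic_def)

lemma loop_class_eq_iff:
  assumes "p \<in> loops T a" "q \<in> loops T a"
  shows "loop_class T a p = loop_class T a q \<longleftrightarrow> loop_homotopic T a p q"
  using assms unfolding loop_class_eq
  by (blast intro: loop_homotopic_refl loop_homotopic_sym loop_homotopic_trans)

lemma loop_in_own_class: "p \<in> loops T a \<Longrightarrow> p \<in> loop_class T a p"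
  by (simp add: loop_class_eq loop_homotopic_refl)

lemma loop_homotopic_cong:
  assumes "p \<in> loops T a" "\<And>t. t \<in> {0..1} \<Longrightarrow> p t = q t"
  shows "loop_homotopic T a p q"
  unfolding loop_homotopic_def
  by (rule homotopic_with_equal) (use assms in \<open>auto simp: loops_def pathin_def\<close>)

lemma loop_homotopic_imp_loops:
  assumes "loop_homotopic T a p q"
  shows "p \<in> loops T a" "q \<in> loops T a"
  using homotopic_with_imp_continuous_maps[OF assms[unfolded loop_homotopic_def]]
    homotopic_with_imp_property[OF assms[unfolded loop_homotopic_def]]
  by (simp_all add: loops_def pathin_def)

text \<open>Two reparametrisations of a path with the same endpoints are joined by the straight-line
  homotopy in the parameter interval.  Each group law below is an instance of this.\<close>

lemma loop_homotopic_reparametrize: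
  assumes p: "pathin T p" and f: "continuous_on {0..1} f" "f ` {0..1} \<subseteq> {0..1}"
    and g: "continuous_on {0..1} g" "g ` {0..1} \<subseteq> {0..1}"
    and ends: "f 0 = g 0" "f 1 = g 1" "p (f 0) = a" "p (f 1) = a"
    and u: "\<And>t. t \<in> {0..1} \<Longrightarrow> u t = p (f t)" and v: "\<And>t. t \<in> {0..1} \<Longrightarrow> v t = p (g t)"
  shows "loop_homotopic T a u v"
proof -
  define l where "l = (\<lambda>(s, t). (1 - s) * f t + s * g t)"
  have "continuous_on ({0..1} \<times> {0..1}) l"
    unfolding l_def case_prod_unfold
    using image_subset_iff[THEN iffD1, OF f(2)] image_subset_iff[THEN iffD1, OF g(2)]
    by (intro continuous_intros continuous_on_compose2[OF f(1), of _ snd]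
        continuous_on_compose2[OF g(1), of _ snd]) auto
  moreover have "l ` ({0..1} \<times> {0..1}) \<subseteq> {0..1}"
  proof clarify
    fix s t :: real assume st: "s \<in> {0..1}" "t \<in> {0..1}"
    then have "f t \<in> {0..1}" "g t \<in> {0..1}" using f(2) g(2) by blast+
    then have "(1 - s) *\<^sub>R f t + s *\<^sub>R g t \<in> {0..1}"
      using st by (intro convexD) auto
    then show "l (s, t) \<in> {0..1}" by (simp add: l_def)
  qed
  ultimately have "continuous_map (top_of_set ({0..1} \<times> {0..1})) (top_of_set {0..1}) l"
    by (auto simp: continuous_map_in_subtopology)
  with p have "continuous_map (top_of_set ({0..1} \<times> {0..1})) T (p \<circ> l)"
    unfolding pathin_def by (rule continuous_map_compose[rotated])
  then show ?thesis
    unfolding loop_homotopic_iff using ends u v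
    by (intro exI[of _ "p \<circ> l"]) (auto simp: l_def algebra_simps)
qed

lemma loops_pathinD: "p \<in> loops T a \<Longrightarrow> pathin T p"
  by (simp add: loops_def)

lemma continuous_map_concat:
  fixes k1 k2 :: "real \<times> real \<Rightarrow> 'a"
  assumes k1: "continuous_map (top_of_set ({0..1} \<times> {0..1})) T k1"
    and k2: "continuous_map (top_of_set ({0..1} \<times> {0..1})) T k2"
    and eq: "\<And>s. s \<in> {0..1} \<Longrightarrow> k1 (s, 1) = k2 (s, 0)"
  shows "continuous_map (top_of_set ({0..1} \<times> {0..1})) T
           (\<lambda>z. if snd z \<le> 1/2 then k1 (fst z, 2 * snd z) else k2 (fst z, 2 * snd z - 1))"
proof (rule continuous_map_cases_le)
  let ?S = "top_of_set ({0..1} \<times> {0..1 :: real}) :: (real \<times> real) topology"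
  show "continuous_map ?S euclideanreal snd" "continuous_map ?S euclideanreal (\<lambda>_. 1/2)"
    by (auto intro: continuous_intros)
  have 1: "subtopology ?S {x \<in> topspace ?S. snd x \<le> 1/2} = top_of_set ({0..1} \<times> {0..1/2})"
    by (simp add: subtopology_subtopology) (rule arg_cong[where f = top_of_set], auto)
  have 2: "subtopology ?S {x \<in> topspace ?S. 1/2 \<le> snd x} = top_of_set ({0..1} \<times> {1/2..1})"
    by (simp add: subtopology_subtopology) (rule arg_cong[where f = top_of_set], auto)
  have "continuous_map (top_of_set ({0..1} \<times> {0..1/2})) ?S (\<lambda>z. (fst z, 2 * snd z))"
    by (auto simp: continuous_map_in_subtopology intro!: continuous_intros)
  from continuous_map_compose[OF this k1]
  show "continuous_map (subtopology ?S {x \<in> topspace ?S. snd x \<le> 1/2}) T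
          (\<lambda>z. k1 (fst z, 2 * snd z))" unfolding 1 by (simp add: o_def)
  have "continuous_map (top_of_set ({0..1} \<times> {1/2..1})) ?S (\<lambda>z. (fst z, 2 * snd z - 1))"
    by (auto simp: continuous_map_in_subtopology intro!: continuous_intros)
  from continuous_map_compose[OF this k2]
  show "continuous_map (subtopology ?S {x \<in> topspace ?S. 1/2 \<le> snd x}) T
          (\<lambda>z. k2 (fst z, 2 * snd z - 1))" unfolding 2 by (simp add: o_def)
next
  fix z :: "real \<times> real"
  assume "z \<in> topspace (top_of_set ({0..1} \<times> {0..1}))" "snd z = 1/2"
  then show "k1 (fst z, 2 * snd z) = k2 (fst z, 2 * snd z - 1)" using eq[of "fst z"] by (cases z) (auto simp: mult.commute)
qed

lemma loop_homotopic_concat: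
  assumes "loop_homotopic T a p p'" "loop_homotopic T a q q'"
  shows "loop_homotopic T a (concat_paths p q) (concat_paths p' q')"
proof -
  from assms(1) obtain k1 :: "real \<times> real \<Rightarrow> 'a"
    where k1: "continuous_map (top_of_set ({0..1} \<times> {0..1})) T k1"
        "\<forall>t\<in>{0..1}. k1 (0, t) = p t" "\<forall>t\<in>{0..1}. k1 (1, t) = p' t"
        "\<forall>s\<in>{0..1}. k1 (s, 0) = a \<and> k1 (s, 1) = a"
    unfolding loop_homotopic_iff by blast
  from assms(2) obtain k2 :: "real \<times> real \<Rightarrow> 'a"
    where k2: "continuous_map (top_of_set ({0..1} \<times> {0..1})) T k2"
        "\<forall>t\<in>{0..1}. k2 (0, t) = q t" "\<forall>t\<in>{0..1}. k2 (1, t) = q' t"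
        "\<forall>s\<in>{0..1}. k2 (s, 0) = a \<and> k2 (s, 1) = a"
    unfolding loop_homotopic_iff by blast
  show ?thesis unfolding loop_homotopic_iff
    by (rule exI, rule conjI, rule continuous_map_concat[OF k1(1) k2(1)])
       (use k1 k2 in \<open>auto simp: concat_paths_def\<close>)
qed

lemma concat_in_loops:
  assumes "p \<in> loops T a" "q \<in> loops T a"
  shows "concat_paths p q \<in> loops T a"
  using loop_homotopic_concat[OF assms[THEN loop_homotopic_refl]]
  by (rule loop_homotopic_imp_loops)

lemma const_in_loops: "a \<in> topspace T \<Longrightarrow> (\<lambda>_. a) \<in> loops T a"
  by (simp add: loops_def pathin_def)

lemma reverse_in_loops:
  assumes "p \<in> loops T a" shows "p \<circ> (\<lambda>t. 1 - t) \<in> loops T a"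
proof -
  have "continuous_map (top_of_set {0..1}) (top_of_set {0..1::real}) (\<lambda>t. 1 - t)"
    by (auto simp: continuous_map_in_subtopology intro!: continuous_intros)
  from continuous_map_compose[OF this loops_pathinD[OF assms, unfolded pathin_def]]
  show ?thesis using assms by (simp add: loops_def pathin_def)
qed

lemma fundamental_group_carrier:
  "carrier (fundamental_group T a) = loop_class T a ` loops T a"
  by (simp add: fundamental_group_def)

lemma fundamental_group_mult:
  assumes "p \<in> loops T a" "q \<in> loops T a"
  shows "loop_class T a p \<otimes>\<^bsub>fundamental_group T a\<^esub> loop_class T a q
       = loop_class T a (concat_paths p q)"
proof -
  have "loop_class T a (concat_paths p' q') = loop_class T a (concat_paths p q)"
    if "p' \<in> loop_class T a p" "q' \<in> loop_class T a q" for p' q'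
  proof -
    have "p' \<in> loops T a" "q' \<in> loops T a" "loop_homotopic T a p' p" "loop_homotopic T a q' q"
      using that by (auto simp: loop_class_eq loop_homotopic_sym)
    then show ?thesis
      using assms by (simp add: loop_class_eq_iff concat_in_loops loop_homotopic_concat)
  qed
  then have "(\<Union>p'\<in>loop_class T a p. \<Union>q'\<in>loop_class T a q. loop_class T a (concat_paths p' q'))
      = (\<Union>p'\<in>loop_class T a p. \<Union>q'\<in>loop_class T a q. loop_class T a (concat_paths p q))"
    by simp
  then show ?thesis
    using loop_in_own_class[OF assms(1)] loop_in_own_class[OF assms(2)]
    by (auto simp: fundamental_group_def)
qed

lemma fundamental_group_one:
  "\<one>\<^bsub>fundamental_group T a\<^esub> = loop_class T a (\<lambda>_. a)"
  by (simp add: fundamental_group_def)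

lemma loop_homotopic_assoc:
  assumes "p \<in> loops T a" "q \<in> loops T a" "r \<in> loops T a"
  shows "loop_homotopic T a (concat_paths (concat_paths p q) r) (concat_paths p (concat_paths q r))"
proof (rule loop_homotopic_reparametrize)
  let ?f = "\<lambda>t::real. min (2 * t) (min (t + 1/4) ((t + 1)/2))"
  show "pathin T (concat_paths p (concat_paths q r))"
    using assms by (intro loops_pathinD concat_in_loops)
  show "continuous_on {0..1} ?f" by (intro continuous_intros) auto
  show "?f ` {0..1} \<subseteq> {0..1}" by (auto simp: min_def)
  show "continuous_on {0..1} (\<lambda>t::real. t)" by simp
  fix t :: real assume t: "t \<in> {0..1}"
  consider "t \<le> 1/4" | "1/4 < t" "t \<le> 1/2" | "1/2 < t" by linarith
  then show "concat_paths (concat_paths p q) r t = concat_paths p (concat_paths q r) (?f t)"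
  proof cases
    case 1 then have "?f t = 2 * t" using t by simp
    then show ?thesis using 1 by (simp add: concat_paths_def)
  next
    case 2 then have "?f t = t + 1/4" using t by simp
    moreover have "2 * (2 * (t + 1/4) - 1) = 2 * (2 * t) - 1" "t + 1/4 \<le> 1/2 \<longleftrightarrow> t \<le> 1/4"
      "2 * (t + 1/4) - 1 \<le> 1/2" using 2 by (simp_all add: algebra_simps)
    ultimately show ?thesis using 2 by (simp only: concat_paths_def) simp
  next
    case 3 then have "?f t = (t + 1)/2" using t by simp
    then show ?thesis using 3 assms by (auto simp: concat_paths_def field_simps loops_def)
  qed
qed (use assms in \<open>auto simp: concat_paths_def loops_def\<close>)

lemma loop_homotopic_const_left:
  assumes "p \<in> loops T a" shows "loop_homotopic T a (concat_paths (\<lambda>_. a) p) p"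
proof (rule loop_homotopic_reparametrize)
  show "pathin T p" using assms by (rule loops_pathinD)
  show "continuous_on {0..1} (\<lambda>t::real. max 0 (2 * t - 1))" by (intro continuous_intros)
  show "concat_paths (\<lambda>_. a) p t = p (max 0 (2 * t - 1))" for t
    using assms by (auto simp: concat_paths_def loops_def max_def dest: antisym)
qed (use assms in \<open>auto simp: loops_def max_def\<close>)

lemma loop_homotopic_reverse_left:
  assumes "p \<in> loops T a"
  shows "loop_homotopic T a (concat_paths (p \<circ> (\<lambda>t. 1 - t)) p) (\<lambda>_. a)"
proof (rule loop_homotopic_reparametrize)
  show "pathin T p" using assms by (rule loops_pathinD)
  show "continuous_on {0..1} (\<lambda>t::real. \<bar>1 - 2 * t\<bar>)" by (intro continuous_intros)
  show "concat_paths (p \<circ> (\<lambda>t. 1 - t)) p t = p \<bar>1 - 2 * t\<bar>" for t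
    by (auto simp: concat_paths_def abs_if)
  show "continuous_on {0..1} (\<lambda>_. 1 :: real)" by simp
qed (use assms in \<open>auto simp: loops_def\<close>)

lemma pathin_start_in_topspace: "p \<in> loops T a \<Longrightarrow> a \<in> topspace T"
  unfolding loops_def pathin_def continuous_map_def Pi_def by auto

theorem group_fundamental_group:
  assumes "a \<in> topspace T" shows "group (fundamental_group T a)"
proof (rule groupI)
  let ?G = "fundamental_group T a"
  note c = const_in_loops[OF assms]
  fix x assume x: "x \<in> carrier ?G"
  then obtain p where p: "p \<in> loops T a" "x = loop_class T a p"
    by (auto simp: fundamental_group_carrier)
  show "\<one>\<^bsub>?G\<^esub> \<otimes>\<^bsub>?G\<^esub> x = x"
    using p c by (simp add: fundamental_group_one fundamental_group_mult loop_class_eq_iff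
        concat_in_loops loop_homotopic_const_left)
  show "\<exists>y\<in>carrier ?G. y \<otimes>\<^bsub>?G\<^esub> x = \<one>\<^bsub>?G\<^esub>"
    using p c by (intro bexI[of _ "loop_class T a (p \<circ> (\<lambda>t. 1 - t))"])
      (simp_all add: fundamental_group_one fundamental_group_mult loop_class_eq_iff
        concat_in_loops loop_homotopic_reverse_left reverse_in_loops fundamental_group_carrier)
  fix y assume "y \<in> carrier ?G"
  then obtain q where q: "q \<in> loops T a" "y = loop_class T a q"
    by (auto simp: fundamental_group_carrier)
  show "x \<otimes>\<^bsub>?G\<^esub> y \<in> carrier ?G"
    using p q by (simp add: fundamental_group_mult concat_in_loops fundamental_group_carrier)
  fix z assume "z \<in> carrier ?G"
  then obtain r where r: "r \<in> loops T a" "z = loop_class T a r"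
    by (auto simp: fundamental_group_carrier)
  show "x \<otimes>\<^bsub>?G\<^esub> y \<otimes>\<^bsub>?G\<^esub> z = x \<otimes>\<^bsub>?G\<^esub> (y \<otimes>\<^bsub>?G\<^esub> z)"
    using p q r by (simp add: fundamental_group_mult loop_class_eq_iff concat_in_loops
        loop_homotopic_assoc)
qed (simp add: fundamental_group_one fundamental_group_carrier const_in_loops[OF assms])

lemma fundamental_group_inv:
  assumes "p \<in> loops T a"
  shows "inv\<^bsub>fundamental_group T a\<^esub> (loop_class T a p) = loop_class T a (p \<circ> (\<lambda>t. 1 - t))"
proof -
  interpret group "fundamental_group T a"
    using assms by (intro group_fundamental_group pathin_start_in_topspace)
  have c: "(\<lambda>_. a) \<in> loops T a" using assms by (intro const_in_loops pathin_start_in_topspace)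
  show ?thesis
    using assms c by (intro inv_equality)
      (simp_all add: fundamental_group_one fundamental_group_mult loop_class_eq_iff
        concat_in_loops loop_homotopic_reverse_left reverse_in_loops fundamental_group_carrier)
qed

lemma loop_homotopic_compose:
  assumes "continuous_map T T' f" "loop_homotopic T a p q"
  shows "loop_homotopic T' (f a) (f \<circ> p) (f \<circ> q)"
  using assms(2) unfolding loop_homotopic_def
  by (rule homotopic_with_compose_continuous_map_left) (use assms(1) in auto)

lemma compose_in_loops:
  assumes "continuous_map T T' f" "p \<in> loops T a"
  shows "f \<circ> p \<in> loops T' (f a)"
  using assms by (auto simp: loops_def pathin_def intro: continuous_map_compose)

lemma induced_map_loop_class:
  assumes "continuous_map T T' f" "p \<in> loops T a"
  shows "induced_map T' f a (loop_class T a p) = loop_class T' (f a) (f \<circ> p)"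
proof -
  have "loop_class T' (f a) (f \<circ> p') = loop_class T' (f a) (f \<circ> p)"
    if "p' \<in> loop_class T a p" for p'
    using that assms
    by (simp add: loop_class_eq_iff compose_in_loops loop_class_eq[of T] loop_homotopic_compose
        loop_homotopic_sym)
  then show ?thesis
    using loop_in_own_class[OF assms(2)] unfolding induced_map_def by blast
qed

lemma induced_map_hom:
  assumes "continuous_map T T' f"
  shows "induced_map T' f a \<in> hom (fundamental_group T a) (fundamental_group T' (f a))"
proof (rule homI)
  fix x assume "x \<in> carrier (fundamental_group T a)"
  then obtain p where p: "p \<in> loops T a" "x = loop_class T a p"
    by (auto simp: fundamental_group_carrier)
  then show "induced_map T' f a x \<in> carrier (fundamental_group T' (f a))"
    using assms by (simp add: induced_map_loop_class compose_in_loops fundamental_group_carrier)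
  fix y assume "y \<in> carrier (fundamental_group T a)"
  then obtain q where q: "q \<in> loops T a" "y = loop_class T a q"
    by (auto simp: fundamental_group_carrier)
  have "f \<circ> concat_paths p q = concat_paths (f \<circ> p) (f \<circ> q)"
    by (auto simp: concat_paths_def)
  with p q show "induced_map T' f a (x \<otimes>\<^bsub>fundamental_group T a\<^esub> y) =
      induced_map T' f a x \<otimes>\<^bsub>fundamental_group T' (f a)\<^esub> induced_map T' f a y"
    using assms by (simp add: induced_map_loop_class compose_in_loops fundamental_group_mult
        concat_in_loops)
qed

lemma loops_top_of_set:
  "p \<in> loops (top_of_set S) a \<longleftrightarrow>
     path p \<and> path_image p \<subseteq> S \<and> pathstart p = a \<and> pathfinish p = a"
  by (auto simp: loops_def pathin_def path_def path_image_def pathstart_def pathfinish_def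
      continuous_map_in_subtopology)

lemma loop_homotopic_top_of_set:
  assumes "pathstart p = a" "pathfinish p = a"
  shows "loop_homotopic (top_of_set S) a p q \<longleftrightarrow> homotopic_paths S p q"
  using assms by (simp add: loop_homotopic_def homotopic_paths_def pathstart_def pathfinish_def)

lemma concat_paths_eq_joinpaths: "concat_paths = (+++)"
  by (simp add: fun_eq_iff concat_paths_def joinpaths_def)

section \<open>Lifting along the orbit map of a free finite action\<close>

locale free_finite_action =
  fixes X :: "'a::real_normed_vector set" and F :: "('a \<Rightarrow> 'a) set" and q :: "'a \<Rightarrow> 'b"
  assumes open_X: "open X" and finite_F: "finite F"
    and id_F: "(\<lambda>v. v) \<in> F"
    and cont_F: "f \<in> F \<Longrightarrow> continuous_on X f"
    and onto_F: "f \<in> F \<Longrightarrow> f ` X = X" and inj_F: "f \<in> F \<Longrightarrow> inj_on f X"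
    and orbit_F: "u \<in> X \<Longrightarrow> v \<in> X \<Longrightarrow> q u = q v \<longleftrightarrow> (\<exists>f\<in>F. v = f u)"
    and free_F: "f \<in> F \<Longrightarrow> g \<in> F \<Longrightarrow> v \<in> X \<Longrightarrow> f v = g v \<Longrightarrow> f = g"
begin

definition quot :: "'b topology" where
  "quot = quotient_topology (top_of_set X) q"

lemma in_X: "f \<in> F \<Longrightarrow> v \<in> X \<Longrightarrow> f v \<in> X"
  using onto_F by blast

lemma q_F: "f \<in> F \<Longrightarrow> v \<in> X \<Longrightarrow> q (f v) = q v"
  using orbit_F[of v "f v"] in_X by metis

lemma openin_quot: "openin quot A \<longleftrightarrow> A \<subseteq> q ` X \<and> openin (top_of_set X) {v \<in> X. q v \<in> A}"
  by (simp add: quot_def openin_quotient_topology)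

lemma topspace_quot: "topspace quot = q ` X"
  by (simp add: quot_def)

lemma continuous_map_q: "continuous_map (top_of_set X) quot q"
  unfolding quot_def by (rule quotient_imp_continuous_map[OF quotient_map_quotient_topology])

lemma open_preimage_F:
  assumes "open U" "U \<subseteq> X" "f \<in> F" shows "open {v \<in> X. f v \<in> U}"
proof -
  have "open (X \<inter> f -` U)" using continuous_open_preimage[OF cont_F[OF assms(3)] open_X assms(1)] .
  then show ?thesis by (simp add: vimage_def Int_def)
qed

lemma openin_q_image:
  assumes "open U" "U \<subseteq> X" shows "openin quot (q ` U)"
proof -
  have "{v \<in> X. q v \<in> q ` U} = (\<Union>f\<in>F. {v \<in> X. f v \<in> U})"
    using assms(2) orbit_F q_F by (auto simp: image_iff) (metis subsetD)+
  also have "open \<dots>" using assms by (intro open_UN ballI open_preimage_F)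
  finally show ?thesis
    using assms(2) open_X by (auto simp: openin_quot openin_open_eq)
qed

text \<open>Each map other than the identity moves \<open>v0\<close> to a point that can be separated from it.\<close>

lemma locally_injective:
  assumes "v0 \<in> X"
  obtains U where "open U" "v0 \<in> U" "U \<subseteq> X" "inj_on q U"
proof -
  let ?F = "F - {\<lambda>v. v}"
  have "\<exists>U. open U \<and> v0 \<in> U \<and> U \<subseteq> X \<and> (\<forall>u\<in>U. k u \<notin> U)" if "k \<in> ?F" for k
  proof -
    have "k v0 \<noteq> v0" using that id_F free_F[of k "\<lambda>v. v" v0] assms by auto
    then obtain A B where AB: "open A" "open B" "v0 \<in> A" "k v0 \<in> B" "A \<inter> B = {}"
      using hausdorff by metis
    have "open {v \<in> X. k v \<in> X \<inter> B}" using AB that open_X by (intro open_preimage_F) auto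
    then have "open (A \<inter> {v \<in> X. k v \<in> X \<inter> B})" using AB by blast
    then show ?thesis
      using AB that assms in_X by (intro exI[of _ "A \<inter> {v \<in> X. k v \<in> X \<inter> B}"]) blast
  qed
  then obtain U where U: "\<And>k. k \<in> ?F \<Longrightarrow> open (U k) \<and> v0 \<in> U k \<and> U k \<subseteq> X \<and> (\<forall>u\<in>U k. k u \<notin> U k)"
    by metis
  show thesis
  proof (rule that)
    show "open (X \<inter> (\<Inter>k\<in>?F. U k))" using U finite_F open_X by (intro open_Int open_INT) auto
    show "v0 \<in> X \<inter> (\<Inter>k\<in>?F. U k)" using U assms by auto
    show "inj_on q (X \<inter> (\<Inter>k\<in>?F. U k))"
    proof (rule inj_onI, rule ccontr)
      fix u u' assume u: "u \<in> X \<inter> (\<Inter>k\<in>?F. U k)" "u' \<in> X \<inter> (\<Inter>k\<in>?F. U k)" "q u = q u'" "u \<noteq> u'"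
      then obtain f where "f \<in> F" "u' = f u" using orbit_F by auto
      moreover from this u have "f \<in> ?F" by auto
      ultimately show False using u U by blast
    qed
  qed auto
qed

text \<open>The orbit space lies in no type class, while the pullback of the orbit map along a map from
  a normed space does; lifts of the map are sections of this pullback.\<close>

definition pullback :: "'c set \<Rightarrow> ('c \<Rightarrow> 'b) \<Rightarrow> ('c \<times> 'a) set" where
  "pullback K h = {z. fst z \<in> K \<and> snd z \<in> X \<and> h (fst z) = q (snd z)}"

text \<open>Since the orbit map is open, the first components of the points of the pullback in a small box
  fill a neighbourhood.\<close>

lemma pullback_fst_open:
  fixes K :: "'c::real_normed_vector set"
  assumes h: "continuous_map (top_of_set K) quot h"
    and V: "open V" "V \<subseteq> X" and z: "z \<in> K" "h z \<in> q ` V" "open A" "z \<in> A"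
  shows "\<exists>T. openin (top_of_set K) T \<and> z \<in> T \<and> T \<subseteq> fst ` (pullback K h \<inter> (A \<times> V))"
proof (intro exI conjI)
  let ?T = "{z \<in> K. h z \<in> q ` V} \<inter> A"
  have "openin (top_of_set K) {z \<in> topspace (top_of_set K). h z \<in> q ` V}"
    using h openin_q_image[OF V] by (rule openin_continuous_map_preimage)
  then show "openin (top_of_set K) ?T"
    using z(3) by (simp add: openin_Int_open)
  show "z \<in> ?T" using z by auto
  show "?T \<subseteq> fst ` (pullback K h \<inter> (A \<times> V))"
  proof clarify
    fix z v assume "z \<in> K" "v \<in> V" "h z = q v" "z \<in> A"
    then have "(z, v) \<in> pullback K h \<inter> (A \<times> V)" using V by (auto simp: pullback_def)
    then show "z \<in> fst ` (pullback K h \<inter> (A \<times> V))" by (metis fst_conv imageI)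
  qed
qed

text \<open>Let \<open>U\<close> be a small set on which the orbit map is injective.  Over the points that \<open>h\<close> maps to
  orbits of \<open>U\<close>, the pullback is the disjoint union of the sheets on which a given map of \<open>F\<close> moves
  the second component into \<open>U\<close>.\<close>

lemma covering_space_pullback:
  fixes K :: "'c::real_normed_vector set"
  assumes h: "continuous_map (top_of_set K) quot h"
  shows "covering_space (pullback K h) fst K"
proof
  let ?E = "pullback K h"
  have hK: "h z \<in> q ` X" if "z \<in> K" for z
    using h that topspace_quot by (metis continuous_map_image_subset_topspace image_subset_iff
        topspace_euclidean_subtopology)
  show "continuous_on ?E fst" by (intro continuous_intros)
  show "fst ` ?E = K"
  proof
    show "K \<subseteq> fst ` ?E"
    proof
      fix z assume "z \<in> K"
      with hK obtain v where "(z, v) \<in> ?E" by (auto simp: pullback_def)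
      then show "z \<in> fst ` ?E" by (metis fst_conv imageI)
    qed
  qed (auto simp: pullback_def)
  fix z0 assume z0: "z0 \<in> K"
  obtain v0 where v0: "v0 \<in> X" "h z0 = q v0" using hK[OF z0] by blast
  obtain U where U: "open U" "v0 \<in> U" "U \<subseteq> X" "inj_on q U" using locally_injective[OF v0(1)] .
  define T where "T = {z \<in> K. h z \<in> q ` U}"
  define S where "S = (\<lambda>f. {z \<in> ?E. f (snd z) \<in> U})"
  have opT: "openin (top_of_set K) T"
    using openin_continuous_map_preimage[OF h openin_q_image[OF U(1,3)]] by (simp add: T_def)
  have sub: "z \<in> ?E \<and> fst z \<in> T" if "z \<in> S f" "f \<in> F" for z f
    using that q_F[of f "snd z"] by (auto simp: S_def T_def pullback_def image_iff) metis
  have opS: "openin (top_of_set ?E) (S f)" if f: "f \<in> F" for f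
  proof -
    have "S f = ?E \<inter> (UNIV \<times> {v \<in> X. f v \<in> U})" by (auto simp: S_def pullback_def)
    then show ?thesis
      using open_preimage_F[OF U(1,3) f] by (auto simp: open_Times)
  qed
  have "\<Union>(S ` F) = ?E \<inter> fst -` T"
  proof
    show "\<Union>(S ` F) \<subseteq> ?E \<inter> fst -` T" using sub by blast
    show "?E \<inter> fst -` T \<subseteq> \<Union>(S ` F)"
    proof
      fix z assume z: "z \<in> ?E \<inter> fst -` T"
      then obtain u where u: "u \<in> U" "q (snd z) = q u" by (auto simp: T_def pullback_def)
      then obtain f where "f \<in> F" "u = f (snd z)"
        using orbit_F[of "snd z" u] z U(3) by (auto simp: pullback_def)
      then show "z \<in> \<Union>(S ` F)" using z u by (auto simp: S_def)
    qed
  qed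
  moreover have "pairwise disjnt (S ` F)"
  proof (clarsimp simp: pairwise_def)
    fix f g assume fg: "f \<in> F" "g \<in> F" "S f \<noteq> S g"
    show "disjnt (S f) (S g)"
    proof (rule ccontr)
      assume "\<not> disjnt (S f) (S g)"
      then obtain z where z: "z \<in> ?E" "f (snd z) \<in> U" "g (snd z) \<in> U" by (auto simp: S_def disjnt_def)
      then have "f (snd z) = g (snd z)"
        using inj_onD[OF U(4)] q_F fg by (auto simp: pullback_def)
      then show False using free_F[OF fg(1,2)] z fg(3) by (auto simp: pullback_def)
    qed
  qed
  moreover have "\<exists>g. homeomorphism (S f) T fst g" if f: "f \<in> F" for f
  proof -
    have im: "fst ` S f = T"
    proof
      show "T \<subseteq> fst ` S f"
      proof
        fix z assume z: "z \<in> T"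
        then obtain u where u: "u \<in> U" "h z = q u" by (auto simp: T_def)
        then obtain v where "v \<in> X" "u = f v" using onto_F[OF f] U(3) by blast
        then have "(z, v) \<in> S f" using z u q_F[OF f] by (auto simp: S_def pullback_def T_def)
        then show "z \<in> fst ` S f" by (metis fst_conv imageI)
      qed
    qed (use sub f in blast)
    have inj: "inj_on fst (S f)"
    proof (rule inj_onI)
      fix z z' assume zz: "z \<in> S f" "z' \<in> S f" "fst z = fst z'"
      then have "q (snd z) = q (snd z')" and XX: "snd z \<in> X" "snd z' \<in> X"
        by (auto simp: S_def pullback_def)
      then have "f (snd z) = f (snd z')"
        using inj_onD[OF U(4)] zz q_F[OF f] by (auto simp: S_def)
      then have "snd z = snd z'" using inj_onD[OF inj_F[OF f]] XX by blast
      then show "z = z'" using zz(3) by (simp add: prod_eq_iff)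
    qed
    have op: "openin (top_of_set T) (fst ` O')" if O': "openin (top_of_set (S f)) O'" for O'
    proof (subst openin_subopen, intro ballI)
      fix z assume "z \<in> fst ` O'"
      then obtain v where zv: "(z, v) \<in> O'" by auto
      obtain Q where Q: "open Q" "O' = S f \<inter> Q" using O' by (auto simp: openin_open)
      have "(z, v) \<in> Q" using zv Q(2) by blast
      with Q(1) obtain A B where "open A" "open B" "(z, v) \<in> A \<times> B" "A \<times> B \<subseteq> Q"
        by (rule open_prod_elim)
      then have AB: "open A" "open B" "z \<in> A" "v \<in> B" "A \<times> B \<subseteq> Q" by blast+
      let ?V = "B \<inter> {v \<in> X. f v \<in> U}"
      have zvE: "(z, v) \<in> S f" using zv Q by blast
      have "open ?V" using AB(2) open_preimage_F[OF U(1,3) f] by blast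
      moreover have "h z \<in> q ` ?V" "z \<in> K" using zvE AB by (auto simp: S_def pullback_def)
      ultimately obtain T' where T': "openin (top_of_set K) T'" "z \<in> T'"
          "T' \<subseteq> fst ` (?E \<inter> (A \<times> ?V))"
        using pullback_fst_open[OF h, of ?V z A] AB by blast
      have "?E \<inter> (A \<times> ?V) \<subseteq> O'" using AB Q by (auto simp: S_def)
      then have "T' \<subseteq> fst ` O'" using T' by blast
      moreover have "fst ` O' \<subseteq> T" using im Q by blast
      ultimately show "\<exists>T'. openin (top_of_set T) T' \<and> z \<in> T' \<and> T' \<subseteq> fst ` O'"
        using T' openin_subset_trans[OF T'(1), of T] openin_imp_subset[OF opT] by blast
    qed
    obtain g where "homeomorphism (S f) T fst g"
      by (rule homeomorphism_injective_open_map[OF continuous_on_fst[OF continuous_on_id] im inj op])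
    then show ?thesis by (intro exI[of _ g])
  qed
  ultimately show "\<exists>T. z0 \<in> T \<and> openin (top_of_set K) T \<and>
      (\<exists>\<V>. \<Union>\<V> = ?E \<inter> fst -` T \<and> (\<forall>u\<in>\<V>. openin (top_of_set ?E) u) \<and> pairwise disjnt \<V> \<and>
           (\<forall>u\<in>\<V>. \<exists>g. homeomorphism u T fst g))"
  proof (intro exI[of _ T] conjI exI[of _ "S ` F"] opT)
    show "z0 \<in> T" using z0 v0 U(2) by (auto simp: T_def)
  qed (use opS in blast)+
qed

lemma lift_exists:
  fixes K :: "'c::real_normed_vector set"
  assumes "convex K" "continuous_map (top_of_set K) quot h" "z0 \<in> K" "v0 \<in> X" "h z0 = q v0"
  obtains k where "continuous_on K k" "k ` K \<subseteq> X" "k z0 = v0" "\<And>z. z \<in> K \<Longrightarrow> q (k z) = h z"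
proof -
  have "(z0, v0) \<in> pullback K h" using assms by (simp add: pullback_def)
  then obtain g where g: "continuous_on K g" "g \<in> K \<rightarrow> pullback K h" "g z0 = (z0, v0)"
      "\<And>z. z \<in> K \<Longrightarrow> fst (g z) = z"
    by (rule covering_space_lift_strong[OF covering_space_pullback[OF assms(2)] _ assms(3)
          convex_imp_simply_connected[OF assms(1)] convex_imp_locally_path_connected[OF assms(1)],
          of "(z0, v0)" "\<lambda>z. z"]) auto
  show thesis
  proof (rule that)
    show "continuous_on K (\<lambda>z. snd (g z))" using g(1) by (intro continuous_intros)
  qed (use g in \<open>auto simp: pullback_def Pi_iff\<close>)
qed

lemma lift_unique:
  fixes K :: "'c::real_normed_vector set"
  assumes "connected K" and k1: "continuous_on K k1" "k1 ` K \<subseteq> X"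
    and k2: "continuous_on K k2" "k2 ` K \<subseteq> X"
    and eq: "\<And>z. z \<in> K \<Longrightarrow> q (k1 z) = q (k2 z)" and z0: "z0 \<in> K" "k1 z0 = k2 z0" and z: "z \<in> K"
  shows "k1 z = k2 z"
proof -
  have "continuous_map (top_of_set K) (top_of_set X) k1"
    using k1 by (auto simp: continuous_map_in_subtopology)
  from continuous_map_compose[OF this continuous_map_q]
  have "covering_space (pullback K (q \<circ> k1)) fst K" by (rule covering_space_pullback)
  then have "(z, k1 z) = (z, k2 z)"
  proof (rule covering_space_lift_unique[of _ _ _ "\<lambda>z. (z, k1 z)" z0 "\<lambda>z. (z, k2 z)" K "\<lambda>z. z" z])
    show "(\<lambda>z. (z, k1 z)) \<in> K \<rightarrow> pullback K (q \<circ> k1)" "(\<lambda>z. (z, k2 z)) \<in> K \<rightarrow> pullback K (q \<circ> k1)"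
      using k1 k2 eq by (auto simp: pullback_def)
  qed (use assms in \<open>auto intro!: continuous_intros\<close>)
  then show ?thesis by simp
qed

lemma loop_lift:
  assumes p: "p \<in> loops quot (q x)" and x: "x \<in> X"
  obtains \<gamma> f where "path \<gamma>" "path_image \<gamma> \<subseteq> X" "\<gamma> 0 = x" "f \<in> F" "\<gamma> 1 = f x"
    "\<And>t. t \<in> {0..1} \<Longrightarrow> q (\<gamma> t) = p t"
proof -
  obtain k where k: "continuous_on {0..1} k" "k ` {0..1} \<subseteq> X" "k 0 = x"
      "\<And>z. z \<in> {0..1} \<Longrightarrow> q (k z) = p z"
    using lift_exists[of "{0..1::real}" p 0 x] p x by (auto simp: loops_def pathin_def)
  have "q x = q (k 1)" "k 1 \<in> X" using k p by (auto simp: loops_def)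
  then obtain f where "f \<in> F" "k 1 = f x" using orbit_F[OF x] by auto
  then show thesis using k by (intro that[of k f]) (auto simp: path_def path_image_def)
qed

lemma path_projects_to_loop:
  assumes "path \<gamma>" "path_image \<gamma> \<subseteq> X" "\<gamma> 0 = x" "f \<in> F" "\<gamma> 1 = f x"
  shows "q \<circ> \<gamma> \<in> loops quot (q x)"
proof -
  have "continuous_map (top_of_set {0..1}) (top_of_set X) \<gamma>"
    using assms by (auto simp: continuous_map_in_subtopology path_def path_image_def)
  from continuous_map_compose[OF this continuous_map_q]
  have "continuous_map (top_of_set {0..1}) quot (q \<circ> \<gamma>)" .
  moreover have "x \<in> X" using assms by (auto simp: path_image_def)
  ultimately show ?thesis using assms q_F by (simp add: loops_def pathin_def)
qed

text \<open>A homotopy in the orbit space lifts; on the sides of the square where it is constant the lift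
  is constant, and on the other two sides it is the given path.\<close>

lemma homotopic_paths_of_projections:
  assumes \<gamma>: "path \<gamma>" "path_image \<gamma> \<subseteq> X" "\<gamma> 0 = x" and \<delta>: "path \<delta>" "path_image \<delta> \<subseteq> X" "\<delta> 0 = x"
    and hom: "loop_homotopic quot (q x) (q \<circ> \<gamma>) (q \<circ> \<delta>)"
  shows "homotopic_paths X \<gamma> \<delta>"
proof -
  let ?Q = "{0..1} \<times> {0..1} :: (real \<times> real) set"
  from hom obtain h :: "real \<times> real \<Rightarrow> 'b" where h: "continuous_map (top_of_set ?Q) quot h"
      "\<And>t. t \<in> {0..1} \<Longrightarrow> h (0, t) = q (\<gamma> t)" "\<And>t. t \<in> {0..1} \<Longrightarrow> h (1, t) = q (\<delta> t)"
      "\<And>s. s \<in> {0..1} \<Longrightarrow> h (s, 0) = q x \<and> h (s, 1) = q x"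
    unfolding loop_homotopic_iff by auto
  have x: "x \<in> X" using \<gamma> by (auto simp: path_image_def)
  obtain k where k: "continuous_on ?Q k" "k ` ?Q \<subseteq> X" "k (0, 0) = x"
      "\<And>z. z \<in> ?Q \<Longrightarrow> q (k z) = h z"
  proof (rule lift_exists[OF _ h(1), of "(0, 0)" x])
    show "convex ?Q" by (intro convex_Times) simp_all
  qed (use h(4)[of 0] x in auto)
  have side: "continuous_on {0..1} (\<lambda>t. k (c t, d t))" "(\<lambda>t. k (c t, d t)) ` {0..1} \<subseteq> X"
    if "continuous_on {0..1} c" "continuous_on {0..1} d" "\<forall>t\<in>{0..1}. c t \<in> {0..1} \<and> d t \<in> {0..1}"
    for c d :: "real \<Rightarrow> real"
  proof -
    have cd: "(\<lambda>t. (c t, d t)) ` {0..1} \<subseteq> ?Q" using that by blast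
    have "continuous_on {0..1} (\<lambda>t. (c t, d t))" using that by (intro continuous_intros)
    from continuous_on_compose2[OF k(1) this cd]
    show "continuous_on {0..1} (\<lambda>t. k (c t, d t))" .
    show "(\<lambda>t. k (c t, d t)) ` {0..1} \<subseteq> X" using cd k(2) by blast
  qed
  have I: "continuous_on {0..1} \<gamma>" "\<gamma> ` {0..1} \<subseteq> X" "continuous_on {0..1} \<delta>" "\<delta> ` {0..1} \<subseteq> X"
    using \<gamma> \<delta> by (auto simp: path_def path_image_def)
  have kq: "q (k (s, t)) = h (s, t)" if "s \<in> {0..1}" "t \<in> {0..1}" for s t using k(4) that by simp
  have x1: "\<gamma> 1 \<in> X" "q (\<gamma> 1) = q x" using I h(2)[of 1] h(4)[of 0] by auto
  note u = lift_unique[OF connected_Icc, of 0 1]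
  have 1: "k (0, t) = \<gamma> t" if "t \<in> {0..1}" for t
  proof (rule u[of "\<lambda>t. k (0, t)" \<gamma> 0])
    show "q (k (0, t)) = q (\<gamma> t)" if "t \<in> {0..1}" for t using that kq h(2) by simp
  qed (use side[of "\<lambda>_. 0" "\<lambda>t. t"] I k(3) \<gamma>(3) that in auto)
  have 2: "k (s, 0) = x" if "s \<in> {0..1}" for s
  proof (rule u[of "\<lambda>s. k (s, 0)" "\<lambda>_. x" 0])
    show "q (k (t, 0)) = q x" if "t \<in> {0..1}" for t using that kq h(4) by simp
  qed (use side[of "\<lambda>t. t" "\<lambda>_. 0"] x k(3) that in auto)
  have 3: "k (1, t) = \<delta> t" if "t \<in> {0..1}" for t
  proof (rule u[of "\<lambda>t. k (1, t)" \<delta> 0])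
    show "q (k (1, t)) = q (\<delta> t)" if "t \<in> {0..1}" for t using that kq h(3) by simp
  qed (use side[of "\<lambda>_. 1" "\<lambda>t. t"] I 2[of 1] \<delta>(3) that in auto)
  have 4: "k (s, 1) = \<gamma> 1" if "s \<in> {0..1}" for s
  proof (rule u[of "\<lambda>s. k (s, 1)" "\<lambda>_. \<gamma> 1" 0])
    show "q (k (t, 1)) = q (\<gamma> 1)" if "t \<in> {0..1}" for t using that kq h(4) x1 by simp
  qed (use side[of "\<lambda>t. t" "\<lambda>_. 1"] x1 1[of 1] that in auto)
  show ?thesis
    unfolding homotopic_paths
    by (rule exI[of _ k]) (use k 1 2 3 4 \<gamma> in \<open>auto simp: pathstart_def pathfinish_def\<close>)
qed

end

section \<open>Loops modulo commutators\<close>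

abbreviation pi1 :: "'a::topological_space set \<Rightarrow> 'a \<Rightarrow> (real \<Rightarrow> 'a) set monoid" where
  "pi1 S a \<equiv> fundamental_group (top_of_set S) a"

abbreviation path_class :: "'a::topological_space set \<Rightarrow> 'a \<Rightarrow> (real \<Rightarrow> 'a) \<Rightarrow> (real \<Rightarrow> 'a) set" where
  "path_class S a p \<equiv> loop_class (top_of_set S) a p"

abbreviation null_homologous :: "'a::topological_space set \<Rightarrow> 'a \<Rightarrow> (real \<Rightarrow> 'a) \<Rightarrow> bool" where
  "null_homologous S a p \<equiv> path_class S a p \<in> derived (pi1 S a) (carrier (pi1 S a))"

definition path_in :: "'a::real_normed_vector set \<Rightarrow> 'a \<Rightarrow> 'a \<Rightarrow> (real \<Rightarrow> 'a) \<Rightarrow> bool" where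
  "path_in Y a b p \<longleftrightarrow> path p \<and> path_image p \<subseteq> Y \<and> pathstart p = a \<and> pathfinish p = b"

lemma path_in_join: "path_in Y a b p \<Longrightarrow> path_in Y b c q \<Longrightarrow> path_in Y a c (p +++ q)"
  by (auto simp: path_in_def path_image_join)

lemma path_in_reverse: "path_in Y a b p \<Longrightarrow> path_in Y b a (reversepath p)"
  by (simp add: path_in_def)

lemma path_in_const: "a \<in> Y \<Longrightarrow> path_in Y a a (linepath a a)"
  by (simp add: path_in_def)

lemma path_in_mono: "path_in U a b p \<Longrightarrow> U \<subseteq> Y \<Longrightarrow> path_in Y a b p"
  by (auto simp: path_in_def)

lemma loops_path_in: "p \<in> loops (top_of_set Y) a \<longleftrightarrow> path_in Y a a p"
  by (auto simp: loops_top_of_set path_in_def)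

lemmas path_in_intros = path_in_join path_in_reverse path_in_const

lemma path_in_endpoints: "path_in Y a b p \<Longrightarrow> a \<in> Y \<and> b \<in> Y"
  by (auto simp: path_in_def)

lemma loop_class_top_of_set_eq:
  assumes "path_in Y a a p" "path_in Y a a q" "homotopic_paths Y p q"
  shows "path_class Y a p = path_class Y a q"
  using assms by (simp add: loop_class_eq_iff loops_path_in loop_homotopic_top_of_set path_in_def)

lemma loop_class_homotopic:
  assumes "path_in Y a a p" "homotopic_paths Y p q"
  shows "path_class Y a p = path_class Y a q"
  using assms homotopic_paths_imp_path[OF assms(2)] homotopic_paths_imp_subset[OF assms(2)]
    homotopic_paths_imp_pathstart[OF assms(2)] homotopic_paths_imp_pathfinish[OF assms(2)]
  by (intro loop_class_top_of_set_eq) (auto simp: path_in_def)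

lemma pi1_mult:
  assumes "path_in Y a a p" "path_in Y a a q"
  shows "path_class Y a p \<otimes>\<^bsub>pi1 Y a\<^esub> path_class Y a q
       = path_class Y a (p +++ q)"
  using assms by (simp add: fundamental_group_mult loops_path_in concat_paths_eq_joinpaths)

lemma pi1_inv:
  assumes "path_in Y a a p"
  shows "inv\<^bsub>pi1 Y a\<^esub> (path_class Y a p)
       = path_class Y a (reversepath p)"
  using assms by (simp add: fundamental_group_inv loops_path_in reversepath_def o_def)

lemma pi1_carrier:
  "carrier (pi1 Y a) = path_class Y a ` {p. path_in Y a a p}"
  by (auto simp: fundamental_group_carrier loops_path_in)

lemma group_pi1: "a \<in> Y \<Longrightarrow> group (pi1 Y a)"
  by (simp add: group_fundamental_group)

lemma homotopic_path_in_refl: "path_in Y a b p \<Longrightarrow> homotopic_paths Y p p"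
  by (simp add: path_in_def)

lemma homotopic_cancel:
  assumes d: "path_in Y a b d" and r: "path_in Y b c r"
  shows "homotopic_paths Y (reversepath d +++ (d +++ r)) r"
proof -
  note [trans] = homotopic_paths_trans
  have "homotopic_paths Y (reversepath d +++ (d +++ r)) ((reversepath d +++ d) +++ r)"
    using assms by (intro homotopic_paths_assoc) (auto simp: path_in_def)
  also have "homotopic_paths Y \<dots> (linepath b b +++ r)"
    using assms homotopic_paths_linv[of d Y]
    by (intro homotopic_paths_join) (auto simp: path_in_def)
  also have "homotopic_paths Y \<dots> r"
    using r by (intro homotopic_paths_lid') (auto simp: path_in_def)
  finally show ?thesis .
qed

lemma homotopic_assoc:
  assumes "path_in Y a b p" "path_in Y b c q" "path_in Y c d r"
  shows "homotopic_paths Y ((p +++ q) +++ r) (p +++ (q +++ r))"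
  using assms by (intro homotopic_paths_sym[OF homotopic_paths_assoc]) (auto simp: path_in_def)

text \<open>Closing up paths along fixed paths \<open>d\<close> to a base point turns concatenation into multiplication.
  This serves both for a change of base point and for cutting a loop into pieces.\<close>

lemma homotopic_conjugates_join:
  assumes d: "path_in Y y a d1" "path_in Y y b d2" "path_in Y y c d3"
    and p: "path_in Y a b p" and q: "path_in Y b c q"
  shows "homotopic_paths Y ((d1 +++ (p +++ reversepath d2)) +++ (d2 +++ (q +++ reversepath d3)))
           (d1 +++ ((p +++ q) +++ reversepath d3))"
proof -
  note [trans] = homotopic_paths_trans
  note * = path_in_intros d p q
  have s: "pathfinish d1 = a" "pathstart p = a" "pathfinish p = b" "pathstart q = b" "pathfinish d2 = b"
    using d p q by (auto simp: path_in_def)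
  have "homotopic_paths Y ((d1 +++ (p +++ reversepath d2)) +++ (d2 +++ (q +++ reversepath d3)))
      (d1 +++ ((p +++ reversepath d2) +++ (d2 +++ (q +++ reversepath d3))))"
    by (rule homotopic_assoc) (rule *)+
  also have "homotopic_paths Y \<dots> (d1 +++ (p +++ (reversepath d2 +++ (d2 +++ (q +++ reversepath d3)))))"
    by (rule homotopic_paths_join[OF homotopic_path_in_refl homotopic_assoc]) (rule * | simp add: s)+
  also have "homotopic_paths Y \<dots> (d1 +++ (p +++ (q +++ reversepath d3)))"
    by (rule homotopic_paths_join[OF homotopic_path_in_refl homotopic_paths_join[OF
            homotopic_path_in_refl homotopic_cancel]]) (rule * | simp add: s)+
  also have "homotopic_paths Y \<dots> (d1 +++ ((p +++ q) +++ reversepath d3))"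
    by (rule homotopic_paths_join[OF homotopic_path_in_refl homotopic_paths_sym[OF homotopic_assoc]])
       (rule * | simp add: s)+
  finally show ?thesis .
qed

lemma homotopic_unconjugate:
  assumes d: "path_in Y y z d" and p: "path_in Y y y p"
  shows "homotopic_paths Y (d +++ ((reversepath d +++ (p +++ d)) +++ reversepath d)) p"
proof -
  note [trans] = homotopic_paths_trans
  note * = path_in_intros d p
  have s: "pathstart d = y" "pathfinish d = z" "pathstart p = y" "pathfinish p = y"
    using d p by (auto simp: path_in_def)
  have "homotopic_paths Y (d +++ ((reversepath d +++ (p +++ d)) +++ reversepath d))
      (d +++ (reversepath d +++ ((p +++ d) +++ reversepath d)))"
    by (rule homotopic_paths_join[OF homotopic_path_in_refl homotopic_assoc]) (rule * | simp add: s)+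
  also have "homotopic_paths Y \<dots> ((p +++ d) +++ reversepath d)"
    using homotopic_cancel[OF path_in_reverse[OF d]
        path_in_join[OF path_in_join[OF p d] path_in_reverse[OF d]]] by simp
  also have "homotopic_paths Y \<dots> (p +++ (d +++ reversepath d))"
    by (rule homotopic_assoc) (rule *)+
  also have "homotopic_paths Y \<dots> (p +++ linepath y y)"
    using d p homotopic_paths_rinv[of d Y]
    by (intro homotopic_paths_join) (auto simp: path_in_def)
  also have "homotopic_paths Y \<dots> p"
    using p by (intro homotopic_paths_rid') (auto simp: path_in_def)
  finally show ?thesis .
qed

section \<open>Homomorphisms and the derived group\<close>

text \<open>This is applied to winding numbers, as functions of a homotopy class of loops.\<close>

lemma (in group) additive_vanishes_on_derived:
  fixes f :: "'a \<Rightarrow> 'c::ab_group_add"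
  assumes add: "\<And>x y. x \<in> carrier G \<Longrightarrow> y \<in> carrier G \<Longrightarrow> f (x \<otimes> y) = f x + f y"
    and "x \<in> derived G (carrier G)"
  shows "f x = 0"
proof -
  have f_one: "f \<one> = 0" using add[of \<one> \<one>] by simp
  have f_inv: "f (inv x) = - f x" if "x \<in> carrier G" for x
    using add[of x "inv x"] that f_one by (simp add: eq_neg_iff_add_eq_0 add.commute)
  have set: "f h = 0" "h \<in> carrier G" if "h \<in> derived_set G (carrier G)" for h
    using that by (auto simp: add f_inv)
  show ?thesis
    using assms(2) unfolding derived_def
  proof (induction rule: generate.induct)
    case one
    show ?case by (rule f_one)
  next
    case (incl h)
    then show ?case by (rule set(1))
  next
    case (inv h)
    then show ?case using set[OF inv] by (simp add: f_inv)
  next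
    case (eng h1 h2)
    then have "h1 \<in> carrier G" "h2 \<in> carrier G"
      using generate_in_carrier[OF derived_set_in_carrier[OF subset_refl]] by blast+
    then show ?case using eng add[of h1 h2] by simp
  qed
qed

lemma derived_hom_image:
  assumes "group G" "group H" "h \<in> hom G H" "x \<in> derived G (carrier G)"
  shows "h x \<in> derived H (carrier H)"
proof -
  interpret group_hom G H h using assms by (simp add: group_hom_def group_hom_axioms_def)
  have "h x \<in> derived H (h ` carrier G)" using derived_img[of "carrier G"] assms(4) by blast
  then show ?thesis using H.mono_derived[of "carrier H" "h ` carrier G"] H.mono_derived[of "h ` carrier G" "carrier H"]
    hom_carrier[OF assms(3)] by auto
qed

text \<open>The quotient by the derived group is abelian, so there the elements of the two subgroups can
  be collected.\<close>

lemma (in group) generate_two_subgroups_mod_derived: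
  assumes H: "subgroup H G" and K: "subgroup K G" and x: "x \<in> generate G (H \<union> K)"
  shows "\<exists>h\<in>H. \<exists>k\<in>K. \<exists>d\<in>derived G (carrier G). x = d \<otimes> (h \<otimes> k)"
proof -
  let ?D = "derived G (carrier G)"
  have nD: "?D \<lhd> G" by (rule derived_self_is_normal)
  interpret D: normal ?D G by (rule nD)
  interpret Q: comm_group "G Mod ?D" by (rule derived_quot_is_comm_group)
  define \<pi> where "\<pi> = (\<lambda>x. ?D #> x)"
  have pi: "\<pi> \<in> hom G (G Mod ?D)" unfolding \<pi>_def by (rule D.r_coset_hom_Mod)
  have HK: "h \<in> carrier G" if "h \<in> H \<union> K" for h
    using that subgroup.subset[OF H] subgroup.subset[OF K] by auto
  have mult: "\<pi> (a \<otimes> b) = \<pi> a \<otimes>\<^bsub>G Mod ?D\<^esub> \<pi> b" if "a \<in> carrier G" "b \<in> carrier G" for a b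
    using hom_mult[OF pi] that by blast
  have cl: "\<pi> a \<in> carrier (G Mod ?D)" if "a \<in> carrier G" for a using hom_in_carrier[OF pi] that by blast
  from x have "\<exists>h\<in>H. \<exists>k\<in>K. \<pi> x = \<pi> (h \<otimes> k)"
  proof (induction rule: generate.induct)
    case one
    then show ?case using subgroup.one_closed[OF H] subgroup.one_closed[OF K] by force
  next
    case (incl g)
    then show ?case
      using subgroup.one_closed[OF H] subgroup.one_closed[OF K] HK l_one r_one by (metis UnE UnI1 UnI2)
  next
    case (inv g)
    then show ?case
      using subgroup.one_closed[OF H] subgroup.one_closed[OF K] HK l_one r_one inv_closed
        subgroup.m_inv_closed[OF H] subgroup.m_inv_closed[OF K] by (metis UnE)
  next
    case (eng g g')
    then obtain h k h' k' where e: "h \<in> H" "k \<in> K" "\<pi> g = \<pi> (h \<otimes> k)"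
        "h' \<in> H" "k' \<in> K" "\<pi> g' = \<pi> (h' \<otimes> k')" by blast
    have c: "h \<in> carrier G" "k \<in> carrier G" "h' \<in> carrier G" "k' \<in> carrier G" using e HK by auto
    have "g \<in> carrier G" "g' \<in> carrier G"
      using eng.hyps generate_in_carrier[of "H \<union> K"] HK by auto
    then have "\<pi> (g \<otimes> g') = \<pi> (h \<otimes> k) \<otimes>\<^bsub>G Mod ?D\<^esub> \<pi> (h' \<otimes> k')" using e mult by simp
    also have "\<dots> = \<pi> ((h \<otimes> h') \<otimes> (k \<otimes> k'))"
      using c cl by (simp add: mult Q.m_ac del: mult_FactGroup)
    finally show ?case using e subgroup.m_closed[OF H] subgroup.m_closed[OF K] by blast
  qed
  then obtain h k where hk: "h \<in> H" "k \<in> K" "?D #> x = ?D #> (h \<otimes> k)" unfolding \<pi>_def by blast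
  have "x \<in> carrier G" using x generate_in_carrier[of "H \<union> K"] HK by auto
  then have "x \<in> ?D #> (h \<otimes> k)" using hk rcos_self[OF _ D.is_subgroup] by auto
  then show ?thesis using hk by (auto simp: r_coset_def)
qed

lemma derived_induced_map:
  assumes "continuous_map T T' f" "p \<in> loops T a"
    and "loop_class T a p \<in> derived (fundamental_group T a) (carrier (fundamental_group T a))"
  shows "loop_class T' (f a) (f \<circ> p)
      \<in> derived (fundamental_group T' (f a)) (carrier (fundamental_group T' (f a)))"
proof -
  have "a \<in> topspace T" using assms(2) by (rule pathin_start_in_topspace)
  moreover from this have "f a \<in> topspace T'"
    using assms(1) by (auto simp: continuous_map_def)
  ultimately show ?thesis
    using derived_hom_image[OF group_fundamental_group group_fundamental_group induced_map_hom[OF assms(1)] assms(3)]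
    by (simp add: induced_map_loop_class[OF assms(1,2)])
qed

lemma derived_pi1_mono:
  assumes "U \<subseteq> Y" "path_in U a a p"
    and "null_homologous U a p"
  shows "null_homologous Y a p"
proof -
  have "continuous_map (top_of_set U) (top_of_set Y) (\<lambda>x. x)"
    using assms(1) by (auto simp: continuous_map_in_subtopology)
  from derived_induced_map[OF this, of p a] show ?thesis using assms(2,3) by (simp add: loops_path_in o_def)
qed

text \<open>Conjugation by a path is a homomorphism of fundamental groups.\<close>

lemma derived_pi1_base_change:
  assumes d: "path_in Y y z d" and p: "path_in Y y y p"
    and der: "null_homologous Y z (reversepath d +++ (p +++ d))"
  shows "null_homologous Y y p"
proof -
  let ?G = "\<lambda>y. pi1 Y y" and ?c = "\<lambda>y. path_class Y y"
  define conj where "conj C = ?c y (d +++ ((SOME r. r \<in> C) +++ reversepath d))" for C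
  have conj: "conj (?c z r) = ?c y (d +++ (r +++ reversepath d))" if r: "path_in Y z z r" for r
  proof -
    define r' where "r' = (SOME r'. r' \<in> ?c z r)"
    have "r' \<in> ?c z r"
      unfolding r'_def using loop_in_own_class[of r "top_of_set Y" z] r
      by (intro someI[of "\<lambda>r'. r' \<in> ?c z r"]) (simp add: loops_path_in)
    then have r': "path_in Y z z r'" "homotopic_paths Y r r'"
      using r by (auto simp: loop_class_eq loops_path_in loop_homotopic_top_of_set path_in_def)
    have "homotopic_paths Y (d +++ (r' +++ reversepath d)) (d +++ (r +++ reversepath d))"
      using r r' d
      by (intro homotopic_paths_join homotopic_paths_sym[OF r'(2)]) (auto simp: path_in_def)
    then show ?thesis
      unfolding conj_def r'_def[symmetric]
      using d r' by (intro loop_class_homotopic) (auto intro!: path_in_intros)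
  qed
  have hom: "conj \<in> hom (?G z) (?G y)"
  proof (rule homI)
    fix C assume "C \<in> carrier (?G z)"
    then obtain r where r: "path_in Y z z r" "C = ?c z r" by (auto simp: pi1_carrier)
    have dr: "path_in Y y y (d +++ (r +++ reversepath d))" if "path_in Y z z r" for r
      using d that by (intro path_in_intros)
    show "conj C \<in> carrier (?G y)" using r dr by (auto simp: conj pi1_carrier)
    fix D assume "D \<in> carrier (?G z)"
    then obtain s where s: "path_in Y z z s" "D = ?c z s" by (auto simp: pi1_carrier)
    show "conj (C \<otimes>\<^bsub>?G z\<^esub> D) = conj C \<otimes>\<^bsub>?G y\<^esub> conj D"
      using r s dr loop_class_homotopic[OF path_in_join[OF dr[OF r(1)] dr[OF s(1)]]
          homotopic_conjugates_join[OF d d d r(1) s(1)]]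
      by (simp add: pi1_mult conj path_in_join)
  qed
  have r: "path_in Y z z (reversepath d +++ (p +++ d))" using d p by (intro path_in_intros)
  have "conj (?c z (reversepath d +++ (p +++ d))) = ?c y p"
    using loop_class_homotopic[OF path_in_join[OF d path_in_join[OF r path_in_reverse[OF d]]]
        homotopic_unconjugate[OF d p]] by (simp add: conj[OF r])
  then show ?thesis
    using derived_hom_image[OF group_pi1 group_pi1 hom der] path_in_endpoints[OF d] by simp
qed

section \<open>The generation half of the van Kampen theorem\<close>

text \<open>Each point of \<open>Y\<close> is joined to \<open>y\<close> by a path that stays in every piece containing the point.
  Call two parameters of \<open>\<gamma>\<close> related if the subpath between them, closed up along these paths, lies
  in the generated subgroup.  This is an equivalence relation that holds locally, because a short
  subpath stays in one piece; hence it holds for 0 and 1.\<close>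

lemma loops_generated_by_two_pieces:
  fixes Y :: "'a::real_normed_vector set"
  assumes opU: "openin (top_of_set Y) U" and opV: "openin (top_of_set Y) V" and Y: "Y = U \<union> V"
    and pc: "path_connected U" "path_connected V" "path_connected (U \<inter> V)"
    and y: "y \<in> U \<inter> V" and \<gamma>: "path_in Y y y \<gamma>"
  shows "path_class Y y \<gamma> \<in> generate (pi1 Y y)
      (path_class Y y ` {p. path_in U y y p} \<union> path_class Y y ` {p. path_in V y y p})"
proof -
  let ?G = "pi1 Y y" and ?c = "path_class Y y"
  let ?gen = "generate ?G (?c ` {p. path_in U y y p} \<union> ?c ` {p. path_in V y y p})"
  have "\<exists>d. path_in Y y z d \<and> (z \<in> U \<longrightarrow> path_image d \<subseteq> U) \<and> (z \<in> V \<longrightarrow> path_image d \<subseteq> V)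
      \<and> (z = y \<longrightarrow> d = linepath y y)" if z: "z \<in> Y" for z
  proof -
    consider "z = y" | "z \<in> U" "z \<notin> V" | "z \<in> V" "z \<notin> U" | "z \<in> U \<inter> V" "z \<noteq> y" using z Y by blast
    then show ?thesis
    proof cases
      case 1 then show ?thesis using y Y by (intro exI[of _ "linepath y y"]) (auto simp: path_in_def)
    next
      case 2
      then obtain d where "path_in U y z d" using pc(1) y unfolding path_connected_def path_in_def by blast
      then show ?thesis using 2 y Y by (intro exI[of _ d]) (auto simp: path_in_def)
    next
      case 3
      then obtain d where "path_in V y z d" using pc(2) y unfolding path_connected_def path_in_def by blast
      then show ?thesis using 3 y Y by (intro exI[of _ d]) (auto simp: path_in_def)
    next
      case 4
      then obtain d where "path_in (U \<inter> V) y z d" using pc(3) y unfolding path_connected_def path_in_def by blast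
      then show ?thesis using 4 y Y by (intro exI[of _ d]) (auto simp: path_in_def)
    qed
  qed
  then obtain d where d: "\<And>z. z \<in> Y \<Longrightarrow> path_in Y y z (d z)" "\<And>z. z \<in> U \<Longrightarrow> path_image (d z) \<subseteq> U"
      "\<And>z. z \<in> V \<Longrightarrow> path_image (d z) \<subseteq> V" "d y = linepath y y"
    using Y y by (metis IntD1 UnCI)
  define l where "l s t = d (\<gamma> s) +++ (subpath s t \<gamma> +++ reversepath (d (\<gamma> t)))" for s t
  have \<gamma>Y: "\<gamma> t \<in> Y" if "t \<in> {0..1}" for t using \<gamma> that by (auto simp: path_in_def path_image_def)
  have sub: "path_in Y (\<gamma> s) (\<gamma> t) (subpath s t \<gamma>)" if "s \<in> {0..1}" "t \<in> {0..1}" for s t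
    using \<gamma> that path_image_subpath_subset[of s t \<gamma>] by (auto simp: path_in_def)
  have lp: "path_in Y y y (l s t)" if "s \<in> {0..1}" "t \<in> {0..1}" for s t
    unfolding l_def using that
    by (intro path_in_join[OF d(1)] path_in_join[OF sub] path_in_reverse[OF d(1)] \<gamma>Y)
  define R where "R s t \<longleftrightarrow> ?c (l s t) \<in> ?gen \<and> ?c (l t s) \<in> ?gen" for s t
  have join: "?c (l s u) = ?c (l s t) \<otimes>\<^bsub>?G\<^esub> ?c (l t u)"
    if "s \<in> {0..1}" "t \<in> {0..1}" "u \<in> {0..1}" for s t u
  proof -
    note [trans] = homotopic_paths_trans
    have "homotopic_paths Y (l s t +++ l t u)
        (d (\<gamma> s) +++ ((subpath s t \<gamma> +++ subpath t u \<gamma>) +++ reversepath (d (\<gamma> u))))"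
      unfolding l_def
      by (rule homotopic_conjugates_join[OF d(1)[OF \<gamma>Y] d(1)[OF \<gamma>Y] d(1)[OF \<gamma>Y] sub sub]) (rule that)+
    also have "homotopic_paths Y \<dots> (l s u)"
      unfolding l_def using that d(1)[OF \<gamma>Y] \<gamma> sub
      by (intro homotopic_paths_join homotopic_join_subpaths) (auto simp: path_in_def)
    finally show ?thesis
      using lp that loop_class_homotopic[OF path_in_join[OF lp lp]] by (simp add: pi1_mult)
  qed
  have loc: "l s t \<in> {p. path_in A y y p}" if "A = U \<or> A = V" "s \<in> {0..1}" "t \<in> {0..1}"
      "\<gamma> ` closed_segment s t \<subseteq> A" for A s t
  proof -
    have "path_image (subpath s t \<gamma>) \<subseteq> A" using that by (simp add: path_image_subpath_gen)
    moreover have "\<gamma> s \<in> A" "\<gamma> t \<in> A" using that(4) by auto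
    then have "path_image (d (\<gamma> s)) \<subseteq> A" "path_image (d (\<gamma> t)) \<subseteq> A" using that(1) d(2,3) by blast+
    ultimately show ?thesis
      using lp[OF that(2,3)] d(1)[OF \<gamma>Y] sub that(2,3) unfolding l_def path_in_def
      by (auto simp: path_image_join)
  qed
  have "R 0 1"
  proof (rule connected_equivalence_relation[of "{0..1::real}"])
    show "R t s" if "R s t" for s t using that by (simp add: R_def)
    show "R s u" if "R s t" "R t u" "s \<in> {0..1}" "t \<in> {0..1}" "u \<in> {0..1}" for s t u
      using that join generate.eng unfolding R_def by metis
    fix s :: real assume s: "s \<in> {0..1}"
    obtain A where A: "A = U \<or> A = V" "\<gamma> s \<in> A" using \<gamma>Y[OF s] Y by blast
    then have "openin (top_of_set Y) A" using opU opV by blast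
    then have "openin (top_of_set {0..1}) ({0..1} \<inter> \<gamma> -` A)"
      using \<gamma> continuous_openin_preimage[of "{0..1}" \<gamma> Y A]
      by (auto simp: path_in_def path_def path_image_def)
    then obtain e where e: "e > 0" "ball s e \<inter> {0..1} \<subseteq> {0..1} \<inter> \<gamma> -` A"
      using s A unfolding openin_contains_ball by blast
    show "\<exists>T. openin (top_of_set {0..1}) T \<and> s \<in> T \<and> (\<forall>t\<in>T. R s t)"
    proof (intro exI conjI ballI)
      show "openin (top_of_set {0..1}) ({0..1} \<inter> ball s e)" by (simp add: openin_open_Int)
      show "s \<in> {0..1} \<inter> ball s e" using s e by simp
      fix t assume t: "t \<in> {0..1} \<inter> ball s e"
      have "closed_segment s t \<subseteq> ball s e \<inter> {0..1}"
        using s t e by (intro closed_segment_subset convex_Int) auto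
      then have "\<gamma> ` closed_segment s t \<subseteq> A" using e by blast
      then have "l s t \<in> {p. path_in A y y p}" "l t s \<in> {p. path_in A y y p}"
        using loc[OF A(1)] s t by (auto simp: closed_segment_commute)
      then show "R s t" unfolding R_def using A(1) by (auto intro!: generate.incl)
    qed
  qed auto
  moreover have "homotopic_paths Y (l 0 1) \<gamma>"
  proof -
    note [trans] = homotopic_paths_trans
    have e: "\<gamma> 0 = y" "\<gamma> 1 = y" using \<gamma> by (auto simp: path_in_def pathstart_def pathfinish_def)
    have "homotopic_paths Y (linepath y y +++ (\<gamma> +++ linepath y y)) (\<gamma> +++ linepath y y)"
      using path_in_join[OF \<gamma> path_in_const[of y Y]] y Y
      by (intro homotopic_paths_lid') (auto simp: path_in_def)
    also have "homotopic_paths Y \<dots> \<gamma>"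
      using \<gamma> by (intro homotopic_paths_rid') (auto simp: path_in_def)
    finally show ?thesis by (simp add: l_def e d(4))
  qed
  ultimately show ?thesis
    using loop_class_homotopic[OF lp[of 0 1]] by (simp add: R_def)
qed

lemma subgroup_loops_in_subset:
  assumes "U \<subseteq> Y" "y \<in> U"
  shows "subgroup (path_class Y y ` {p. path_in U y y p}) (pi1 Y y)"
proof -
  let ?G = "pi1 Y y" and ?c = "path_class Y y"
  have Y: "path_in Y y y p" if "path_in U y y p" for p using path_in_mono[OF that assms(1)] .
  interpret group ?G using assms by (intro group_pi1) auto
  show ?thesis
  proof (rule subgroupI)
    show "?c ` {p. path_in U y y p} \<subseteq> carrier ?G" using Y by (auto simp: pi1_carrier)
    show "?c ` {p. path_in U y y p} \<noteq> {}" using path_in_const[OF assms(2)] by blast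
    fix a assume "a \<in> ?c ` {p. path_in U y y p}"
    then obtain p where p: "path_in U y y p" "a = ?c p" by blast
    then show "inv\<^bsub>?G\<^esub> a \<in> ?c ` {p. path_in U y y p}"
      using pi1_inv[OF Y] path_in_reverse by blast
    fix b assume "b \<in> ?c ` {p. path_in U y y p}"
    then obtain q where q: "path_in U y y q" "b = ?c q" by blast
    then show "a \<otimes>\<^bsub>?G\<^esub> b \<in> ?c ` {p. path_in U y y p}"
      using p pi1_mult[OF Y Y] path_in_join by blast
  qed
qed

section \<open>Winding numbers determine loops in a punctured convex region modulo commutators\<close>

definition class_winding :: "complex \<Rightarrow> (real \<Rightarrow> complex) set \<Rightarrow> complex" where
  "class_winding a C = winding_number (SOME p. p \<in> C) a"

lemma class_winding:
  assumes p: "path_in Y y y p" and a: "a \<notin> Y"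
  shows "class_winding a (path_class Y y p) = winding_number p a"
proof -
  define q where "q = (SOME q. q \<in> path_class Y y p)"
  have "q \<in> path_class Y y p"
    unfolding q_def using loop_in_own_class[of p "top_of_set Y" y] p
    by (intro someI[of "\<lambda>q. q \<in> path_class Y y p"]) (simp add: loops_path_in)
  then have "homotopic_paths Y p q"
    using p by (auto simp: loop_class_eq loop_homotopic_top_of_set path_in_def)
  then have "homotopic_paths (- {a}) p q"
    by (rule homotopic_paths_subset) (use a in auto)
  then show ?thesis
    unfolding class_winding_def q_def[symmetric] using winding_number_homotopic_paths by metis
qed

lemma class_winding_mult:
  assumes a: "a \<notin> Y" and "C \<in> carrier (pi1 Y y)"
    "D \<in> carrier (pi1 Y y)"
  shows "class_winding a (C \<otimes>\<^bsub>pi1 Y y\<^esub> D)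
       = class_winding a C + class_winding a D"
proof -
  obtain p q where pq: "path_in Y y y p" "C = path_class Y y p"
      "path_in Y y y q" "D = path_class Y y q"
    using assms by (auto simp: pi1_carrier)
  then have "winding_number (p +++ q) a = winding_number p a + winding_number q a"
    using a by (intro winding_number_join) (auto simp: path_in_def)
  then show ?thesis
    using pq a by (simp add: pi1_mult class_winding path_in_join)
qed

lemma pi1_convex_trivial:
  assumes "convex Y" "path_in Y y y p"
  shows "path_class Y y p = \<one>\<^bsub>pi1 Y y\<^esub>"
proof -
  have "homotopic_paths Y p (linepath y y)"
    using convex_imp_simply_connected[OF assms(1)] assms(2)
    unfolding simply_connected_eq_contractible_path path_in_def by blast
  then show ?thesis
    using loop_class_homotopic[OF assms(2)] by (simp add: fundamental_group_one linepath_refl)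
qed

text \<open>Radial projection onto a small ball around \<open>a\<close> deforms \<open>K - {a}\<close> into itself, and it maps
  a null-homotopy in the punctured plane to one in \<open>K - {a}\<close>.\<close>

lemma pi1_convex_minus_point:
  fixes K :: "complex set"
  assumes K: "open K" "convex K" "a \<in> K" and p: "path_in (K - {a}) y y p"
    and w: "winding_number p a = 0"
  shows "path_class (K - {a}) y p = \<one>\<^bsub>pi1 (K - {a}) y\<^esub>"
proof -
  obtain r where r: "r > 0" "cball a r \<subseteq> K" using K open_contains_cball by metis
  \<comment> \<open>The projection moves points outside the ball of radius \<open>r\<close> radially onto its boundary.\<close>
  define \<rho> where "\<rho> z = a + of_real (min 1 (r / norm (z - a))) * (z - a)" for z
  have p': "path p" "a \<notin> path_image p" "pathstart p = y" "pathfinish p = y" "path_image p \<subseteq> K - {a}"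
    using p by (auto simp: path_in_def)
  obtain c where c: "homotopic_loops (- {a}) p (\<lambda>t. c)"
    using winding_number_homotopic_loops_null_eq[OF p'(1,2)] w by auto
  have cont: "continuous_on (- {a}) \<rho>"
    unfolding \<rho>_def by (intro continuous_intros) auto
  have norm_eq: "norm (\<rho> z - a) = min 1 (r / norm (z - a)) * norm (z - a)" for z
    using r by (simp add: \<rho>_def norm_mult)
  have im: "\<rho> z \<in> K - {a}" if "z \<noteq> a" for z
  proof -
    have "norm (\<rho> z - a) \<le> r / norm (z - a) * norm (z - a)"
      unfolding norm_eq by (intro mult_right_mono) auto
    also have "\<dots> = r" using that by simp
    finally have "\<rho> z \<in> K" using r(2) by (auto simp: subset_iff dist_norm norm_minus_commute)
    moreover have "norm (\<rho> z - a) > 0" unfolding norm_eq using that r by simp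
    ultimately show ?thesis by auto
  qed
  have "homotopic_loops (K - {a}) (\<rho> \<circ> p) (\<rho> \<circ> (\<lambda>t. c))"
    using c cont by (rule homotopic_loops_continuous_image) (use im in auto)
  moreover have "homotopic_loops (K - {a}) p (\<rho> \<circ> p)"
  proof (rule homotopic_loops_linear)
    have cp: "continuous_on (path_image p) \<rho>" using cont by (rule continuous_on_subset) (use p' in auto)
    show "path (\<rho> \<circ> p)" using p'(1) cp by (rule path_continuous_image)
    fix t :: real assume t: "t \<in> {0..1}"
    define m where "m = min 1 (r / norm (p t - a))"
    have z: "p t \<in> K - {a}" using t p'(5) unfolding path_image_def by blast
    have m: "0 < m" using z r by (simp add: m_def)
    show "closed_segment (p t) ((\<rho> \<circ> p) t) \<subseteq> K - {a}"
    proof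
      fix v assume v: "v \<in> closed_segment (p t) ((\<rho> \<circ> p) t)"
      have "v \<in> K" using v z im[of "p t"] K(2) by (auto dest: closed_segment_subset[of "p t" K "\<rho> (p t)"])
      moreover have "v \<noteq> a"
      proof -
        obtain u where u: "0 \<le> u" "u \<le> 1" "v = (1 - u) *\<^sub>R p t + u *\<^sub>R \<rho> (p t)"
          using v by (auto simp: closed_segment_def)
        have "v - a = of_real (1 - u + u * m) * (p t - a)"
          unfolding u(3) \<rho>_def m_def[symmetric] by (simp add: scaleR_conv_of_real algebra_simps)
        moreover have "1 - u + u * m > 0"
        proof (cases "u = 1")
          case False
          then show ?thesis using u m by (intro add_pos_nonneg) auto
        qed (use m in simp)
        then have "(of_real (1 - u + u * m) :: complex) \<noteq> 0" by (metis less_irrefl of_real_eq_0_iff)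
        ultimately show ?thesis using z by auto
      qed
      ultimately show "v \<in> K - {a}" by blast
    qed
  qed (use p' in \<open>auto simp: pathfinish_compose pathstart_compose\<close>)
  ultimately have "homotopic_loops (K - {a}) p (\<rho> \<circ> (\<lambda>t. c))"
    by (blast intro: homotopic_loops_trans)
  then have "homotopic_loops (K - {a}) p (linepath (\<rho> c) (\<rho> c))"
    by (simp add: o_def linepath_refl)
  then have "homotopic_paths (K - {a}) p (linepath y y)"
    using homotopic_loops_imp_homotopic_paths_null p'(3) by blast
  then show ?thesis
    using loop_class_homotopic[OF p] by (simp add: fundamental_group_one linepath_refl)
qed

lemma path_connected_open_convex_minus_finite:
  fixes K :: "complex set"
  assumes "open K" "convex K" "finite S"
  shows "path_connected (K - S)"
  using assms by (intro connected_open_path_connected connected_open_delete_finite)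
    (auto simp: convex_connected finite_imp_closed open_Diff)

text \<open>A line that separates the punctures cuts the region into two convex pieces whose overlap
  contains no puncture.\<close>

lemma separating_strip:
  fixes K :: "complex set"
  assumes S: "finite S" "S \<subseteq> K" "a \<in> S" "b \<in> S" "a \<noteq> b" and K: "open K" "convex K"
  obtains U V where "open U" "convex U" "open V" "convex V" "U \<union> V = K" "U \<inter> V \<inter> S = {}"
    "U \<inter> V \<noteq> {}" "U \<inter> S \<subset> S" "V \<inter> S \<subset> S"
proof -
  define f where "f z = (b - a) \<bullet> z" for z :: complex
  have "f b - f a = (b - a) \<bullet> (b - a)" by (simp add: f_def inner_diff_right)
  then have ab: "f a < f b" using S(5) by (metis diff_gt_0_iff_gt inner_gt_zero_iff right_minus_eq)
  \<comment> \<open>No puncture has a value strictly between \<open>f a\<close> and the least value \<open>m\<close> above it.\<close>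
  define A where "A = {v \<in> f ` S. f a < v}"
  have A: "finite A" "f b \<in> A" using S ab by (auto simp: A_def)
  define m where "m = Min A"
  have "m \<in> A" unfolding m_def using A by (intro Min_in) auto
  then obtain b' where b': "b' \<in> S" "f b' = m" "f a < m" by (auto simp: A_def)
  have low: "m \<le> f s" if "s \<in> S" "f a < f s" for s
    unfolding m_def using A that by (intro Min_le) (auto simp: A_def)
  define U where "U = K \<inter> {z. (b - a) \<bullet> z < m}"
  define V where "V = K \<inter> {z. (b - a) \<bullet> z > f a}"
  show thesis
  proof (rule that)
    show "open U" "open V" unfolding U_def V_def
      using K(1) by (auto intro!: open_Int open_halfspace_lt open_halfspace_gt)
    show "convex U" "convex V" unfolding U_def V_def
      using K(2) by (auto intro!: convex_Int convex_halfspace_lt convex_halfspace_gt)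
    show "U \<union> V = K" using b' by (auto simp: U_def V_def)
    show "U \<inter> V \<inter> S = {}" using low by (auto simp: U_def V_def f_def[symmetric] not_less)
        (meson linorder_not_less)
    have "midpoint a b' \<in> K"
      using K(2) S b'(1) by (meson convex_contains_segment midpoint_in_closed_segment subsetD)
    moreover have "f (midpoint a b') = (f a + m) / 2"
      using b'(2) by (simp add: f_def midpoint_def inner_add_right)
    ultimately have "midpoint a b' \<in> U \<inter> V" using b'(3) by (simp add: U_def V_def f_def[symmetric])
    then show "U \<inter> V \<noteq> {}" by blast
    have "b' \<notin> U" "a \<notin> V" using b' by (simp_all add: U_def V_def f_def[symmetric])
    then show "U \<inter> S \<subset> S" "V \<inter> S \<subset> S" using b' S by blast+
  qed
qed

text \<open>Induction on the number of punctures.  Modulo commutators, the loop is a product of loops in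
  the two pieces of a separating strip.  The loop in one piece does not wind around the punctures of
  the other, so all winding numbers of both factors vanish.\<close>

theorem null_winding_imp_in_derived:
  fixes K :: "complex set"
  assumes "finite S" "open K" "convex K" "S \<subseteq> K" "path_in (K - S) y y p"
    and "\<And>a. a \<in> S \<Longrightarrow> winding_number p a = 0"
  shows "null_homologous (K - S) y p"
  using assms
proof (induction S arbitrary: K y p rule: finite_psubset_induct)
  case (psubset S)
  let ?Y = "K - S"
  interpret G: group "pi1 ?Y y"
    using psubset.prems(4) path_in_endpoints by (intro group_pi1) blast
  have one: "\<one>\<^bsub>pi1 ?Y y\<^esub>
      \<in> derived (pi1 ?Y y) (carrier (pi1 ?Y y))"
    using subgroup.one_closed[OF G.derived_is_subgroup[of "carrier (pi1 ?Y y)"]]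
    by simp
  consider "S = {}" | a where "S = {a}" | a b where "a \<in> S" "b \<in> S" "a \<noteq> b" by blast
  then show ?case
  proof cases
    case 1
    then show ?thesis using one pi1_convex_trivial[of K y p] psubset.prems by simp
  next
    case (2 a)
    then show ?thesis using one pi1_convex_minus_point[of K a y p] psubset.prems by simp
  next
    case (3 a b)
    obtain U V where UV: "open U" "convex U" "open V" "convex V" "U \<union> V = K" "U \<inter> V \<inter> S = {}"
        "U \<inter> V \<noteq> {}" "U \<inter> S \<subset> S" "V \<inter> S \<subset> S"
      using separating_strip[OF psubset.hyps psubset.prems(3) 3 psubset.prems(1,2)] .
    obtain z where z: "z \<in> U \<inter> V" using UV(7) by blast
    then have zY: "z \<in> ?Y" using UV(5,6) by blast
    have "path_connected ?Y"
      using psubset.prems psubset.hyps by (intro path_connected_open_convex_minus_finite)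
    then obtain d where d: "path_in ?Y y z d"
      using zY path_in_endpoints[OF psubset.prems(4)] unfolding path_connected_def path_in_def by blast
    define g where "g = reversepath d +++ (p +++ d)"
    have g: "path_in ?Y z z g"
      unfolding g_def using d psubset.prems(4) by (intro path_in_intros)
    let ?G = "pi1 ?Y z" and ?c = "path_class ?Y z"
    let ?D = "derived ?G (carrier ?G)"
    interpret Gz: group ?G using zY by (rule group_pi1)
    have g0: "winding_number g s = 0" if s: "s \<in> S" for s
      using d psubset.prems(4) psubset.prems(5)[OF s] s unfolding g_def path_in_def
      by (subst winding_number_join winding_number_reversepath
            | force simp: path_image_join)+
    define U' where "U' = U - S \<inter> U"
    define V' where "V' = V - S \<inter> V"
    have sub: "U' \<subseteq> ?Y" "V' \<subseteq> ?Y" using UV(5) by (auto simp: U'_def V'_def)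
    have "?c g \<in> generate ?G (?c ` {p. path_in U' z z p} \<union> ?c ` {p. path_in V' z z p})"
    proof (rule loops_generated_by_two_pieces)
      have "U' = ?Y \<inter> U" "V' = ?Y \<inter> V" using UV(5) by (auto simp: U'_def V'_def)
      then show "openin (top_of_set ?Y) U'" "openin (top_of_set ?Y) V'"
        using UV(1,3) by (auto simp: openin_open_Int)
      show "?Y = U' \<union> V'" using UV(5) by (auto simp: U'_def V'_def)
      show "path_connected U'" "path_connected V'"
        unfolding U'_def V'_def using UV psubset.hyps
        by (auto intro: path_connected_open_convex_minus_finite)
      have "U' \<inter> V' = U \<inter> V" using UV(6) by (auto simp: U'_def V'_def)
      then show "path_connected (U' \<inter> V')"
        using UV by (simp add: convex_Int convex_imp_path_connected)
      show "z \<in> U' \<inter> V'" using z zY by (auto simp: U'_def V'_def)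
    qed (rule g)
    then obtain u v e where uve: "path_in U' z z u" "path_in V' z z v" "e \<in> ?D"
        "?c g = e \<otimes>\<^bsub>?G\<^esub> (?c u \<otimes>\<^bsub>?G\<^esub> ?c v)"
      using Gz.generate_two_subgroups_mod_derived[OF subgroup_loops_in_subset[OF sub(1)]
          subgroup_loops_in_subset[OF sub(2)]] z zY by (fastforce simp: U'_def V'_def)
    have uvY: "path_in ?Y z z u" "path_in ?Y z z v" using uve sub path_in_mono by blast+
    have "e \<in> carrier ?G" using uve(3) Gz.derived_in_carrier[of "carrier ?G"] by blast
    have w: "winding_number u s + winding_number v s = 0" if s: "s \<in> S" for s
    proof -
      have s': "s \<notin> ?Y" using s by blast
      have c: "?c u \<in> carrier ?G" "?c v \<in> carrier ?G" using uvY by (auto simp: pi1_carrier)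
      have "class_winding s e = 0"
        using Gz.additive_vanishes_on_derived[of "class_winding s", OF class_winding_mult[OF s'] uve(3)] .
      then have "class_winding s (?c g) = class_winding s (?c u) + class_winding s (?c v)"
        using uve(4) c \<open>e \<in> carrier ?G\<close> by (simp add: class_winding_mult[OF s'])
      then show ?thesis using g0[OF s] by (simp add: class_winding[OF _ s'] uvY g)
    qed
    have out: "winding_number q s = 0" if "path_in (A - S \<inter> A) z z q" "convex A" "s \<notin> A" for q s A
      using that by (intro winding_number_zero_outside[of q A]) (auto simp: path_in_def)
    have dsj: "s \<notin> V" if "s \<in> S \<inter> U" for s using that UV(6) by blast
    have dsj': "s \<notin> U" if "s \<in> S \<inter> V" for s using that UV(6) by blast
    have "winding_number u s = 0" if "s \<in> S \<inter> U" for s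
      using w[of s] out[OF uve(2)[unfolded V'_def] UV(4) dsj[OF that]] that by simp
    then have "null_homologous U' z u"
      using psubset.IH[of "S \<inter> U" U z u] UV uve(1) unfolding U'_def by (auto simp: Int_commute)
    then have u: "?c u \<in> ?D" by (rule derived_pi1_mono[OF sub(1) uve(1)])
    have "winding_number v s = 0" if "s \<in> S \<inter> V" for s
      using w[of s] out[OF uve(1)[unfolded U'_def] UV(2) dsj'[OF that]] that by simp
    then have "null_homologous V' z v"
      using psubset.IH[of "S \<inter> V" V z v] UV uve(2) unfolding V'_def by (auto simp: Int_commute)
    then have v: "?c v \<in> ?D" by (rule derived_pi1_mono[OF sub(2) uve(2)])
    have "?c g \<in> ?D"
      unfolding uve(4) using u v uve(3)
      by (intro subgroup.m_closed[OF Gz.derived_is_subgroup[OF subset_refl]])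
    then show ?thesis
      unfolding g_def by (rule derived_pi1_base_change[OF d psubset.prems(4)])
  qed
qed

section \<open>Loops in the complement of complex lines in the plane\<close>

text \<open>Add continuous logarithms of the two paths.\<close>

lemma winding_number_times:
  assumes p: "path p" "0 \<notin> path_image p" and q: "path q" "0 \<notin> path_image q"
  shows "winding_number (\<lambda>t. p t * q t) 0 = winding_number p 0 + winding_number q 0"
proof -
  obtain l where l: "path l" "pathfinish l - pathstart l = 2 * of_real pi * \<i> * winding_number p 0"
      "\<And>t. t \<in> {0..1} \<Longrightarrow> p t = 0 + exp (l t)"
    using winding_number_as_continuous_log[OF p] by blast
  obtain m where m: "path m" "pathfinish m - pathstart m = 2 * of_real pi * \<i> * winding_number q 0"
      "\<And>t. t \<in> {0..1} \<Longrightarrow> q t = 0 + exp (m t)"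
    using winding_number_as_continuous_log[OF q] by blast
  have "winding_number (\<lambda>t. p t * q t) 0 = winding_number (exp \<circ> (\<lambda>t. l t + m t)) 0"
    by (rule winding_number_cong) (simp add: l m exp_add)
  also have "\<dots> = (pathfinish (\<lambda>t. l t + m t) - pathstart (\<lambda>t. l t + m t)) / (2 * of_real pi * \<i>)"
    using l(1) m(1) by (intro winding_number_compose_exp) (auto simp: path_def intro: continuous_intros)
  also have "pathfinish (\<lambda>t. l t + m t) - pathstart (\<lambda>t. l t + m t)
      = (pathfinish l - pathstart l) + (pathfinish m - pathstart m)"
    by (simp add: pathfinish_def pathstart_def)
  finally show ?thesis unfolding l m by (simp add: add_divide_distrib)
qed

lemma winding_number_scale:
  assumes "path p" "0 \<notin> path_image p" "c \<noteq> 0"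
  shows "winding_number (\<lambda>t. c * p t) 0 = winding_number p 0"
  using winding_number_times[of "\<lambda>_. c" p] assms winding_number_zero_const[of c 0]
  by (auto simp: path_def path_image_def)

text \<open>The determinant of two vectors.  The line spanned by \<open>h\<close> is the zero set of \<open>wedge h\<close>.\<close>

definition wedge :: "complex^2 \<Rightarrow> complex^2 \<Rightarrow> complex" where
  "wedge u v = u$1 * v$2 - u$2 * v$1"

lemma wedge_matrix: "wedge (A *v u) (A *v v) = det A * wedge u v"
  by (simp add: wedge_def matrix_vector_mult_def sum_2 det_2 algebra_simps)

lemma wedge_self [simp]: "wedge u u = 0"
  by (simp add: wedge_def)

lemma wedge_scale_left: "wedge (c *s u) v = c * wedge u v"
  and wedge_scale_right: "wedge u (c *s v) = c * wedge u v"
  and wedge_add_left: "wedge (u + u') v = wedge u v + wedge u' v"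
  and wedge_add_right: "wedge u (v + v') = wedge u v + wedge u v'"
  by (simp_all add: wedge_def algebra_simps)

lemma wedge_commute: "wedge u v = - wedge v u"
  by (simp add: wedge_def)

lemma vec2_eq_iff: "(u :: 'a^2) = v \<longleftrightarrow> u$1 = v$1 \<and> u$2 = v$2"
  by (simp add: vec_eq_iff forall_2)

lemma wedge_eq_0_iff:
  assumes "h \<noteq> 0" shows "wedge h v = 0 \<longleftrightarrow> (\<exists>c. v = c *s h)"
proof
  assume w: "wedge h v = 0"
  consider "h$1 \<noteq> 0" | "h$2 \<noteq> 0" using assms by (auto simp: vec2_eq_iff)
  then show "\<exists>c. v = c *s h"
  proof cases
    case 1
    with w have "v = (v$1 / h$1) *s h" by (simp add: vec2_eq_iff wedge_def field_simps)
    then show ?thesis ..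
  next
    case 2
    with w have "v = (v$2 / h$2) *s h" by (simp add: vec2_eq_iff wedge_def field_simps)
    then show ?thesis ..
  qed
qed (auto simp: wedge_scale_right)

lemma wedge_expansion: "wedge h k *s v = wedge v k *s h + wedge h v *s k"
  by (simp add: vec2_eq_iff wedge_def algebra_simps)

lemma exists_wedge_1:
  assumes "h \<noteq> 0" obtains k where "wedge h k = 1"
proof -
  obtain v where v: "wedge h v \<noteq> 0"
  proof (cases "h$1 = 0")
    case True
    then have "wedge h (vector [1, 0]) \<noteq> 0" using assms by (simp add: wedge_def vec2_eq_iff)
    then show thesis by (rule that)
  next
    case False
    then have "wedge h (vector [0, 1]) \<noteq> 0" by (simp add: wedge_def)
    then show thesis by (rule that)
  qed
  then show thesis by (intro that[of "(1 / wedge h v) *s v"]) (simp add: wedge_scale_right)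
qed

lemma continuous_on_wedge [continuous_intros]:
  "continuous_on S f \<Longrightarrow> continuous_on S g \<Longrightarrow> continuous_on S (\<lambda>t. wedge (f t) (g t))"
  unfolding wedge_def by (intro continuous_intros continuous_on_component)

lemma continuous_on_vector_scalar_mult [continuous_intros]:
  "continuous_on S f \<Longrightarrow> continuous_on S g \<Longrightarrow> continuous_on S (\<lambda>t. f t *s (g t :: complex^'n))"
  unfolding vector_scalar_mult_def
  by (intro continuous_on_vec_lambda continuous_intros continuous_on_component)

definition lines_complement :: "(complex^2) set \<Rightarrow> (complex^2) set" where
  "lines_complement N = {v. \<forall>h\<in>N. wedge h v \<noteq> 0}"

lemma path_wedge:
  assumes "path_in (lines_complement N) x y p" "h \<in> N"
  shows "path (wedge h \<circ> p)" "0 \<notin> path_image (wedge h \<circ> p)"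
proof -
  show "path (wedge h \<circ> p)"
    using assms unfolding path_def o_def path_in_def by (intro continuous_intros) auto
  show "0 \<notin> path_image (wedge h \<circ> p)"
    using assms by (force simp: path_in_def path_image_def lines_complement_def)
qed

text \<open>With one of the lines at infinity, the complement becomes the product of a punctured line and
  a line with finitely many punctures.  A loop whose first component has winding number zero can be
  pushed into the second factor.\<close>

theorem null_windings_imp_in_derived:
  assumes N: "finite N" "N \<noteq> {}" "0 \<notin> N" "\<And>h k. h \<in> N \<Longrightarrow> k \<in> N \<Longrightarrow> h \<noteq> k \<Longrightarrow> wedge h k \<noteq> 0"
    and p: "path_in (lines_complement N) x x p"
    and w: "\<And>h. h \<in> N \<Longrightarrow> winding_number (wedge h \<circ> p) 0 = 0"
  shows "null_homologous (lines_complement N) x p"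
proof -
  let ?X = "lines_complement N"
  obtain h0 where h0: "h0 \<in> N" using N by blast
  then have "h0 \<noteq> 0" using N by blast
  then obtain k0 where k0: "wedge h0 k0 = 1" by (rule exists_wedge_1)
  \<comment> \<open>The coordinates are the value \<open>b\<close> of the form of \<open>h0\<close> and the slope \<open>z\<close>, in which a line other
    than that of \<open>h0\<close> becomes a puncture \<open>s h\<close>.\<close>
  define m where "m = (\<lambda>(b, z). b *s (z *s h0 + k0))"
  define z where "z v = wedge v k0 / wedge h0 v" for v
  define s where "s h = - wedge h k0 / wedge h h0" for h
  define S where "S = s ` (N - {h0})"
  have wm: "wedge h (m (b, c)) = b * (c * wedge h h0 + wedge h k0)" for h b c
    by (simp add: m_def wedge_scale_right wedge_add_right algebra_simps)
  have wh: "wedge h (m (b, c)) = b * (wedge h h0 * (c - s h))" if "h \<in> N - {h0}" for h b c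
  proof -
    have "wedge h h0 \<noteq> 0" using N(4)[of h h0] that h0 by blast
    then show ?thesis unfolding wm s_def by (simp add: field_simps)
  qed
  have mX: "m (b, c) \<in> ?X \<longleftrightarrow> b \<noteq> 0 \<and> c \<in> UNIV - S" for b c
  proof
    assume "m (b, c) \<in> ?X"
    then have nz: "wedge h (m (b, c)) \<noteq> 0" if "h \<in> N" for h using that by (simp add: lines_complement_def)
    have "c \<noteq> s h" if "h \<in> N - {h0}" for h using nz[of h] wh[OF that, of b c] that by auto
    then show "b \<noteq> 0 \<and> c \<in> UNIV - S"
      using wm[of h0 b c] nz[OF h0] k0 by (auto simp: S_def)
  next
    assume bc: "b \<noteq> 0 \<and> c \<in> UNIV - S"
    show "m (b, c) \<in> ?X" unfolding lines_complement_def
    proof clarify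
      fix h assume h: "h \<in> N" "wedge h (m (b, c)) = 0"
      show False
      proof (cases "h = h0")
        case True then show ?thesis using h wm[of h0 b c] k0 bc by simp
      next
        case False then show ?thesis using h wh[of h b c] bc N(4)[of h h0] h0 by (auto simp: S_def)
      qed
    qed
  qed
  have vm: "v = m (wedge h0 v, z v)" if "v \<in> ?X" for v
  proof -
    have "wedge h0 v \<noteq> 0" using that h0 by (auto simp: lines_complement_def)
    then have "m (wedge h0 v, z v) = wedge v k0 *s h0 + wedge h0 v *s k0"
      by (simp add: m_def z_def vec2_eq_iff field_simps)
    then show ?thesis using wedge_expansion[of h0 k0 v] k0 by simp
  qed
  have contm: "continuous_on R (\<lambda>y. m (f y, g y))" if "continuous_on R f" "continuous_on R g"
    for R :: "'r::topological_space set" and f g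
    using that unfolding m_def case_prod_conv by (intro continuous_intros)
  have pX: "path p" "path_image p \<subseteq> ?X" "p 0 = x" "p 1 = x"
    using p by (auto simp: path_in_def pathstart_def pathfinish_def)
  have pt: "p t \<in> ?X" if "t \<in> {0..1}" for t using pX(2) that by (auto simp: path_image_def)
  have xX: "x \<in> ?X" using pt[of 0] pX(3) by simp
  define b where "b = wedge h0 \<circ> p"
  define c where "c = z \<circ> p"
  have b: "path b" "0 \<notin> path_image b" using path_wedge[OF p h0] by (simp_all add: b_def)
  have b0: "b t \<noteq> 0" if "t \<in> {0..1}" for t using b(2) that by (force simp: path_image_def)
  have pbc: "p t = m (b t, c t)" if "t \<in> {0..1}" for t using vm[OF pt[OF that]] by (simp add: b_def c_def)
  have cS: "c t \<in> UNIV - S" if "t \<in> {0..1}" for t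
    using pt[OF that] pbc[OF that] mX by metis
  have contp: "continuous_on {0..1} p" and contb: "continuous_on {0..1} b"
    using pX(1) b(1) by (auto simp: path_def)
  have contc: "continuous_on {0..1} c"
    unfolding c_def o_def z_def
    using contp contb b0 unfolding b_def o_def by (intro continuous_intros) auto
  have c: "path_in (UNIV - S) (z x) (z x) c"
    using contc cS pX by (auto simp: path_in_def path_def path_image_def pathstart_def pathfinish_def c_def)
  have "winding_number c a = 0" if a: "a \<in> S" for a
  proof -
    obtain h where h: "h \<in> N - {h0}" "a = s h" using a by (auto simp: S_def)
    have hh: "wedge h h0 \<noteq> 0" using h N h0 by blast
    have ca: "path (\<lambda>t. c t - a)" "0 \<notin> path_image (\<lambda>t. c t - a)"
      using contc cS that by (auto simp: path_def path_image_def intro!: continuous_intros)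
    have ca': "path (\<lambda>t. wedge h h0 * (c t - a))" "0 \<notin> path_image (\<lambda>t. wedge h h0 * (c t - a))"
      using ca hh by (auto simp: path_def path_image_def intro!: continuous_intros)
    have "winding_number (wedge h \<circ> p) 0 = winding_number (\<lambda>t. b t * (wedge h h0 * (c t - a))) 0"
      by (rule winding_number_cong) (simp add: pbc wh[OF h(1)] h(2))
    also have "\<dots> = winding_number b 0 + winding_number (\<lambda>t. c t - a) 0"
      using winding_number_times[OF b ca'] winding_number_scale[OF ca hh] by simp
    finally have "winding_number (\<lambda>t. c t - a) 0 = 0"
      using w[of h] w[OF h0] h by (simp add: b_def)
    then show ?thesis using winding_number_offset[of c a] by simp
  qed
  moreover have "finite S" using N by (simp add: S_def)
  ultimately have der: "null_homologous (UNIV - S) (z x) c"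
    using c by (intro null_winding_imp_in_derived) auto
  define j where "j u = m (wedge h0 x, u)" for u
  have jx: "j (z x) = x" using vm[OF xX] by (simp add: j_def)
  have "wedge h0 x \<noteq> 0" using xX h0 by (auto simp: lines_complement_def)
  then have "continuous_map (top_of_set (UNIV - S)) (top_of_set ?X) j"
    unfolding j_def using mX by (auto simp: continuous_map_in_subtopology intro!: contm continuous_intros)
  from derived_induced_map[OF this _ der]
  have "null_homologous ?X x (j \<circ> c)"
    using c by (simp add: loops_path_in jx)
  moreover have "homotopic_paths ?X p (j \<circ> c)"
  proof -
    obtain e where e: "homotopic_paths (- {0}) b (\<lambda>t. e)"
      using winding_number_homotopic_paths_null_eq[OF b] w[OF h0] by (auto simp: b_def)
    then have "e = b 0" using homotopic_paths_imp_pathstart[OF e] by (simp add: pathstart_def)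
    with e have "homotopic_paths (- {0}) b (\<lambda>t. b 0)" by simp
    then obtain k :: "real \<times> real \<Rightarrow> complex" where k: "continuous_on ({0..1} \<times> {0..1}) k"
        "k \<in> {0..1} \<times> {0..1} \<rightarrow> - {0}" "\<And>t. t \<in> {0..1} \<Longrightarrow> k (0, t) = b t"
        "\<And>t. t \<in> {0..1} \<Longrightarrow> k (1, t) = b 0"
        "\<And>s. s \<in> {0..1} \<Longrightarrow> k (s, 0) = b 0 \<and> k (s, 1) = b 1"
      unfolding homotopic_paths by (auto simp: pathstart_def pathfinish_def)
    have bb: "b 0 = wedge h0 x" "b 1 = wedge h0 x" "c 0 = z x" "c 1 = z x"
      using pX by (simp_all add: b_def c_def)
    show ?thesis unfolding homotopic_paths
    proof (intro exI[of _ "\<lambda>y. m (k y, c (snd y))"] conjI ballI)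
      have "continuous_on ({0..1} \<times> {0..1}) (\<lambda>y::real\<times>real. c (snd y))"
        by (rule continuous_on_compose2[OF contc]) (auto intro: continuous_intros)
      then show "continuous_on ({0..1} \<times> {0..1}) (\<lambda>y. m (k y, c (snd y)))"
        using k(1) by (intro contm)
      show "(\<lambda>y. m (k y, c (snd y))) \<in> {0..1} \<times> {0..1} \<rightarrow> ?X"
        using k(2) cS by (auto simp: mX Pi_iff)
    qed (simp_all add: k pbc bb pX j_def pathstart_def pathfinish_def jx[unfolded j_def])
  qed
  ultimately show ?thesis using loop_class_homotopic[OF p] by simp
qed

section \<open>Reflection groups of rank two\<close>

definition line :: "complex^2 \<Rightarrow> (complex^2) set" where
  "line h = {v. wedge h v = 0}"

definition is_line :: "(complex^2) set \<Rightarrow> bool" where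
  "is_line H \<longleftrightarrow> (\<exists>h. h \<noteq> 0 \<and> H = line h)"

lemma line_eq_span:
  assumes "h \<noteq> 0" shows "line h = vec.span {h}"
  using wedge_eq_0_iff[OF assms] by (auto simp: line_def vec.span_singleton)

lemma hyperplane_iff_is_line: "hyperplane (H :: (complex^2) set) \<longleftrightarrow> is_line H"
proof
  assume "hyperplane H"
  then have H: "vec.subspace H" "vec.dim H = 1" by (simp_all add: hyperplane_def)
  obtain B where B: "B \<subseteq> H" "vec.independent B" "H \<subseteq> vec.span B" "card B = vec.dim H"
    using vec.basis_exists by blast
  with H obtain h where h: "B = {h}" by (metis card_1_singletonE)
  then have "h \<noteq> 0" using B(2) by (simp add: vec.dependent_single)
  moreover have "H = vec.span {h}" using B h H vec.span_minimal[of B H] by blast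
  ultimately show "is_line H" using line_eq_span by (auto simp: is_line_def)
next
  assume "is_line H"
  then obtain h where h: "h \<noteq> 0" "H = vec.span {h}" using line_eq_span by (auto simp: is_line_def)
  have "vec.dim {h} = card {h}" using h(1) by (intro vec.dim_eq_card_independent) (simp add: vec.dependent_single)
  then show "hyperplane H" using h(2) by (simp add: hyperplane_def vec.subspace_span)
qed

lemma reflection_along_rank2:
  "reflection_along (r :: complex^2^2) H \<longleftrightarrow>
     invertible r \<and> r \<noteq> mat 1 \<and> is_line H \<and> (\<forall>v\<in>H. r *v v = v)"
  by (auto simp: reflection_along_def hyperplane_iff_is_line)

definition generator :: "(complex^2) set \<Rightarrow> complex^2" where
  "generator H = (SOME h. h \<noteq> 0 \<and> H = line h)"

lemma generator:
  assumes "is_line H" shows "generator H \<noteq> 0" "line (generator H) = H" "generator H \<in> H"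
proof -
  have "generator H \<noteq> 0 \<and> H = line (generator H)"
    using assms unfolding is_line_def generator_def by (rule someI_ex)
  then show "generator H \<noteq> 0" "line (generator H) = H" by auto
  then show "generator H \<in> H" by (metis (mono_tags) line_def mem_Collect_eq wedge_self)
qed

lemma line_memD: "v \<in> line h \<Longrightarrow> h \<noteq> 0 \<Longrightarrow> \<exists>c. v = c *s h"
  using wedge_eq_0_iff by (auto simp: line_def)

lemma line_self [simp]: "h \<in> line h" by (simp add: line_def)

lemma line_scale: "c \<noteq> 0 \<Longrightarrow> line (c *s h) = line h"
  by (auto simp: line_def wedge_scale_left)

lemma line_unique:
  assumes "is_line H" "v \<in> H" "v \<noteq> 0" shows "H = line v"
proof -
  obtain h where h: "h \<noteq> 0" "H = line h" using assms(1) by (auto simp: is_line_def)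
  then obtain c where "v = c *s h" using assms(2) line_memD by blast
  then show ?thesis using h assms(3) line_scale[of c h] by (cases "c = 0") auto
qed

lemma is_line_line: "h \<noteq> 0 \<Longrightarrow> is_line (line h)" by (auto simp: is_line_def)

lemma is_line_nonzero: "is_line H \<Longrightarrow> \<exists>h\<in>H. h \<noteq> 0" using generator by blast

lemma is_line_scale: "is_line H \<Longrightarrow> v \<in> H \<Longrightarrow> c *s v \<in> H"
  by (auto simp: is_line_def line_def wedge_scale_right)

lemma lines_independent:
  assumes "is_line H" "is_line K" "H \<noteq> K" "h \<in> H" "h \<noteq> 0" "k \<in> K" "k \<noteq> 0"
  shows "wedge h k \<noteq> 0"
proof
  assume "wedge h k = 0"
  then have "k \<in> line h" by (simp add: line_def)
  moreover have "line h = H" using line_unique[OF assms(1,4,5)] ..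
  ultimately show False using line_unique[OF assms(1) _ assms(7)] line_unique[OF assms(2,6,7)] assms(3) by auto
qed

lemma vector_in_basis:
  assumes "wedge h k \<noteq> 0" obtains c d where "v = c *s h + d *s k"
proof
  show "v = (wedge v k / wedge h k) *s h + (wedge h v / wedge h k) *s k"
    using assms wedge_expansion[of h k v]
    by (simp add: vec2_eq_iff add_divide_distrib[symmetric] eq_divide_eq mult.commute)
qed

lemma matrix_eq_on_basis:
  assumes "wedge h k \<noteq> 0" "A *v h = B *v h" "A *v k = B *v k"
  shows "A = (B :: complex^2^2)"
  unfolding matrix_eq
proof
  fix v
  obtain c d where v: "v = c *s h + d *s k" using vector_in_basis[OF assms(1)] .
  show "A *v v = B *v v"
    unfolding v by (simp add: matrix_vector_right_distrib vector_scalar_commute assms)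
qed

lemma group_GL: "group (GL :: (complex^'n^'n) monoid)"
proof (rule groupI)
  fix A B C :: "complex^'n^'n"
  assume A: "A \<in> carrier GL"
  then obtain A' where A': "A ** A' = mat 1" "A' ** A = mat 1"
    by (auto simp: GL_def invertible_def)
  show "\<exists>B\<in>carrier GL. B \<otimes>\<^bsub>GL\<^esub> A = \<one>\<^bsub>GL\<^esub>"
    using A' by (intro bexI[of _ A']) (auto simp: GL_def invertible_def)
  assume "B \<in> carrier GL"
  then show "A \<otimes>\<^bsub>GL\<^esub> B \<in> carrier GL" using A by (simp add: GL_def invertible_mult)
qed (auto simp: GL_def matrix_mul_assoc invertible_def intro!: exI[of _ "mat 1"])

locale matrix_group =
  fixes W :: "(complex^2^2) set"
  assumes subgroup_W: "subgroup W GL" and finite_W: "finite W"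
begin

lemma one_W: "mat 1 \<in> W"
  using subgroup.one_closed[OF subgroup_W] by (simp add: GL_def)

lemma mult_W: "u \<in> W \<Longrightarrow> w \<in> W \<Longrightarrow> u ** w \<in> W"
  using subgroup.m_closed[OF subgroup_W] by (simp add: GL_def)

lemma invertible_W: "w \<in> W \<Longrightarrow> invertible w"
  using subgroup.subset[OF subgroup_W] by (auto simp: GL_def)

definition minv :: "complex^2^2 \<Rightarrow> complex^2^2" where "minv w = inv\<^bsub>GL\<^esub> w"

lemma minv: assumes "w \<in> W" shows "minv w \<in> W" "minv w ** w = mat 1" "w ** minv w = mat 1"
proof -
  have c: "w \<in> carrier GL" using assms subgroup.subset[OF subgroup_W] by blast
  show "minv w \<in> W" using subgroup.m_inv_closed[OF subgroup_W assms] by (simp add: minv_def)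
  show "minv w ** w = mat 1" "w ** minv w = mat 1"
    using group.l_inv[OF group_GL c] group.r_inv[OF group_GL c] by (simp_all add: minv_def GL_def)
qed

lemma minv_vec: "w \<in> W \<Longrightarrow> minv w *v (w *v v) = v" "w \<in> W \<Longrightarrow> w *v (minv w *v v) = v"
  by (simp_all add: matrix_vector_mul_assoc minv)

lemma det_W: "w \<in> W \<Longrightarrow> det w \<noteq> 0"
  using invertible_W invertible_det_nz by blast

lemma W_vec_eq_0: "w \<in> W \<Longrightarrow> w *v v = 0 \<longleftrightarrow> v = 0"
  using minv_vec(1)[of w v] by auto

lemma group_W: "group (GL\<lparr>carrier := W\<rparr>)"
  using subgroup.subgroup_is_group[OF subgroup_W group_GL] .

abbreviation pre :: "complex^2^2 \<Rightarrow> (complex^2) set \<Rightarrow> (complex^2) set" where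
  "pre w H \<equiv> (*v) w -` H"

lemma pre_one: "pre (mat 1) H = H" by auto

lemma pre_mult: "pre (u ** w) H = pre w (pre u H)"
  by (auto simp: matrix_vector_mul_assoc)

lemma pre_minv: "w \<in> W \<Longrightarrow> pre (minv w) (pre w H) = H" "w \<in> W \<Longrightarrow> pre w (pre (minv w) H) = H"
  by (auto simp: minv_vec)

lemma pre_line: "w \<in> W \<Longrightarrow> pre w (line h) = line (minv w *v h)"
  using wedge_matrix[of w "minv w *v h"] det_W by (auto simp: line_def minv_vec)

lemma is_line_pre: "w \<in> W \<Longrightarrow> is_line H \<Longrightarrow> is_line (pre w H)"
  using pre_line minv(1) W_vec_eq_0 unfolding is_line_def by metis

lemma image_eq_pre: "w \<in> W \<Longrightarrow> (*v) w ` H = pre (minv w) H"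
  using minv_vec by (auto simp: image_iff) metis

text \<open>Both sides are linear forms in \<open>v\<close> with the same line as zero set.\<close>

lemma wedge_generator_pre:
  assumes w: "w \<in> W" and H: "is_line H"
  obtains c where "c \<noteq> 0" "\<And>v. wedge (generator H) (w *v v) = c * wedge (generator (pre w H)) v"
proof -
  have "minv w *v generator H \<in> pre w H" using w generator(3)[OF H] by (simp add: minv_vec)
  then obtain c where c: "minv w *v generator H = c *s generator (pre w H)"
    using line_memD generator[OF is_line_pre[OF w H]] by metis
  have "c \<noteq> 0"
  proof
    assume "c = 0"
    with c have "minv w *v generator H = 0" by simp
    then show False using W_vec_eq_0[OF minv(1)[OF w]] generator(1)[OF H] by simp
  qed
  moreover have "wedge (generator H) (w *v v) = det w * c * wedge (generator (pre w H)) v" for v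
    using wedge_matrix[of w "minv w *v generator H" v]
    unfolding minv_vec(2)[OF w] by (simp add: c wedge_scale_left)
  ultimately show thesis using det_W[OF w] by (intro that[of "det w * c"]) auto
qed

end

locale rank2_reflection_group =
  fixes W :: "(complex^2^2) set"
  assumes crg: "complex_reflection_group W" and has_reflection: "reflecting_hyperplanes W \<noteq> {}"

sublocale rank2_reflection_group \<subseteq> matrix_group
  using crg by (intro matrix_group.intro) (simp_all add: complex_reflection_group_def)

context rank2_reflection_group
begin

abbreviation "\<A> \<equiv> reflecting_hyperplanes W"
abbreviation "X \<equiv> hyperplane_complement W"

lemma arrangement_iff: "H \<in> \<A> \<longleftrightarrow> (\<exists>r\<in>W. reflection_along r H)"
  by (simp add: reflecting_hyperplanes_def)

lemma arrangement_line: "H \<in> \<A> \<Longrightarrow> is_line H"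
  by (auto simp: arrangement_iff reflection_along_rank2)

text \<open>If \<open>r\<close> fixed a vector off the line, it would fix a basis.\<close>

lemma reflection_fixed_space:
  assumes "reflection_along (r :: complex^2^2) H" shows "{v. r *v v = v} = H"
proof -
  have r: "r \<noteq> mat 1" "is_line H" "\<And>v. v \<in> H \<Longrightarrow> r *v v = v"
    using assms by (auto simp: reflection_along_rank2)
  have "v \<in> H" if "r *v v = v" for v
  proof (rule ccontr)
    assume "v \<notin> H"
    then have "wedge (generator H) v \<noteq> 0" using generator(2)[OF r(2)] by (auto simp: line_def)
    then have "r = mat 1"
      using r(3)[OF generator(3)[OF r(2)]] that matrix_eq_on_basis[of "generator H" v r "mat 1"] by simp
    then show False using r(1) by simp
  qed
  then show ?thesis using r(3) by blast
qed

lemma finite_arrangement: "finite \<A>"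
proof (rule finite_subset)
  show "\<A> \<subseteq> (\<lambda>r. {v. r *v v = v}) ` W"
    using reflection_fixed_space by (fastforce simp: arrangement_iff)
qed (simp add: finite_W)

lemma reflection_along_pre:
  assumes w: "w \<in> W" and r: "r \<in> W" "reflection_along r H"
  shows "reflection_along (minv w ** r ** w) (pre w H)"
proof -
  have "minv w ** r ** w \<noteq> mat 1"
  proof
    assume "minv w ** r ** w = mat 1"
    then have "w ** (minv w ** r ** w) ** minv w = mat 1" using minv[OF w] by simp
    then have "r = mat 1"
      using minv[OF w] by (metis matrix_mul_assoc matrix_mul_lid matrix_mul_rid)
    then show False using r by (simp add: reflection_along_rank2)
  qed
  then show ?thesis
    using r w minv[OF w] invertible_W mult_W is_line_pre[OF w]
    by (auto simp: reflection_along_rank2 matrix_vector_mul_assoc[symmetric] minv_vec)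
qed

lemma arrangement_pre: "w \<in> W \<Longrightarrow> H \<in> \<A> \<Longrightarrow> pre w H \<in> \<A>"
  using reflection_along_pre minv mult_W unfolding arrangement_iff by meson

lemma arrangement_pre_iff: "w \<in> W \<Longrightarrow> pre w H \<in> \<A> \<longleftrightarrow> H \<in> \<A>"
  using arrangement_pre[of w H] arrangement_pre[of "minv w" "pre w H"] minv(1) pre_minv(1) by metis

lemma bij_betw_pre: "w \<in> W \<Longrightarrow> bij_betw (pre w) \<A> \<A>"
  by (rule bij_betw_byWitness[where f' = "pre (minv w)"])
     (auto simp: pre_minv arrangement_pre minv)

lemma complement_eq: "X = lines_complement (generator ` \<A>)"
proof -
  have "v \<in> H \<longleftrightarrow> wedge (generator H) v = 0" if "H \<in> \<A>" for v H
    using generator(2)[OF arrangement_line[OF that]] by (auto simp: line_def)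
  then show ?thesis by (auto simp: hyperplane_complement_def lines_complement_def)
qed

lemma wedge_nonzero: "v \<in> X \<Longrightarrow> H \<in> \<A> \<Longrightarrow> wedge (generator H) v \<noteq> 0"
  by (auto simp: complement_eq lines_complement_def)

lemma open_complement: "open X"
proof -
  have "X = (\<Inter>H\<in>\<A>. {v. wedge (generator H) v \<noteq> 0})"
    by (auto simp: complement_eq lines_complement_def)
  also have "open \<dots>"
    using finite_arrangement by (intro open_INT ballI open_Collect_neq continuous_intros)
  finally show ?thesis .
qed

lemma zero_notin_complement: "0 \<notin> X"
  using has_reflection wedge_nonzero[of 0] by (auto simp: wedge_def)

lemma complement_closed: "w \<in> W \<Longrightarrow> v \<in> X \<Longrightarrow> w *v v \<in> X"
  using arrangement_pre by (auto simp: hyperplane_complement_def)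

text \<open>In rank two, an element that fixes a nonzero vector is trivial or a reflection along the line
  spanned by that vector.\<close>

lemma free_on_complement:
  assumes "u \<in> W" "w \<in> W" "v \<in> X" "u *v v = w *v v"
  shows "u = w"
proof (rule ccontr)
  assume "u \<noteq> w"
  define r where "r = minv w ** u"
  have r: "r \<in> W" using assms by (simp add: r_def mult_W minv)
  have "r \<noteq> mat 1"
  proof
    assume "r = mat 1"
    then have "w ** r = w" by simp
    then show False using \<open>u \<noteq> w\<close> minv[OF assms(2)] by (simp add: r_def matrix_mul_assoc)
  qed
  have rv: "r *v v = v" using assms by (simp add: r_def matrix_vector_mul_assoc[symmetric] minv_vec)
  have v0: "v \<noteq> 0" using assms zero_notin_complement by auto
  have "r *v y = y" if "y \<in> line v" for y
    using line_memD[OF that v0] rv by (auto simp: vector_scalar_commute)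
  then have "line v \<in> \<A>"
    using r \<open>r \<noteq> mat 1\<close> invertible_W v0 unfolding arrangement_iff reflection_along_rank2
    by (intro bexI[of _ r]) (auto simp: is_line_line)
  then show False using assms(3) by (auto simp: hyperplane_complement_def)
qed

lemma orbit_map_eq: "orbit_map W v = (\<lambda>w. w *v v) ` W"
  by (auto simp: orbit_def)

lemma orbit_map_eq_iff: "orbit_map W u = orbit_map W v \<longleftrightarrow> (\<exists>w\<in>W. v = w *v u)"
proof
  assume "orbit_map W u = orbit_map W v"
  moreover have "v \<in> orbit_map W v" unfolding orbit_map_eq using one_W
    by (metis image_eqI matrix_vector_mul_lid)
  ultimately show "\<exists>w\<in>W. v = w *v u" by (auto simp: orbit_map_eq)
next
  assume "\<exists>w\<in>W. v = w *v u"
  then obtain w where w: "w \<in> W" "v = w *v u" by blast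
  have "g *v u = (g ** minv w) *v v" for g
    using w by (simp add: matrix_vector_mul_assoc[symmetric] minv_vec)
  then have 1: "g *v u \<in> orbit_map W v" if "g \<in> W" for g
    unfolding orbit_map_eq using that w mult_W minv(1) by blast
  have "g *v v = (g ** w) *v u" for g using w by (simp add: matrix_vector_mul_assoc)
  then have 2: "g *v v \<in> orbit_map W u" if "g \<in> W" for g
    unfolding orbit_map_eq using that w mult_W by blast
  show "orbit_map W u = orbit_map W v"
    using 1 2 by (auto simp: orbit_map_eq)
qed

lemma orbit_map_W: "w \<in> W \<Longrightarrow> orbit_map W (w *v v) = orbit_map W v"
  using orbit_map_eq_iff by metis

sublocale free_finite_action X "(*v) ` W" "orbit_map W"
proof
  show "(\<lambda>v. v) \<in> (*v) ` W" using one_W by (force simp: image_iff fun_eq_iff)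
  show "continuous_on X f" if "f \<in> (*v) ` W" for f
    using that by (auto intro: matrix_vector_mult_linear_continuous_on)
  show "f ` X = X" if f: "f \<in> (*v) ` W" for f
  proof -
    obtain w where w: "w \<in> W" "f = (*v) w" using f by blast
    have "v \<in> f ` X" if "v \<in> X" for v
      using w complement_closed[OF minv(1) that] minv_vec(2)[of w v] by (metis imageI)
    then show ?thesis using w complement_closed by blast
  qed
  show "inj_on f X" if "f \<in> (*v) ` W" for f
    using that minv_vec(1) by (auto simp: inj_on_def) metis
  show "orbit_map W u = orbit_map W v \<longleftrightarrow> (\<exists>f\<in>(*v) ` W. v = f u)" for u v
    using orbit_map_eq_iff by auto
  show "f = g" if "f \<in> (*v) ` W" "g \<in> (*v) ` W" "v \<in> X" "f v = g v" for f g v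
    using that free_on_complement by auto
qed (use open_complement finite_W in auto)

lemma quot_eq: "quot = orbit_space W"
  by (simp add: quot_def orbit_space_def)

end

context rank2_reflection_group
begin

section \<open>The braid group modulo commutators of pure braids as a concrete group\<close>

text \<open>This is the semidirect product of \<open>W\<close> with the functions on the reflecting lines: taking the
  preimage of lines under \<open>u\<close> is the action of the inverse of \<open>u\<close>.\<close>

definition winding_extension :: "((complex^2^2) \<times> ((complex^2) set \<Rightarrow> complex)) monoid" where
  "winding_extension =
     \<lparr>carrier = W \<times> {f. \<forall>H. H \<notin> \<A> \<longrightarrow> f H = 0},
      mult = (\<lambda>(u, f) (w, g). (u ** w, \<lambda>H. f H + g (pre u H))),
      one = (mat 1, \<lambda>_. 0)\<rparr>"

lemma winding_extension_mult [simp]: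
  "(u, f) \<otimes>\<^bsub>winding_extension\<^esub> (w, g) = (u ** w, \<lambda>H. f H + g (pre u H))"
  by (simp add: winding_extension_def)

lemma winding_extension_one [simp]: "\<one>\<^bsub>winding_extension\<^esub> = (mat 1, \<lambda>_. 0)"
  by (simp add: winding_extension_def)

lemma winding_extension_carrier [simp]:
  "(w, f) \<in> carrier winding_extension \<longleftrightarrow> w \<in> W \<and> (\<forall>H. H \<notin> \<A> \<longrightarrow> f H = 0)"
  by (simp add: winding_extension_def)

lemma group_winding_extension: "group winding_extension"
proof (rule groupI)
  fix a b c
  assume a: "a \<in> carrier winding_extension"
  obtain u f where uf: "a = (u, f)" by (cases a)
  have u: "u \<in> W" "\<And>H. H \<notin> \<A> \<Longrightarrow> f H = 0" using a uf by auto
  show "\<exists>b\<in>carrier winding_extension. b \<otimes>\<^bsub>winding_extension\<^esub> a = \<one>\<^bsub>winding_extension\<^esub>"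
    using u minv[OF u(1)] arrangement_pre_iff[OF minv(1)[OF u(1)]]
    by (intro bexI[of _ "(minv u, \<lambda>H. - f (pre (minv u) H))"]) (auto simp: uf)
  assume b: "b \<in> carrier winding_extension"
  obtain w g where wg: "b = (w, g)" by (cases b)
  show "a \<otimes>\<^bsub>winding_extension\<^esub> b \<in> carrier winding_extension"
    using a b u arrangement_pre_iff by (auto simp: uf wg mult_W)
  assume "c \<in> carrier winding_extension"
  obtain v k where vk: "c = (v, k)" by (cases c)
  show "a \<otimes>\<^bsub>winding_extension\<^esub> b \<otimes>\<^bsub>winding_extension\<^esub> c
      = a \<otimes>\<^bsub>winding_extension\<^esub> (b \<otimes>\<^bsub>winding_extension\<^esub> c)"
    by (simp add: uf wg vk matrix_mul_assoc pre_mult add.assoc del: vimage_Collect_eq)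
qed (auto simp: one_W pre_one)

text \<open>Paths need not be closed, so the winding numbers are complex.  The value zero off the
  arrangement makes such a function determined by its values on the reflecting lines.\<close>

definition turns :: "(real \<Rightarrow> complex^2) \<Rightarrow> (complex^2) set \<Rightarrow> complex" where
  "turns p H = (if H \<in> \<A> then winding_number (wedge (generator H) \<circ> p) 0 else 0)"

lemma path_wedge_generator:
  assumes "path_in X a b p" "H \<in> \<A>"
  shows "path (wedge (generator H) \<circ> p)" "0 \<notin> path_image (wedge (generator H) \<circ> p)"
  using path_wedge[of "generator ` \<A>" a b p "generator H"] assms by (simp_all add: complement_eq)

lemma turns_join:
  assumes "path_in X a b p" "path_in X b c q"
  shows "turns (p +++ q) H = turns p H + turns q H"
proof (cases "H \<in> \<A>")
  case True
  have "wedge (generator H) \<circ> (p +++ q) = (wedge (generator H) \<circ> p) +++ (wedge (generator H) \<circ> q)"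
    by (rule path_compose_join)
  then show ?thesis
    using path_wedge_generator[OF assms(1) True] path_wedge_generator[OF assms(2) True] assms True
    by (simp add: turns_def winding_number_join pathfinish_compose pathstart_compose path_in_def)
qed (simp add: turns_def)

lemma turns_reverse:
  assumes "path_in X a b p" shows "turns (reversepath p) H = - turns p H"
proof (cases "H \<in> \<A>")
  case True
  have "wedge (generator H) \<circ> reversepath p = reversepath (wedge (generator H) \<circ> p)"
    by (simp add: reversepath_def o_def)
  then show ?thesis
    using path_wedge_generator[OF assms True] True by (simp add: turns_def winding_number_reversepath)
qed (simp add: turns_def)

lemma turns_homotopic:
  assumes "homotopic_paths X p q" shows "turns p = turns q"
proof
  fix H
  show "turns p H = turns q H"
  proof (cases "H \<in> \<A>")
    case True
    have "homotopic_paths (- {0}) (wedge (generator H) \<circ> p) (wedge (generator H) \<circ> q)"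
      using assms by (rule homotopic_paths_continuous_image)
        (use True wedge_nonzero in \<open>auto intro!: continuous_intros\<close>)
    then show ?thesis using True by (simp add: turns_def winding_number_homotopic_paths)
  qed (simp add: turns_def)
qed

lemma turns_matrix:
  assumes p: "path_in X a b p" and w: "w \<in> W"
  shows "turns ((*v) w \<circ> p) H = turns p (pre w H)"
proof (cases "H \<in> \<A>")
  case True
  obtain c where c: "c \<noteq> 0"
      "\<And>v. wedge (generator H) (w *v v) = c * wedge (generator (pre w H)) v"
    using wedge_generator_pre[OF w arrangement_line[OF True]] by blast
  have "wedge (generator H) \<circ> ((*v) w \<circ> p) = (\<lambda>t. c * (wedge (generator (pre w H)) \<circ> p) t)"
    by (simp add: fun_eq_iff c(2))
  then show ?thesis
    using winding_number_scale[OF path_wedge_generator[OF p arrangement_pre[OF w True]] c(1)]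
      True arrangement_pre[OF w True] by (simp add: turns_def)
qed (simp add: turns_def arrangement_pre_iff[OF w])

lemma turns_exp:
  assumes p: "path_in X a b p" and H: "H \<in> \<A>"
  shows "wedge (generator H) b = exp (2 * pi * \<i> * turns p H) * wedge (generator H) a"
  using winding_number_exp_2pi[OF path_wedge_generator[OF p H]] p H
  by (simp add: turns_def path_in_def pathfinish_compose pathstart_compose)

lemma path_in_matrix:
  assumes "path_in X a b p" "w \<in> W" shows "path_in X (w *v a) (w *v b) ((*v) w \<circ> p)"
  using assms complement_closed unfolding path_in_def
  by (auto simp: path_image_compose pathfinish_compose pathstart_compose
      intro!: path_continuous_image matrix_vector_mult_linear_continuous_on)

abbreviation braid_of_path :: "complex^2 \<Rightarrow> (real \<Rightarrow> complex^2) \<Rightarrow> (real \<Rightarrow> (complex^2) set) set" where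
  "braid_of_path x p \<equiv> loop_class (orbit_space W) (orbit_map W x) (orbit_map W \<circ> p)"

lemma orbit_path_loop:
  assumes "path_in X x (w *v x) p" "w \<in> W"
  shows "orbit_map W \<circ> p \<in> loops (orbit_space W) (orbit_map W x)"
  using path_projects_to_loop[of p x "(*v) w"] assms
  by (auto simp: path_in_def quot_eq pathstart_def pathfinish_def)

lemma braid_path_exists:
  assumes "C \<in> carrier (braid_group W x)" "x \<in> X"
  obtains p w where "w \<in> W" "path_in X x (w *v x) p" "C = braid_of_path x p"
proof -
  obtain l where l: "l \<in> loops (orbit_space W) (orbit_map W x)"
      "C = loop_class (orbit_space W) (orbit_map W x) l"
    using assms(1) by (auto simp: braid_group_def fundamental_group_carrier)
  obtain p f where p: "path p" "path_image p \<subseteq> X" "p 0 = x" "f \<in> (*v) ` W" "p 1 = f x"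
      "\<And>t. t \<in> {0..1} \<Longrightarrow> orbit_map W (p t) = l t"
    using loop_lift[of l x] l(1) assms(2) by (auto simp: quot_eq)
  then obtain w where w: "w \<in> W" "f = (*v) w" by blast
  have pin: "path_in X x (w *v x) p" using p w by (simp add: path_in_def pathstart_def pathfinish_def)
  have "loop_homotopic (orbit_space W) (orbit_map W x) l (orbit_map W \<circ> p)"
    using l(1) p(6) by (intro loop_homotopic_cong) auto
  then have "C = braid_of_path x p"
    using l orbit_path_loop[OF pin w(1)] by (simp add: loop_class_eq_iff)
  then show thesis using that w(1) pin by blast
qed

lemma braid_of_path_carrier:
  assumes "path_in X x (w *v x) p" "w \<in> W"
  shows "braid_of_path x p \<in> carrier (braid_group W x)"
  using orbit_path_loop[OF assms] by (simp add: braid_group_def fundamental_group_carrier)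

text \<open>The value is read off from a lift of the braid to a path in the complement.\<close>

definition monodromy ::
    "complex^2 \<Rightarrow> (real \<Rightarrow> (complex^2) set) set \<Rightarrow> (complex^2^2) \<times> ((complex^2) set \<Rightarrow> complex)" where
  "monodromy x C = (THE m. \<exists>p w. w \<in> W \<and> path_in X x (w *v x) p \<and> orbit_map W \<circ> p \<in> C
                              \<and> m = (w, turns p))"

text \<open>Two lifts of the same braid that start at \<open>x\<close> are homotopic, so they have the same end point and
  the same winding numbers.\<close>

lemma monodromy_braid_of_path:
  assumes p: "path_in X x (w *v x) p" and w: "w \<in> W"
  shows "monodromy x (braid_of_path x p) = (w, turns p)"
  unfolding monodromy_def
proof (rule the_equality)
  show "\<exists>p' w'. w' \<in> W \<and> path_in X x (w' *v x) p' \<and> orbit_map W \<circ> p' \<in> braid_of_path x p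
      \<and> (w, turns p) = (w', turns p')"
    using p w loop_in_own_class[OF orbit_path_loop[OF p w]] by blast
  fix m
  assume "\<exists>p' w'. w' \<in> W \<and> path_in X x (w' *v x) p' \<and> orbit_map W \<circ> p' \<in> braid_of_path x p
      \<and> m = (w', turns p')"
  then obtain p' w' where p': "w' \<in> W" "path_in X x (w' *v x) p'" "m = (w', turns p')"
      "orbit_map W \<circ> p' \<in> braid_of_path x p" by blast
  then have "loop_homotopic quot (orbit_map W x) (orbit_map W \<circ> p) (orbit_map W \<circ> p')"
    by (simp add: loop_class_eq quot_eq)
  then have hom: "homotopic_paths X p p'"
    using p p'(2) by (intro homotopic_paths_of_projections[of p x p'])
      (auto simp: path_in_def pathstart_def)
  then have "w *v x = w' *v x"
    using homotopic_paths_imp_pathfinish[OF hom] p p'(2) by (simp add: path_in_def)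
  then have "w = w'" using free_on_complement[OF w p'(1)] path_in_endpoints[OF p] by blast
  then show "m = (w, turns p)" using p'(3) turns_homotopic[OF hom] by simp
qed

lemma group_braid_group: "x \<in> X \<Longrightarrow> group (braid_group W x)"
  unfolding braid_group_def by (rule group_fundamental_group) (auto simp: quot_eq[symmetric] topspace_quot)

lemma braid_of_path_mult:
  assumes p: "path_in X x (u *v x) p" "u \<in> W" and q: "path_in X x (w *v x) q" "w \<in> W"
  shows "braid_of_path x p \<otimes>\<^bsub>braid_group W x\<^esub> braid_of_path x q
       = braid_of_path x (p +++ ((*v) u \<circ> q))"
    and "path_in X x ((u ** w) *v x) (p +++ ((*v) u \<circ> q))"
proof -
  have "concat_paths (orbit_map W \<circ> p) (orbit_map W \<circ> q) = orbit_map W \<circ> (p +++ ((*v) u \<circ> q))"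
    by (auto simp: fun_eq_iff concat_paths_def joinpaths_def orbit_map_W[OF p(2)])
  then show "braid_of_path x p \<otimes>\<^bsub>braid_group W x\<^esub> braid_of_path x q
      = braid_of_path x (p +++ ((*v) u \<circ> q))"
    using orbit_path_loop[OF p] orbit_path_loop[OF q] by (simp add: braid_group_def fundamental_group_mult)
  show "path_in X x ((u ** w) *v x) (p +++ ((*v) u \<circ> q))"
    using path_in_join[OF p(1) path_in_matrix[OF q(1) p(2)]] by (simp add: matrix_vector_mul_assoc)
qed

lemma turns_outside: "H \<notin> \<A> \<Longrightarrow> turns p H = 0"
  by (simp add: turns_def)

text \<open>The product of the braids of \<open>p\<close> and \<open>q\<close> is the braid of \<open>p\<close> followed by the translate of \<open>q\<close>, and
  the translate by \<open>u\<close> winds around \<open>H\<close> as \<open>q\<close> winds around the preimage of \<open>H\<close> under \<open>u\<close>.\<close>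

theorem monodromy_hom:
  assumes x: "x \<in> X" shows "monodromy x \<in> hom (braid_group W x) winding_extension"
proof (rule homI)
  fix C assume "C \<in> carrier (braid_group W x)"
  then obtain p u where p: "u \<in> W" "path_in X x (u *v x) p" "C = braid_of_path x p"
    using braid_path_exists x by blast
  then show "monodromy x C \<in> carrier winding_extension"
    by (simp add: monodromy_braid_of_path turns_outside)
  fix D assume "D \<in> carrier (braid_group W x)"
  then obtain q w where q: "w \<in> W" "path_in X x (w *v x) q" "D = braid_of_path x q"
    using braid_path_exists x by blast
  have "turns (p +++ ((*v) u \<circ> q)) = (\<lambda>H. turns p H + turns q (pre u H))"
    using turns_join[OF p(2) path_in_matrix[OF q(2) p(1)]] turns_matrix[OF q(2) p(1)] by auto
  then show "monodromy x (C \<otimes>\<^bsub>braid_group W x\<^esub> D)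
      = monodromy x C \<otimes>\<^bsub>winding_extension\<^esub> monodromy x D"
    using p q braid_of_path_mult[OF p(2,1) q(2,1)]
    by (simp add: monodromy_braid_of_path mult_W)
qed

lemma pure_to_braid_loop_class:
  assumes "path_in X x x p"
  shows "pure_to_braid W x (path_class X x p) = braid_of_path x p"
  using induced_map_loop_class[OF continuous_map_q, of p x] assms
  by (simp add: pure_to_braid_def quot_eq loops_path_in)

lemma group_pure_braid_group: "x \<in> X \<Longrightarrow> group (pure_braid_group W x)"
  by (simp add: pure_braid_group_def group_pi1)

text \<open>A braid with trivial monodromy lifts to a loop with vanishing winding numbers, which is a
  product of commutators.  Conversely, winding numbers of loops are additive, so they vanish on
  commutators.\<close>

theorem kernel_monodromy:
  assumes x: "x \<in> X"
  shows "kernel (braid_group W x) winding_extension (monodromy x)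
       = pure_to_braid W x ` derived (pure_braid_group W x) (carrier (pure_braid_group W x))"
    (is "?K = ?D")
proof
  show "?K \<subseteq> ?D"
  proof
    fix C assume "C \<in> ?K"
    then have C: "C \<in> carrier (braid_group W x)" "monodromy x C = (mat 1, \<lambda>_. 0)"
      by (auto simp: kernel_def)
    obtain p w where p: "w \<in> W" "path_in X x (w *v x) p" "C = braid_of_path x p"
      using braid_path_exists[OF C(1) x] .
    then have w: "w = mat 1" and t: "turns p = (\<lambda>_. 0)"
      using C(2) by (simp_all add: monodromy_braid_of_path)
    have px: "path_in X x x p" using p(2) w by simp
    have "null_homologous X x p"
      unfolding complement_eq
    proof (rule null_windings_imp_in_derived)
      show "0 \<notin> generator ` \<A>" using generator(1) arrangement_line by force
      show "wedge h k \<noteq> 0" if hk: "h \<in> generator ` \<A>" "k \<in> generator ` \<A>" "h \<noteq> k" for h k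
      proof -
        obtain H K where "H \<in> \<A>" "h = generator H" "K \<in> \<A>" "k = generator K" using hk by blast
        then show ?thesis
          using lines_independent[of H K h k] generator arrangement_line hk(3) by metis
      qed
      show "winding_number (wedge h \<circ> p) 0 = 0" if "h \<in> generator ` \<A>" for h
        using that fun_cong[OF t] by (auto simp: turns_def) metis
    qed (use finite_arrangement has_reflection px complement_eq in auto)
    then show "C \<in> ?D"
      using pure_to_braid_loop_class[OF px] p(3) unfolding pure_braid_group_def by (metis imageI)
  qed
  show "?D \<subseteq> ?K"
  proof
    fix C assume "C \<in> ?D"
    then obtain E where E: "E \<in> derived (pure_braid_group W x) (carrier (pure_braid_group W x))"
        "C = pure_to_braid W x E" by blast
    interpret P: group "pure_braid_group W x" using x by (rule group_pure_braid_group)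
    have loop: "\<exists>p. path_in X x x p \<and> F = path_class X x p
        \<and> monodromy x (pure_to_braid W x F) = (mat 1, turns p)"
      if F: "F \<in> carrier (pure_braid_group W x)" for F
    proof -
      obtain p where p: "path_in X x x p" "F = path_class X x p"
        using F by (auto simp: pure_braid_group_def pi1_carrier)
      then show ?thesis
        using monodromy_braid_of_path[of x "mat 1" p] one_W pure_to_braid_loop_class by auto
    qed
    have "E \<in> carrier (pure_braid_group W x)"
      using E(1) P.derived_in_carrier[of "carrier (pure_braid_group W x)"] by blast
    then obtain p where p: "path_in X x x p" "E = path_class X x p"
        "monodromy x C = (mat 1, turns p)"
      using loop E(2) by blast
    have "snd (monodromy x (pure_to_braid W x E)) H = 0" for H
    proof (rule P.additive_vanishes_on_derived[OF _ E(1)])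
      fix F G assume "F \<in> carrier (pure_braid_group W x)" "G \<in> carrier (pure_braid_group W x)"
      then obtain p q where pq: "path_in X x x p" "F = path_class X x p"
          "path_in X x x q" "G = path_class X x q"
          "monodromy x (pure_to_braid W x F) = (mat 1, turns p)"
          "monodromy x (pure_to_braid W x G) = (mat 1, turns q)" using loop by meson
      have "monodromy x (pure_to_braid W x (F \<otimes>\<^bsub>pure_braid_group W x\<^esub> G)) = (mat 1, turns (p +++ q))"
        using pq(1-4) path_in_join[OF pq(1,3)] one_W monodromy_braid_of_path[of x "mat 1" "p +++ q"]
        by (simp add: pure_braid_group_def pi1_mult pure_to_braid_loop_class[unfolded pure_braid_group_def])
      then show "snd (monodromy x (pure_to_braid W x (F \<otimes>\<^bsub>pure_braid_group W x\<^esub> G))) H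
          = snd (monodromy x (pure_to_braid W x F)) H + snd (monodromy x (pure_to_braid W x G)) H"
        using pq(5,6) turns_join[OF pq(1,3)] by simp
    qed
    then have "turns p = (\<lambda>_. 0)" using p(3) E(2) by auto
    moreover have "C \<in> carrier (braid_group W x)"
      using p E(2) pure_to_braid_loop_class[OF p(1)] braid_of_path_carrier[of x "mat 1" p] one_W by simp
    ultimately show "C \<in> ?K" using p(3) by (simp add: kernel_def)
  qed
qed

end

context rank2_reflection_group
begin

section \<open>The image of the monodromy\<close>

text \<open>The complex line through two points of the complement meets each reflecting line in at most one
  point, and removing finitely many points does not disconnect it.\<close>

lemma path_in_complement_exists:
  assumes "u \<in> X" "v \<in> X" obtains p where "path_in X u v p"
proof -
  define l where "l z = u + z *s (v - u)" for z :: complex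
  define S where "S = {z. l z \<notin> X}"
  have w: "wedge (generator H) (l z) = wedge (generator H) u + z * wedge (generator H) (v - u)" for H z
    unfolding l_def by (simp only: wedge_add_right wedge_scale_right)
  have "S \<subseteq> (\<lambda>H. - wedge (generator H) u / wedge (generator H) (v - u)) ` \<A>"
  proof
    fix z assume "z \<in> S"
    then obtain H where H: "H \<in> \<A>" "wedge (generator H) u + z * wedge (generator H) (v - u) = 0"
      by (auto simp: S_def complement_eq lines_complement_def w)
    then have "wedge (generator H) (v - u) \<noteq> 0" using wedge_nonzero[OF assms(1) H(1)] by auto
    then have "z = - wedge (generator H) u / wedge (generator H) (v - u)"
      using H(2) by (simp only: nonzero_eq_divide_eq eq_neg_iff_add_eq_0 add.commute not_False_eq_True)
    then show "z \<in> (\<lambda>H. - wedge (generator H) u / wedge (generator H) (v - u)) ` \<A>" using H(1) by blast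
  qed
  then have "finite S" using finite_arrangement finite_subset by blast
  then have "path_connected (- S)" by (intro path_connected_complement_countable countable_finite) auto
  moreover have "0 \<in> - S" "1 \<in> - S" using assms by (auto simp: S_def l_def)
  ultimately obtain g where g: "path g" "path_image g \<subseteq> - S" "pathstart g = 0" "pathfinish g = 1"
    unfolding path_connected_def by blast
  have "path_in X u v (l \<circ> g)"
    using g unfolding path_in_def
    by (auto simp: path_image_compose pathfinish_compose pathstart_compose S_def l_def
        intro!: path_continuous_image continuous_intros)
  then show thesis by (rule that)
qed

abbreviation "monodromy_image x \<equiv> monodromy x ` carrier (braid_group W x)"

lemma monodromy_in_image:
  assumes "w \<in> W" "path_in X x (w *v x) p"
  shows "(w, turns p) \<in> monodromy_image x"
  using monodromy_braid_of_path[OF assms(2,1)] braid_of_path_carrier[OF assms(2,1)] by (metis imageI)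

lemma monodromy_image_onto_W:
  assumes "x \<in> X" "w \<in> W"
  obtains f where "(w, f) \<in> monodromy_image x"
  using path_in_complement_exists[OF assms(1) complement_closed[OF assms(2,1)]]
    monodromy_in_image[OF assms(2)] by metis

lemma monodromy_image_exp:
  assumes "(w, f) \<in> monodromy_image x" "x \<in> X" "H \<in> \<A>"
  shows "wedge (generator H) (w *v x) = exp (2 * pi * \<i> * f H) * wedge (generator H) x"
proof -
  obtain C where C: "C \<in> carrier (braid_group W x)" "monodromy x C = (w, f)" using assms(1) by auto
  obtain p u where p: "u \<in> W" "path_in X x (u *v x) p" "C = braid_of_path x p"
    using braid_path_exists[OF C(1) assms(2)] .
  then have "u = w" "turns p = f" using C(2) monodromy_braid_of_path[OF p(2,1)] by auto
  then show ?thesis using turns_exp[OF p(2) assms(3)] by simp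
qed

lemma winding_number_exp_line: "winding_number (\<lambda>s. exp (2 * pi * \<i> * t * complex_of_real s)) 0 = t"
proof -
  have "winding_number (exp \<circ> (\<lambda>s. 2 * pi * \<i> * t * complex_of_real s)) 0
      = (pathfinish (\<lambda>s. 2 * pi * \<i> * t * complex_of_real s)
         - pathstart (\<lambda>s. 2 * pi * \<i> * t * complex_of_real s)) / (2 * of_real pi * \<i>)"
    by (intro winding_number_compose_exp) (auto simp: path_def intro!: continuous_intros)
  then show ?thesis by (simp add: pathfinish_def pathstart_def o_def)
qed

text \<open>Along the path that multiplies \<open>x\<close> by \<open>exp (2 \<pi> i t s)\<close>, where \<open>s\<close> runs from 0 to 1, every linear
  form makes the same number \<open>t\<close> of turns.\<close>

lemma monodromy_image_scalar:
  assumes x: "x \<in> X" and W: "mat (exp (2 * pi * \<i> * t)) \<in> W"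
  shows "(mat (exp (2 * pi * \<i> * t)), \<lambda>H. if H \<in> \<A> then t else 0)
      \<in> monodromy_image x"
proof -
  define e where "e s = exp (2 * pi * \<i> * t * complex_of_real s)" for s
  define p where "p s = e s *s x" for s
  have "path e" unfolding e_def path_def by (intro continuous_intros)
  have mat: "mat c *v x = c *s x" for c :: complex
    by (simp add: vec2_eq_iff mat_def matrix_vector_mult_def sum_2)
  have e0: "e s \<noteq> 0" for s by (simp add: e_def)
  have inX: "c *s x \<in> X" if "c \<noteq> 0" for c
    using x that by (auto simp: complement_eq lines_complement_def wedge_scale_right)
  have "path p" using \<open>path e\<close> unfolding p_def path_def by (intro continuous_intros)
  moreover have "path_image p \<subseteq> X" using inX[OF e0] by (auto simp: path_image_def p_def)
  moreover have "p 0 = x" "p 1 = exp (2 * pi * \<i> * t) *s x" by (simp_all add: p_def e_def)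
  ultimately have "path_in X x (mat (exp (2 * pi * \<i> * t)) *v x) p"
    by (simp add: path_in_def pathstart_def pathfinish_def mat)
  moreover have "turns p = (\<lambda>H. if H \<in> \<A> then t else 0)"
  proof
    fix H show "turns p H = (if H \<in> \<A> then t else 0)"
    proof (cases "H \<in> \<A>")
      case True
      have "wedge (generator H) \<circ> p = (\<lambda>s. wedge (generator H) x * e s)"
        by (simp add: fun_eq_iff p_def wedge_scale_right)
      then have "turns p H = winding_number (\<lambda>s. wedge (generator H) x * e s) 0"
        using True by (simp add: turns_def)
      also have "\<dots> = winding_number e 0"
        using \<open>path e\<close> e0[symmetric] wedge_nonzero[OF x True]
        by (intro winding_number_scale) (auto simp: path_image_def)
      also have "\<dots> = t" unfolding e_def by (rule winding_number_exp_line)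
      finally show ?thesis using True by simp
    qed (simp add: turns_def)
  qed
  ultimately show ?thesis using monodromy_in_image[OF W, of x p] by simp
qed

lemma small_scale_exists:
  fixes a b :: "'k \<Rightarrow> complex"
  assumes "finite S" "\<And>k. k \<in> S \<Longrightarrow> a k \<noteq> 0"
  obtains e :: real where "e > 0" "\<And>k. k \<in> S \<Longrightarrow> e * norm (b k) < norm (a k)"
proof -
  define E where "E = insert 1 ((\<lambda>k. norm (a k) / (norm (b k) + 1)) ` S)"
  have E: "finite E" "E \<noteq> {}" using assms by (auto simp: E_def)
  have "Min E > 0"
    unfolding Min_gr_iff[OF E] using assms by (auto simp: E_def add_nonneg_pos)
  moreover have "Min E * norm (b k) < norm (a k)" if "k \<in> S" for k
  proof -
    have "Min E \<le> norm (a k) / (norm (b k) + 1)" using E that by (intro Min_le) (auto simp: E_def)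
    then have "Min E * (norm (b k) + 1) \<le> norm (a k)" by (simp add: pos_le_divide_eq add_nonneg_pos)
    then show ?thesis using \<open>Min E > 0\<close> by (simp add: algebra_simps)
  qed
  ultimately show thesis by (rule that)
qed

text \<open>The loop runs once around a small circle with centre at a point that lies on \<open>H\<close> and on no other
  line, and is joined to the base point.\<close>

lemma meridian_exists:
  assumes x: "x \<in> X" and H: "H \<in> \<A>"
  obtains p where "path_in X x x p" "turns p = (\<lambda>K. if K = H then 1 else 0)"
proof -
  define h where "h = generator H"
  have h: "h \<noteq> 0" "h \<in> H" using generator arrangement_line[OF H] by (auto simp: h_def)
  obtain u where u: "wedge h u = 1" using exists_wedge_1[OF h(1)] .
  have gen: "wedge (generator K) h \<noteq> 0" if "K \<in> \<A> - {H}" for K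
    using that lines_independent[of K H "generator K" h] generator arrangement_line H h by blast
  obtain e where e: "e > 0" "\<And>K. K \<in> \<A> - {H} \<Longrightarrow> e * norm (wedge (generator K) u) < norm (wedge (generator K) h)"
    using small_scale_exists[of "\<A> - {H}" "\<lambda>K. wedge (generator K) h" "\<lambda>K. wedge (generator K) u"]
      gen finite_arrangement by auto
  define r where "r s = exp (2 * pi * \<i> * complex_of_real s)" for s :: real
  have r: "path r" "norm (r s) = 1" "r 0 = 1" "r 1 = 1" for s
    unfolding r_def path_def by (auto simp: norm_exp_eq_Re intro!: continuous_intros)
  have r0: "0 \<noteq> r s" for s by (simp add: r_def)
  define c where "c s = h + (of_real e * r s) *s u" for s
  have wc: "wedge (generator K) (c s) = wedge (generator K) h + e * r s * wedge (generator K) u" for K s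
    by (simp add: c_def wedge_add_right wedge_scale_right)
  have ball: "wedge (generator K) (c s) \<in> ball (wedge (generator K) h) (norm (wedge (generator K) h))"
    if "K \<in> \<A> - {H}" for K s
    using e(2)[OF that] e(1) by (simp add: wc dist_norm norm_mult r)
  have wH: "wedge (generator H) (c s) = e * r s" for s
    using u by (simp add: wc h_def)
  have "wedge (generator K) (c s) \<noteq> 0" if "K \<in> \<A>" for K s
  proof (cases "K = H")
    case True then show ?thesis using wH e(1) by (simp add: r_def)
  next
    case False then show ?thesis using ball[of K s] that by (auto simp: dist_norm)
  qed
  then have "c s \<in> X" for s by (auto simp: complement_eq lines_complement_def)
  then have c: "path_in X (c 0) (c 0) c"
    using r(1) by (auto simp: path_in_def path_image_def pathstart_def pathfinish_def path_def c_def r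
        intro!: continuous_intros)
  obtain d where d: "path_in X x (c 0) d" using path_in_complement_exists[OF x \<open>c 0 \<in> X\<close>] .
  have tc: "turns c K = (if K = H then 1 else 0)" for K
  proof (cases "K \<in> \<A>")
    case True
    show ?thesis
    proof (cases "K = H")
      case True
      have "turns c H = winding_number (\<lambda>s. of_real e * r s) 0"
        using H wH by (simp add: turns_def o_def)
      also have "\<dots> = winding_number r 0"
        using r(1) e(1) r0 by (intro winding_number_scale) (auto simp: path_image_def)
      also have "\<dots> = 1" using winding_number_exp_line[of 1] by (simp add: r_def[abs_def])
      finally show ?thesis using True by simp
    next
      case False
      have "winding_number (wedge (generator K) \<circ> c) 0 = 0"
        using path_wedge_generator[OF c True] ball[of K] True False
        by (intro winding_number_zero_outside[of _ "ball (wedge (generator K) h) (norm (wedge (generator K) h))"])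
           (auto simp: path_image_def pathstart_def pathfinish_def c_def r)
      then show ?thesis using True False by (simp add: turns_def)
    qed
  qed (use H in \<open>auto simp: turns_def\<close>)
  have cd: "path_in X (c 0) x (c +++ reversepath d)" using c d by (intro path_in_intros)
  have "turns (d +++ (c +++ reversepath d)) K = (if K = H then 1 else 0)" for K
    using turns_join[OF d cd] turns_join[OF c path_in_reverse[OF d]] turns_reverse[OF d] tc by simp
  moreover have "path_in X x x (d +++ (c +++ reversepath d))" using d cd by (rule path_in_join)
  ultimately show thesis using that[of "d +++ (c +++ reversepath d)"] by auto
qed

abbreviation "image_group x \<equiv> winding_extension\<lparr>carrier := monodromy_image x\<rparr>"

lemma subgroup_monodromy_image:
  assumes "x \<in> X" shows "subgroup (monodromy_image x) winding_extension"
proof -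
  interpret group_hom "braid_group W x" winding_extension "monodromy x"
    using assms monodromy_hom group_braid_group group_winding_extension
    by (simp add: group_hom_def group_hom_axioms_def)
  show ?thesis by (rule img_is_subgroup)
qed

text \<open>The meridians realise the unit vectors, which generate all integral functions.\<close>

lemma monodromy_image_integral:
  assumes x: "x \<in> X" and f: "\<And>H. H \<in> \<A> \<Longrightarrow> f H \<in> \<int>" "\<And>H. H \<notin> \<A> \<Longrightarrow> f H = 0"
  shows "(mat 1, f) \<in> monodromy_image x"
proof -
  let ?S = "monodromy_image x"
  note S = subgroup_monodromy_image[OF x]
  interpret M: group winding_extension by (rule group_winding_extension)
  define Z where "Z = {f. (mat 1, f) \<in> ?S}"
  have zero: "(\<lambda>_. 0) \<in> Z" using subgroup.one_closed[OF S] by (simp add: Z_def)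
  have add: "(\<lambda>H. f H + g H) \<in> Z" if "f \<in> Z" "g \<in> Z" for f g
    using subgroup.m_closed[OF S, of "(mat 1, f)" "(mat 1, g)"] that by (simp add: Z_def pre_one)
  have neg: "(\<lambda>H. - f H) \<in> Z" if "f \<in> Z" for f
  proof -
    have f: "(mat 1, f) \<in> ?S" using that by (simp add: Z_def)
    have f0: "\<And>H. H \<notin> \<A> \<Longrightarrow> f H = 0" using subsetD[OF subgroup.subset[OF S] f] by simp
    have "inv\<^bsub>winding_extension\<^esub> (mat 1, f) = (mat 1, \<lambda>H. - f H)"
      using f0 one_W by (intro M.inv_equality) (auto simp: pre_one)
    then show ?thesis using subgroup.m_inv_closed[OF S f] by (simp add: Z_def)
  qed
  have unit: "(\<lambda>K. if K = H then 1 else 0) \<in> Z" if H: "H \<in> \<A>" for H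
  proof -
    obtain p where "path_in X x x p" "turns p = (\<lambda>K. if K = H then 1 else 0)" using meridian_exists[OF x H] .
    then show ?thesis using monodromy_in_image[OF one_W, of x p] by (simp add: Z_def)
  qed
  have nat: "(\<lambda>K. if K = H then of_nat n else 0) \<in> Z" if H: "H \<in> \<A>" for H n
  proof (induction n)
    case (Suc n)
    have "(\<lambda>K. if K = H then of_nat (Suc n) else 0)
        = (\<lambda>K. (if K = H then of_nat n else 0) + (if K = H then 1 else 0 :: complex))" by auto
    then show ?case using add[OF Suc unit[OF H]] by simp
  next
    case 0
    have "(\<lambda>K. if K = H then of_nat 0 else 0) = (\<lambda>_. 0 :: complex)" by auto
    then show ?case using zero by simp
  qed
  have int: "(\<lambda>K. if K = H then of_int n else 0) \<in> Z" if H: "H \<in> \<A>" for H n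
  proof (cases n rule: int_cases2)
    case (nonneg k)
    show ?thesis unfolding nonneg of_int_of_nat_eq by (rule nat[OF H])
  next
    case (nonpos k)
    have "(\<lambda>K. if K = H then of_int n else 0) = (\<lambda>K. - (if K = H then of_nat k else 0 :: complex))"
      using nonpos by auto
    then show ?thesis using neg[OF nat[OF H, of k]] by simp
  qed
  have "(\<lambda>K. if K \<in> F then f K else 0) \<in> Z" if "F \<subseteq> \<A>" for F
    using finite_subset[OF that finite_arrangement] that
  proof (induction F rule: finite_induct)
    case (insert H F)
    obtain n where n: "f H = of_int n" using f(1)[of H] insert.prems by (auto elim: Ints_cases)
    have "(\<lambda>K. if K \<in> insert H F then f K else 0)
        = (\<lambda>K. (if K \<in> F then f K else 0) + (if K = H then of_int n else 0))"
      using insert.hyps n by auto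
    then show ?case using add[OF insert.IH int[of H n]] insert.prems by simp
  qed (simp add: zero)
  from this[of \<A>] have "(\<lambda>K. if K \<in> \<A> then f K else 0) \<in> Z" by simp
  moreover have "(\<lambda>K. if K \<in> \<A> then f K else 0) = f" using f(2) by auto
  ultimately show ?thesis by (simp add: Z_def)
qed

theorem quotient_iso_image:
  assumes x: "x \<in> X"
  shows "(\<lambda>C. the_elem (monodromy x ` C)) \<in> iso (braid_mod_pure_commutators W x) (image_group x)"
    and "group (braid_mod_pure_commutators W x)" and "group (image_group x)"
proof -
  show gI: "group (image_group x)"
    using subgroup_monodromy_image[OF x] group_winding_extension by (rule subgroup.subgroup_is_group)
  interpret group_hom "braid_group W x" "image_group x" "monodromy x"
    using x monodromy_hom[OF x] group_braid_group[OF x] gI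
    by (simp add: group_hom_def group_hom_axioms_def hom_def)
  have k: "kernel (braid_group W x) (image_group x) (monodromy x)
      = pure_to_braid W x ` derived (pure_braid_group W x) (carrier (pure_braid_group W x))"
    using kernel_monodromy[OF x] by (simp add: kernel_def)
  show "(\<lambda>C. the_elem (monodromy x ` C)) \<in> iso (braid_mod_pure_commutators W x) (image_group x)"
    using FactGroup_iso_set unfolding k braid_mod_pure_commutators_def by simp
  show "group (braid_mod_pure_commutators W x)"
    using normal.factorgroup_is_group[OF normal_kernel] unfolding k braid_mod_pure_commutators_def .
qed

end

section \<open>Bieberbach groups up to isomorphism\<close>

lemma comm_subgroup_iff:
  assumes "group G" "subgroup A G"
  shows "comm_group (G\<lparr>carrier := A\<rparr>) \<longleftrightarrow> (\<forall>a\<in>A. \<forall>b\<in>A. a \<otimes>\<^bsub>G\<^esub> b = b \<otimes>\<^bsub>G\<^esub> a)"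
proof
  assume "comm_group (G\<lparr>carrier := A\<rparr>)"
  then interpret comm_group "G\<lparr>carrier := A\<rparr>" .
  show "\<forall>a\<in>A. \<forall>b\<in>A. a \<otimes>\<^bsub>G\<^esub> b = b \<otimes>\<^bsub>G\<^esub> a" using m_comm by simp
next
  assume c: "\<forall>a\<in>A. \<forall>b\<in>A. a \<otimes>\<^bsub>G\<^esub> b = b \<otimes>\<^bsub>G\<^esub> a"
  interpret group "G\<lparr>carrier := A\<rparr>" using assms(2,1) by (rule subgroup.subgroup_is_group)
  show "comm_group (G\<lparr>carrier := A\<rparr>)" using c by (intro group_comm_groupI) simp
qed

lemma bieberbach_group_iso:
  assumes "\<psi> \<in> iso G H" "group G" "group H" "bieberbach_group H N \<Phi>"
  shows "bieberbach_group G N \<Phi>"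
proof -
  interpret G: group G by fact
  interpret H: group H by fact
  define \<theta> where "\<theta> = inv_into (carrier G) \<psi>"
  have \<psi>: "\<psi> \<in> hom G H" "bij_betw \<psi> (carrier G) (carrier H)" using assms(1) by (auto simp: iso_def)
  have \<theta>: "\<theta> \<in> hom H G" "bij_betw \<theta> (carrier H) (carrier G)"
    using G.iso_set_sym[OF assms(1)] by (auto simp: iso_def \<theta>_def)
  have \<theta>\<psi>: "\<theta> (\<psi> a) = a" if "a \<in> carrier G" for a
    using that \<psi>(2) by (simp add: \<theta>_def bij_betw_def)
  have \<psi>\<theta>: "\<psi> (\<theta> b) = b" if "b \<in> carrier H" for b
    using that \<psi>(2) by (simp add: \<theta>_def bij_betw_def f_inv_into_f)
  interpret gh: group_hom G H \<psi> using \<psi> by unfold_locales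
  interpret hg: group_hom H G \<theta> using \<theta> by unfold_locales
  obtain i p where ip: "group \<Phi>" "finite (carrier \<Phi>)" "i \<in> mon (int_power_group N) H" "p \<in> epi H \<Phi>"
      "i ` carrier (int_power_group N) = kernel H \<Phi> p"
      "maximal_abelian_subgroup H (i ` carrier (int_power_group N))"
    using assms(4) unfolding bieberbach_group_def crystallographic_group_def by blast
  let ?Z = "carrier (int_power_group N)"
  have iZ: "i z \<in> carrier H" if "z \<in> ?Z" for z
    using ip(3) that by (auto simp: mon_def hom_def)
  have "\<theta> \<circ> i \<in> mon (int_power_group N) G"
    using ip(3) hom_compose[of i "int_power_group N" H \<theta> G] \<theta> iZ
    unfolding mon_def by (auto intro!: comp_inj_on simp: bij_betw_def intro: inj_on_subset)
  moreover have "p \<circ> \<psi> \<in> epi G \<Phi>"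
  proof -
    have "(p \<circ> \<psi>) ` carrier G = carrier \<Phi>"
      using ip(4) \<psi>(2) unfolding image_comp[symmetric] epi_def bij_betw_def by simp
    then show ?thesis using ip(4) hom_compose[of \<psi> G H p \<Phi>] \<psi>(1) by (simp add: epi_def)
  qed
  moreover have "(\<theta> \<circ> i) ` ?Z = kernel G \<Phi> (p \<circ> \<psi>)"
  proof -
    have "(\<theta> \<circ> i) ` ?Z = \<theta> ` kernel H \<Phi> p" unfolding ip(5)[symmetric] by (rule image_comp[symmetric])
    also have "\<dots> = kernel G \<Phi> (p \<circ> \<psi>)"
    proof
      show "\<theta> ` kernel H \<Phi> p \<subseteq> kernel G \<Phi> (p \<circ> \<psi>)" by (auto simp: kernel_def \<psi>\<theta>)
      show "kernel G \<Phi> (p \<circ> \<psi>) \<subseteq> \<theta> ` kernel H \<Phi> p"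
      proof
        fix g assume "g \<in> kernel G \<Phi> (p \<circ> \<psi>)"
        then have "g \<in> carrier G" "\<psi> g \<in> kernel H \<Phi> p" by (auto simp: kernel_def)
        then show "g \<in> \<theta> ` kernel H \<Phi> p" using \<theta>\<psi> by (metis imageI)
      qed
    qed
    finally show ?thesis .
  qed
  moreover have "maximal_abelian_subgroup G ((\<theta> \<circ> i) ` ?Z)"
  proof -
    let ?T = "i ` ?Z"
    have T: "subgroup ?T H" "comm_group (H\<lparr>carrier := ?T\<rparr>)"
        "\<And>A. subgroup A H \<Longrightarrow> comm_group (H\<lparr>carrier := A\<rparr>) \<Longrightarrow> ?T \<subseteq> A \<Longrightarrow> A = ?T"
      using ip(6) unfolding maximal_abelian_subgroup_def by blast+
    have TH: "?T \<subseteq> carrier H" using T(1) by (rule subgroup.subset)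
    have S: "subgroup (\<theta> ` ?T) G" using T(1) by (rule hg.subgroup_img_is_subgroup)
    have "\<theta> a \<otimes>\<^bsub>G\<^esub> \<theta> b = \<theta> b \<otimes>\<^bsub>G\<^esub> \<theta> a" if "a \<in> ?T" "b \<in> ?T" for a b
    proof -
      have "a \<in> carrier H" "b \<in> carrier H" using that TH by blast+
      moreover have "a \<otimes>\<^bsub>H\<^esub> b = b \<otimes>\<^bsub>H\<^esub> a"
        using T(2) comm_subgroup_iff[OF assms(3) T(1)] that by blast
      ultimately show ?thesis using hg.hom_mult by metis
    qed
    then have C: "comm_group (G\<lparr>carrier := \<theta> ` ?T\<rparr>)"
      unfolding comm_subgroup_iff[OF assms(2) S] by blast
    have "A = \<theta> ` ?T" if A: "subgroup A G" "comm_group (G\<lparr>carrier := A\<rparr>)" "\<theta> ` ?T \<subseteq> A" for A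
    proof -
      have AG: "A \<subseteq> carrier G" using A(1) by (rule subgroup.subset)
      have SA: "subgroup (\<psi> ` A) H" using A(1) by (rule gh.subgroup_img_is_subgroup)
      have "\<psi> a \<otimes>\<^bsub>H\<^esub> \<psi> b = \<psi> b \<otimes>\<^bsub>H\<^esub> \<psi> a" if "a \<in> A" "b \<in> A" for a b
      proof -
        have "a \<in> carrier G" "b \<in> carrier G" using that AG by blast+
        moreover have "a \<otimes>\<^bsub>G\<^esub> b = b \<otimes>\<^bsub>G\<^esub> a"
          using A(2) comm_subgroup_iff[OF assms(2) A(1)] that by blast
        ultimately show ?thesis using gh.hom_mult by metis
      qed
      then have "comm_group (H\<lparr>carrier := \<psi> ` A\<rparr>)"
        unfolding comm_subgroup_iff[OF assms(3) SA] by blast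
      moreover have "?T \<subseteq> \<psi> ` A"
      proof
        fix t assume t: "t \<in> ?T"
        then have "\<psi> (\<theta> t) = t" using \<psi>\<theta> TH by blast
        then show "t \<in> \<psi> ` A" using A(3) t by (metis imageI subsetD)
      qed
      ultimately have "\<psi> ` A = ?T" using T(3)[OF SA] by blast
      then have "\<theta> ` ?T = \<theta> ` \<psi> ` A" by simp
      also have "\<dots> = (\<lambda>a. a) ` A" unfolding image_image using \<theta>\<psi> AG by (intro image_cong) auto
      finally show ?thesis by simp
    qed
    with S C show ?thesis
      unfolding maximal_abelian_subgroup_def image_comp[symmetric] by blast
  qed
  ultimately have "crystallographic_group G N \<Phi>"
    unfolding crystallographic_group_def using assms(2) ip(1,2) by blast
  moreover have "torsion_free G"
    unfolding torsion_free_def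
  proof (intro ballI allI impI)
    fix g and n :: nat
    assume g: "g \<in> carrier G" "n > 0 \<and> g [^]\<^bsub>G\<^esub> n = \<one>\<^bsub>G\<^esub>"
    then have "\<psi> g [^]\<^bsub>H\<^esub> n = \<one>\<^bsub>H\<^esub>" using gh.hom_nat_pow[OF g(1), of n] by simp
    moreover have "torsion_free H" using assms(4) by (simp add: bieberbach_group_def)
    ultimately have "\<psi> g = \<one>\<^bsub>H\<^esub>"
      using g(2) gh.hom_closed[OF g(1)] unfolding torsion_free_def by blast
    then show "g = \<one>\<^bsub>G\<^esub>" using \<theta>\<psi>[OF g(1)] by simp
  qed
  ultimately show ?thesis by (simp add: bieberbach_group_def)
qed

section \<open>The lattice of translations\<close>

lemma exp_2pi_eq_1_iff: "exp (2 * pi * \<i> * z) = 1 \<longleftrightarrow> z \<in> \<int>"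
proof
  assume "exp (2 * pi * \<i> * z) = 1"
  then obtain n :: int where "Im z = 0" "Re z = of_int n"
    unfolding exp_eq_1 by auto
  then have "z = of_int n" by (simp add: complex_eq_iff)
  then show "z \<in> \<int>" by simp
next
  assume "z \<in> \<int>"
  then obtain n where "z = of_int n" by (auto elim: Ints_cases)
  then show "exp (2 * pi * \<i> * z) = 1" using exp_2pi_1_int[of n] by (simp add: mult.commute mult.left_commute)
qed

lemma mat_mult_vec: "mat c *v v = c *s (v :: complex^2)"
  by (simp add: vec2_eq_iff mat_def matrix_vector_mult_def sum_2)

lemma mat_mult_mat: "mat c ** mat d = (mat (c * d) :: complex^2^2)"
  unfolding matrix_eq by (simp add: matrix_vector_mul_assoc[symmetric] mat_mult_vec vec2_eq_iff)

lemma mat_eq_iff: "(mat c :: complex^2^2) = mat d \<longleftrightarrow> c = d"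
  by (auto simp: vec_eq_iff mat_def)

text \<open>The third eigenvector has nonzero components along the other two, which forces the three
  eigenvalues to agree.\<close>

lemma three_invariant_lines_imp_scalar:
  fixes w :: "complex^2^2"
  assumes lines: "is_line H1" "is_line H2" "is_line H3" "H1 \<noteq> H2" "H1 \<noteq> H3" "H2 \<noteq> H3"
    and inv: "(*v) w ` H1 \<subseteq> H1" "(*v) w ` H2 \<subseteq> H2" "(*v) w ` H3 \<subseteq> H3"
  obtains c where "w = mat c"
proof -
  define h1 where "h1 = generator H1" define h2 where "h2 = generator H2" define h3 where "h3 = generator H3"
  have h: "h1 \<noteq> 0" "h1 \<in> H1" "h2 \<noteq> 0" "h2 \<in> H2" "h3 \<noteq> 0" "h3 \<in> H3"
    using generator[OF lines(1)] generator[OF lines(2)] generator[OF lines(3)]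
    by (auto simp: h1_def h2_def h3_def)
  have eig: "\<exists>c. w *v k = c *s k" if "is_line K" "(*v) w ` K \<subseteq> K" "k \<noteq> 0" "k \<in> K" for K k
  proof -
    have "w *v k \<in> line k" using line_unique[OF that(1,4,3)] that(2,4) by blast
    then show ?thesis using line_memD that(3) by blast
  qed
  obtain c1 c2 c3 where c: "w *v h1 = c1 *s h1" "w *v h2 = c2 *s h2" "w *v h3 = c3 *s h3"
    using eig lines inv h by metis
  have n12: "wedge h1 h2 \<noteq> 0" and n13: "wedge h1 h3 \<noteq> 0" and n23: "wedge h2 h3 \<noteq> 0"
    using lines_independent[OF lines(1,2,4) h(2,1,4,3)] lines_independent[OF lines(1,3,5) h(2,1,6,5)]
      lines_independent[OF lines(2,3,6) h(4,3,6,5)] by auto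
  obtain a b where ab: "h3 = a *s h1 + b *s h2" using vector_in_basis[OF n12] .
  have "wedge h1 (w *v h3) = wedge h1 (c3 *s h3)" "wedge h2 (w *v h3) = wedge h2 (c3 *s h3)"
    using c by simp_all
  then have "b * c2 * wedge h1 h2 = c3 * b * wedge h1 h2" "a * c1 * wedge h2 h1 = c3 * a * wedge h2 h1"
    unfolding ab by (simp_all add: matrix_vector_right_distrib vector_scalar_commute c wedge_add_right wedge_scale_right)
  moreover have "wedge h1 h3 = b * wedge h1 h2" "wedge h2 h3 = a * wedge h2 h1"
    unfolding ab by (simp_all add: wedge_add_right wedge_scale_right)
  then have "a \<noteq> 0" "b \<noteq> 0" "wedge h2 h1 \<noteq> 0" using n13 n23 by auto
  ultimately have "c2 = c3" "c1 = c3" using n12 by auto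
  then have "w = mat c3" using c by (intro matrix_eq_on_basis[OF n12]) (simp_all add: mat_mult_vec)
  then show thesis by (rule that)
qed

context rank2_reflection_group
begin

lemma pre_scalar: "is_line H \<Longrightarrow> c \<noteq> 0 \<Longrightarrow> pre (mat c) H = H"
  by (auto simp: is_line_def line_def mat_mult_vec wedge_scale_right)

lemma scalar_in_W_nonzero: "mat c \<in> W \<Longrightarrow> c \<noteq> 0"
  using W_vec_eq_0[of "mat c" "vector [1, 0]"] by (auto simp: mat_mult_vec vec2_eq_iff)

lemma monodromy_image_carrier:
  assumes "(w, f) \<in> monodromy_image x" "x \<in> X"
  shows "w \<in> W" "H \<notin> \<A> \<Longrightarrow> f H = 0"
  using subsetD[OF subgroup.subset[OF subgroup_monodromy_image[OF assms(2)]] assms(1)] by auto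

text \<open>The elements over scalars form the lattice of the functions \<open>f\<close> that are congruent to a constant
  multiple of \<open>1 / m\<close> modulo integers.  It has a basis that consists of the constant function \<open>1 / m\<close>
  and the indicators of all lines except one, so its rank is the number of lines.  An element that
  commutes with the indicator of each line fixes each line, so it lies over a scalar.\<close>

lemma crystallographic_image_group:
  assumes x: "x \<in> X" and m: "m > 0" and scalars: "\<And>c. mat c \<in> W \<longleftrightarrow> c ^ m = 1"
    and N: "card \<A> \<ge> 3"
    and \<pi>: "\<pi> \<in> epi (GL\<lparr>carrier := W\<rparr>) \<Phi>" "kernel (GL\<lparr>carrier := W\<rparr>) \<Phi> \<pi> = {w \<in> W. \<exists>c. w = mat c}"
    and \<Phi>: "group \<Phi>" "finite (carrier \<Phi>)"
  shows "crystallographic_group (image_group x) (card \<A>) \<Phi>"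
proof -
  let ?E = "monodromy_image x" and ?N = "card \<A>"
  let ?G = "image_group x" and ?Z = "int_power_group (card \<A>)"
  note E = subgroup_monodromy_image[OF x]
  interpret E: group ?G using quotient_iso_image(3)[OF x] .
  obtain e where e: "bij_betw e {..<?N} \<A>"
    using ex_bij_betw_nat_finite[OF finite_arrangement] by (auto simp: atLeast0LessThan)
  have eA: "e j \<in> \<A>" if "j < ?N" for j using e that by (auto simp: bij_betw_def)
  define idx where "idx = inv_into {..<?N} e"
  have idx: "idx H < ?N" "e (idx H) = H" if "H \<in> \<A>" for H
    using e that unfolding idx_def bij_betw_def
    by (metis inv_into_into lessThan_iff, metis f_inv_into_f)
  have idx_e: "idx (e j) = j" if "j < ?N" for j
    using e that by (simp add: idx_def bij_betw_def)
  \<comment> \<open>The coordinate 0 counts multiples of \<open>1 / m\<close> on all lines.  The other coordinates are the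
    integral differences from the line \<open>e 0\<close>.\<close>
  define t where "t n = complex_of_int (n 0) / of_nat m" for n :: "nat \<Rightarrow> int"
  define g where "g n H = (if H \<in> \<A> \<and> idx H \<noteq> 0 then complex_of_int (n (idx H)) else 0)"
    for n :: "nat \<Rightarrow> int" and H
  define c where "c n = exp (2 * pi * \<i> * t n)" for n :: "nat \<Rightarrow> int"
  define i where "i n = (mat (c n) :: complex^2^2, \<lambda>H. g n H + (if H \<in> \<A> then t n else 0))"
    for n :: "nat \<Rightarrow> int"
  have cW: "mat (c n) \<in> W" for n
  proof -
    have "c n ^ m = exp (2 * pi * \<i> * of_int (n 0))"
      unfolding c_def t_def exp_of_nat_mult[symmetric] using m by (intro arg_cong[where f = exp]) simp
    then show ?thesis unfolding scalars using exp_2pi_eq_1_iff[of "of_int (n 0)"] by simp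
  qed
  have iE: "i n \<in> ?E" for n
  proof -
    have "(mat 1, g n) \<in> ?E" using x by (rule monodromy_image_integral) (auto simp: g_def)
    moreover have "(mat (c n), \<lambda>H. if H \<in> \<A> then t n else 0) \<in> ?E"
      using monodromy_image_scalar[OF x] cW unfolding c_def by blast
    ultimately have "(mat 1, g n) \<otimes>\<^bsub>winding_extension\<^esub> (mat (c n), \<lambda>H. if H \<in> \<A> then t n else 0) \<in> ?E"
      by (rule subgroup.m_closed[OF E])
    then show ?thesis by (simp add: i_def pre_one)
  qed
  have Zc: "carrier ?Z = (\<Pi>\<^sub>E j\<in>{..<?N}. UNIV)"
    by (simp add: int_power_group_def integer_group_def)
  have Zm: "n \<otimes>\<^bsub>?Z\<^esub> n' = (\<lambda>j\<in>{..<?N}. n j + n' j)" for n n'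
    by (simp add: int_power_group_def integer_group_def)
  have N0: "0 < ?N" using N by simp
  have "i \<in> hom ?Z ?G"
  proof (rule homI)
    fix n n' assume "n \<in> carrier ?Z" "n' \<in> carrier ?Z"
    have t: "t (n \<otimes>\<^bsub>?Z\<^esub> n') = t n + t n'" using N0 by (simp add: Zm t_def add_divide_distrib)
    have g: "g (n \<otimes>\<^bsub>?Z\<^esub> n') H = g n H + g n' H" for H using idx(1)[of H] by (simp add: Zm g_def)
    have c: "c (n \<otimes>\<^bsub>?Z\<^esub> n') = c n * c n'" unfolding c_def t by (simp add: distrib_left exp_add)
    have pre: "pre (mat (c n)) H \<in> \<A> \<longleftrightarrow> H \<in> \<A>" "H \<in> \<A> \<Longrightarrow> pre (mat (c n)) H = H" for H
      using arrangement_pre_iff[OF cW] pre_scalar[OF arrangement_line scalar_in_W_nonzero[OF cW]] by auto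
    have "g n' (pre (mat (c n)) H) = g n' H" for H using pre by (auto simp: g_def)
    then show "i (n \<otimes>\<^bsub>?Z\<^esub> n') = i n \<otimes>\<^bsub>?G\<^esub> i n'"
      by (auto simp: i_def c g t mat_mult_mat pre(1) fun_eq_iff simp del: vimage_Collect_eq)
  qed (use iE in auto)
  moreover have "inj_on i (carrier ?Z)"
  proof (rule inj_onI)
    fix n n' assume n: "n \<in> carrier ?Z" "n' \<in> carrier ?Z" "i n = i n'"
    have eq: "g n H + t n = g n' H + t n'" if "H \<in> \<A>" for H
      using n(3) that unfolding i_def by (auto dest!: fun_cong[of _ _ H])
    have t: "t n = t n'" using eq[OF eA[OF N0]] idx_e[OF N0] by (simp add: g_def)
    have "n j = n' j" if "j < ?N" for j
    proof (cases "j = 0")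
      case True then show ?thesis using t m by (simp add: t_def)
    next
      case False then show ?thesis using eq[OF eA[OF that]] t idx_e[OF that] eA[OF that] by (simp add: g_def)
    qed
    then show "n = n'" using n(1,2) unfolding Zc by (intro PiE_ext) auto
  qed
  ultimately have mon: "i \<in> mon ?Z ?G" by (simp add: mon_def)
  define p where "p = \<pi> \<circ> (fst :: _ \<times> ((complex^2) set \<Rightarrow> complex) \<Rightarrow> _)"
  have fst_hom: "fst \<in> hom ?G (GL\<lparr>carrier := W\<rparr>)"
  proof (rule homI)
    fix a b assume "a \<in> carrier ?G" "b \<in> carrier ?G"
    moreover obtain u f w g where "a = (u, f)" "b = (w, g)" by (cases a, cases b)
    ultimately show "fst a \<in> carrier (GL\<lparr>carrier := W\<rparr>)"
      "fst (a \<otimes>\<^bsub>?G\<^esub> b) = fst a \<otimes>\<^bsub>GL\<lparr>carrier := W\<rparr>\<^esub> fst b"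
      using monodromy_image_carrier(1)[OF _ x, of u f] by (simp_all add: GL_def)
  qed
  have fst_onto: "fst ` ?E = W"
  proof
    show "fst ` ?E \<subseteq> W"
    proof
      fix w assume "w \<in> fst ` ?E"
      then obtain a where a: "a \<in> ?E" "w = fst a" by blast
      then have "(w, snd a) \<in> ?E" by simp
      then obtain f where "(w, f) \<in> ?E" by blast
      then show "w \<in> W" using monodromy_image_carrier(1)[OF _ x] by blast
    qed
    show "W \<subseteq> fst ` ?E"
    proof
      fix w assume "w \<in> W"
      then obtain f where "(w, f) \<in> ?E" using monodromy_image_onto_W[OF x] by blast
      then have "fst (w, f) \<in> fst ` ?E" by (rule imageI)
      then show "w \<in> fst ` ?E" by simp
    qed
  qed
  have "p \<in> hom ?G \<Phi>" unfolding p_def using fst_hom \<pi>(1) by (auto simp: epi_def intro: hom_compose)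
  moreover have "p ` carrier ?G = carrier \<Phi>"
  proof -
    have "p ` ?E = \<pi> ` W" unfolding p_def image_comp[symmetric] fst_onto by (rule refl)
    then show ?thesis using \<pi>(1) by (simp add: epi_def)
  qed
  ultimately have epi: "p \<in> epi ?G \<Phi>" by (simp add: epi_def)
  have kernel_iff: "(w, f) \<in> kernel ?G \<Phi> p \<longleftrightarrow> (w, f) \<in> ?E \<and> (\<exists>c. w = mat c)" for w f
    using \<pi>(2) monodromy_image_carrier(1)[OF _ x, of w f] by (auto simp: kernel_def p_def)
  have im: "i ` carrier ?Z = kernel ?G \<Phi> p"
  proof
    show "i ` carrier ?Z \<subseteq> kernel ?G \<Phi> p" using iE kernel_iff by (auto simp: i_def)
    show "kernel ?G \<Phi> p \<subseteq> i ` carrier ?Z"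
    proof
      fix a assume a: "a \<in> kernel ?G \<Phi> p"
      obtain w f where wf: "a = (w, f)" by (cases a)
      then obtain l where l: "(w, f) \<in> ?E" "w = mat l" using a kernel_iff by blast
      have "l ^ m = 1" using monodromy_image_carrier(1)[OF l(1) x] l(2) scalars by simp
      have fl: "exp (2 * pi * \<i> * f H) = l" if "H \<in> \<A>" for H
        using monodromy_image_exp[OF l(1) x that] wedge_nonzero[OF x that] l(2)
        by (simp add: mat_mult_vec wedge_scale_right)
      define f0 where "f0 = f (e 0)"
      have "exp (2 * pi * \<i> * (of_nat m * f0)) = exp (2 * pi * \<i> * f0) ^ m"
        unfolding exp_of_nat_mult[symmetric] by (intro arg_cong[where f = exp]) simp
      then have "of_nat m * f0 \<in> \<int>"
        using fl[OF eA[OF N0]] \<open>l ^ m = 1\<close> by (simp add: f0_def exp_2pi_eq_1_iff[symmetric])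
      then obtain n0 where n0: "of_nat m * f0 = of_int n0" by (auto elim: Ints_cases)
      have "\<exists>k. f (e j) - f0 = of_int k" if "j < ?N" for j
      proof -
        have "exp (2 * pi * \<i> * (f (e j) - f0)) = exp (2 * pi * \<i> * f (e j)) / exp (2 * pi * \<i> * f0)"
          by (simp add: right_diff_distrib exp_diff)
        also have "\<dots> = 1" using fl[OF eA[OF that]] fl[OF eA[OF N0]] by (metis f0_def divide_self exp_not_eq_zero)
        finally show ?thesis unfolding exp_2pi_eq_1_iff by (auto elim: Ints_cases)
      qed
      then obtain k where k: "\<And>j. j < ?N \<Longrightarrow> f (e j) - f0 = of_int (k j)" by metis
      define n where "n = (\<lambda>j\<in>{..<?N}. if j = 0 then n0 else k j)"
      have nZ: "n \<in> carrier ?Z" by (simp add: Zc n_def)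
      have tn: "t n = f0" using n0 m N0 by (simp add: t_def n_def field_simps)
      have "g n H + (if H \<in> \<A> then t n else 0) = f H" for H
      proof (cases "H \<in> \<A>")
        case True
        show ?thesis
        proof (cases "idx H = 0")
          case True' : True
          then have "H = e 0" using idx(2)[OF True] by simp
          then show ?thesis using True True' tn by (simp add: g_def f0_def)
        next
          case False
          then show ?thesis using k[OF idx(1)[OF True]] idx[OF True] True tn
            by (simp add: g_def n_def algebra_simps)
        qed
      next
        case False
        then show ?thesis using monodromy_image_carrier(2)[OF l(1) x False] by (simp add: g_def)
      qed
      moreover have "c n = l" using fl[OF eA[OF N0]] by (simp add: c_def tn f0_def)
      ultimately have "i n = a" by (simp add: i_def wf l(2) fun_eq_iff)
      then show "a \<in> i ` carrier ?Z" using nZ by blast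
    qed
  qed
  have "maximal_abelian_subgroup ?G (kernel ?G \<Phi> p)"
  proof -
    interpret p: group_hom ?G \<Phi> p
      using epi \<Phi> E.group_axioms by (simp add: group_hom_def group_hom_axioms_def epi_def)
    have S: "subgroup (kernel ?G \<Phi> p) ?G" by (rule p.subgroup_kernel)
    have "a \<otimes>\<^bsub>?G\<^esub> b = b \<otimes>\<^bsub>?G\<^esub> a" if ab: "a \<in> kernel ?G \<Phi> p" "b \<in> kernel ?G \<Phi> p" for a b
    proof -
      obtain u f w g where uw: "a = (u, f)" "b = (w, g)" by (cases a, cases b)
      then obtain k l where kl: "u = mat k" "w = mat l" "(u, f) \<in> ?E" "(w, g) \<in> ?E"
        using ab kernel_iff by blast
      have z: "mat k \<in> W" "mat l \<in> W" using kl monodromy_image_carrier(1)[OF _ x] by auto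
      have f: "f (pre (mat l) H) = f H" and g: "g (pre (mat k) H) = g H" for H
        using monodromy_image_carrier(2)[OF kl(3) x] monodromy_image_carrier(2)[OF kl(4) x] z
          pre_scalar[OF arrangement_line scalar_in_W_nonzero] arrangement_pre_iff by (cases "H \<in> \<A>"; simp)+
      show ?thesis using f g by (simp add: uw kl(1,2) mat_mult_mat mult.commute add.commute)
    qed
    then have C: "comm_group (?G\<lparr>carrier := kernel ?G \<Phi> p\<rparr>)"
      unfolding comm_subgroup_iff[OF E.group_axioms S] by blast
    have "A \<subseteq> kernel ?G \<Phi> p"
      if A: "subgroup A ?G" "comm_group (?G\<lparr>carrier := A\<rparr>)" "kernel ?G \<Phi> p \<subseteq> A" for A
    proof
      fix a assume aA: "a \<in> A"
      obtain w f where wf: "a = (w, f)" by (cases a)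
      have aE: "(w, f) \<in> ?E" using subgroup.subset[OF A(1)] aA wf by auto
      have w: "w \<in> W" using monodromy_image_carrier(1)[OF aE x] .
      have "pre w H = H" if H: "H \<in> \<A>" for H
      proof -
        let ?u = "\<lambda>K. if K = H then 1 else 0 :: complex"
        have "(mat 1, ?u) \<in> ?E" using x by (rule monodromy_image_integral) (use H in auto)
        then have "(mat 1, ?u) \<in> A" using A(3) kernel_iff by blast
        then have "(w, f) \<otimes>\<^bsub>?G\<^esub> (mat 1, ?u) = (mat 1, ?u) \<otimes>\<^bsub>?G\<^esub> (w, f)"
          using A(2) comm_subgroup_iff[OF E.group_axioms A(1)] aA wf by blast
        then have "f K + ?u (pre w K) = ?u K + f K" for K by (simp add: pre_one fun_eq_iff)
        from this[of H] show ?thesis by (auto split: if_splits)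
      qed
      then have invar: "(*v) w ` H \<subseteq> H" if "H \<in> \<A>" for H using that by blast
      obtain \<B> where "\<B> \<subseteq> \<A>" "card \<B> = 3" using obtain_subset_with_card_n[OF N] by metis
      then obtain H1 H2 H3 where H: "H1 \<in> \<A>" "H2 \<in> \<A>" "H3 \<in> \<A>" "H1 \<noteq> H2" "H1 \<noteq> H3" "H2 \<noteq> H3"
        by (auto simp: card_3_iff)
      obtain l where "w = mat l"
        using three_invariant_lines_imp_scalar[OF arrangement_line[OF H(1)] arrangement_line[OF H(2)]
            arrangement_line[OF H(3)] H(4-6) invar[OF H(1)] invar[OF H(2)] invar[OF H(3)]] .
      then show "a \<in> kernel ?G \<Phi> p" using kernel_iff aE wf by blast
    qed
    with S C show ?thesis unfolding maximal_abelian_subgroup_def by blast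
  qed
  then show ?thesis
    unfolding crystallographic_group_def
    using E.group_axioms \<Phi> mon epi im by metis
qed

end

context matrix_group
begin

abbreviation "GW \<equiv> GL\<lparr>carrier := W\<rparr>"

lemma GL_simps [simp]: "u \<otimes>\<^bsub>GL\<^esub> w = u ** w" "\<one>\<^bsub>GL\<^esub> = mat 1"
  by (simp_all add: GL_def)

lemma pow_W: "w \<in> W \<Longrightarrow> w [^]\<^bsub>GW\<^esub> (n::nat) \<in> W"
  using monoid.nat_pow_closed[OF group.is_monoid[OF group_W], of w n] by simp

lemma pow_Suc_vec: "w [^]\<^bsub>GW\<^esub> Suc n *v v = w [^]\<^bsub>GW\<^esub> n *v (w *v v)"
  by (simp add: matrix_vector_mul_assoc)

lemma det_pow: "det (w [^]\<^bsub>GW\<^esub> (n::nat)) = det w ^ n"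
  by (induction n) (simp_all add: det_mul)

lemma pow_card_W: "w \<in> W \<Longrightarrow> w [^]\<^bsub>GW\<^esub> card W = mat 1"
  using group.pow_order_eq_1[OF group_W, of w] by (simp add: Coset.order_def)

lemma eigenvector_pow: "w *v h = c *s h \<Longrightarrow> w [^]\<^bsub>GW\<^esub> (n::nat) *v h = c ^ n *s h"
  by (induction n) (simp_all add: matrix_vector_mul_assoc[symmetric] vector_scalar_commute mult.commute)

text \<open>If the matrix were not scalar, its \<open>n\<close>-th power would contain \<open>n \<mu> ^ (n - 1) a\<close> with \<open>a \<noteq> 0\<close> off
  the diagonal, so no power would be the identity.\<close>

lemma double_eigenvalue_imp_scalar:
  assumes w: "w \<in> W" and h: "h \<noteq> 0" "w *v h = \<mu> *s h" and det: "det w = \<mu>\<^sup>2"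
  shows "w = mat \<mu>"
proof -
  obtain v where v: "wedge h v = 1" using exists_wedge_1[OF h(1)] .
  have \<mu>: "\<mu> \<noteq> 0" using det_W[OF w] det by auto
  obtain a b where ab: "w *v v = a *s h + b *s v" using vector_in_basis[of h v "w *v v"] v by auto
  have "\<mu> * b = \<mu>\<^sup>2"
    using wedge_matrix[of w h v] v det
    by (simp add: h(2) ab wedge_scale_left wedge_add_right wedge_scale_right mult.commute)
  then have b: "b = \<mu>" using \<mu> by (simp add: power2_eq_square)
  have pow: "w [^]\<^bsub>GW\<^esub> Suc n *v v = \<mu> ^ Suc n *s v + (of_nat (Suc n) * \<mu> ^ n * a) *s h" for n
  proof (induction n)
    case 0
    show ?case using ab b by (simp add: vec2_eq_iff algebra_simps)
  next
    case (Suc n)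
    have "w [^]\<^bsub>GW\<^esub> Suc (Suc n) *v v = w [^]\<^bsub>GW\<^esub> Suc n *v (a *s h + \<mu> *s v)"
      unfolding pow_Suc_vec[of w "Suc n"] ab b ..
    also have "\<dots> = a *s (\<mu> ^ Suc n *s h) + \<mu> *s (\<mu> ^ Suc n *s v + (of_nat (Suc n) * \<mu> ^ n * a) *s h)"
      unfolding matrix_vector_right_distrib vector_scalar_commute Suc eigenvector_pow[OF h(2)] ..
    finally show ?case by (simp add: vec2_eq_iff algebra_simps)
  qed
  have "card W > 0" using finite_W w by (auto simp: card_gt_0_iff)
  then obtain n where n: "card W = Suc n" by (metis gr0_implies_Suc)
  have "v = \<mu> ^ Suc n *s v + (of_nat (Suc n) * \<mu> ^ n * a) *s h"
    using pow[of n] pow_card_W[OF w] n by simp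
  then have "wedge v v = wedge v (\<mu> ^ Suc n *s v + (of_nat (Suc n) * \<mu> ^ n * a) *s h)" by simp
  then have "of_nat (Suc n) * \<mu> ^ n * a * wedge v h = 0"
    by (simp only: wedge_add_right wedge_scale_right wedge_self mult_zero_right add_0)
  then have "a = 0" using \<mu> v wedge_commute[of v h] by (simp del: of_nat_Suc)
  then show ?thesis
    using h(2) ab b v by (intro matrix_eq_on_basis[of h v]) (simp_all add: mat_mult_vec)
qed

text \<open>Such a matrix is its own inverse, hence its own adjugate.\<close>

lemma involution_det_1:
  assumes w: "w \<in> W" "w ** w = mat 1" "det w = 1"
  shows "w = mat 1 \<or> w = mat (- 1)"
proof -
  have "wedge (w *v u) v = wedge u (w *v v)" for u v
    using wedge_matrix[of w u "w *v v"] w(2,3) by (simp add: matrix_vector_mul_assoc)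
  from this[of "vector [1, 0]" "vector [1, 0]"] this[of "vector [0, 1]" "vector [0, 1]"]
    this[of "vector [1, 0]" "vector [0, 1]"]
  have e: "w$2$1 = 0" "w$1$2 = 0" "w$1$1 = w$2$2"
    by (auto simp: wedge_def matrix_vector_mult_def sum_2)
  then have "(w$1$1)\<^sup>2 = 1" using w(3) by (simp add: det_2 power2_eq_square)
  then show ?thesis
    using e by (auto simp: power2_eq_1_iff vec_eq_iff forall_2 mat_def)
qed

end

context rank2_reflection_group
begin

section \<open>Torsion\<close>

text \<open>A reflection multiplies the form of its own line by its determinant.  It multiplies the product of
  the other forms by a constant, and this constant is one, because the product does not vanish at a
  nonzero point of the reflecting line, which is fixed.\<close>

lemma discriminant_character:
  assumes w: "w \<in> W"
  shows "(\<Prod>H\<in>\<A>. wedge (generator H) (w *v v)) = det w * (\<Prod>H\<in>\<A>. wedge (generator H) v)"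
proof -
  define D where "D v = (\<Prod>H\<in>\<A>. wedge (generator H) v)" for v
  have refl: "D (r *v v) = det r * D v" if r: "r \<in> W" "reflection r" for r v
  proof -
    obtain H0 where H0: "reflection_along r H0" using r(2) by (auto simp: reflection_def)
    then have A0: "H0 \<in> \<A>" using r(1) arrangement_iff by blast
    define h where "h = generator H0"
    have h: "h \<in> H0" "h \<noteq> 0" "r *v h = h"
      using generator arrangement_line[OF A0] H0 by (auto simp: h_def reflection_along_rank2)
    let ?A = "\<A> - {H0}"
    define D' where "D' v = (\<Prod>H\<in>?A. wedge (generator H) v)" for v
    have pre0: "pre r H0 = H0"
      using line_unique[OF is_line_pre[OF r(1) arrangement_line[OF A0]], of h]
        line_unique[OF arrangement_line[OF A0] h(1,2)] h by simp
    have bij: "bij_betw (pre r) ?A ?A"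
      using bij_betw_pre[OF r(1)] bij_betw_DiffI[of "pre r" \<A> \<A> "{H0}" "{H0}"] pre0 A0
      by (simp add: bij_betw_def)
    have "\<exists>k. \<forall>v. wedge (generator H) (r *v v) = k * wedge (generator (pre r H)) v" if "H \<in> \<A>" for H
      using wedge_generator_pre[OF r(1) arrangement_line[OF that]] by metis
    then obtain k where k: "\<And>H v. H \<in> \<A> \<Longrightarrow> wedge (generator H) (r *v v) = k H * wedge (generator (pre r H)) v"
      by metis
    have "D' (r *v v) = (\<Prod>H\<in>?A. k H) * D' v" for v
    proof -
      have "D' (r *v v) = (\<Prod>H\<in>?A. k H) * (\<Prod>H\<in>?A. wedge (generator (pre r H)) v)"
        unfolding D'_def prod.distrib[symmetric] using k by (intro prod.cong) auto
      also have "(\<Prod>H\<in>?A. wedge (generator (pre r H)) v) = D' v"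
        unfolding D'_def by (rule prod.reindex_bij_betw[OF bij])
      finally show ?thesis .
    qed
    moreover have "D' h \<noteq> 0"
    proof -
      have "wedge (generator H) h \<noteq> 0" if "H \<in> ?A" for H
        using that lines_independent[of H H0 "generator H" h] generator arrangement_line A0 h by blast
      then show ?thesis unfolding D'_def using finite_arrangement by simp
    qed
    ultimately have "D' (r *v v) = D' v" for v using h(3) by (metis mult_cancel_right1)
    moreover have "D v = wedge h v * D' v" for v
      unfolding D_def D'_def h_def using finite_arrangement A0 by (rule prod.remove)
    moreover have "wedge h (r *v v) = det r * wedge h v" using wedge_matrix[of r h v] h(3) by simp
    ultimately show ?thesis by simp
  qed
  have "w \<in> generate GL {r \<in> W. reflection r}" using w crg by (simp add: complex_reflection_group_def)
  then have "\<forall>v. D (w *v v) = det w * D v"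
  proof (induction rule: generate.induct)
    case one
    then show ?case by (simp add: GL_def)
  next
    case (incl r)
    then show ?case using refl by blast
  next
    case (inv r)
    then have r: "r \<in> W" "reflection r" by auto
    have "det r * det (minv r) = 1" using minv(3)[OF r(1)] by (metis det_I det_mul)
    moreover have "D v = det r * D (minv r *v v)" for v
      using refl[OF r, of "minv r *v v"] minv_vec(2)[OF r(1)] by simp
    ultimately have "D (minv r *v v) = det (minv r) * D v" for v
      by (metis mult.assoc mult.commute mult_1)
    then show ?case by (simp add: minv_def)
  next
    case (eng u w)
    then show ?case by (simp add: GL_def matrix_vector_mul_assoc[symmetric] det_mul)
  qed
  then show ?thesis by (simp add: D_def)
qed

text \<open>The sum of the turns around all lines is additive, so it vanishes on torsion elements.  Then
  the product of all linear forms takes the same value at \<open>x\<close> and at \<open>w *v x\<close>.\<close>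

lemma torsion_imp_det_1:
  assumes x: "x \<in> X" and g: "(w, f) \<in> monodromy_image x"
    and n: "n > 0" "(w, f) [^]\<^bsub>image_group x\<^esub> (n::nat) = \<one>\<^bsub>image_group x\<^esub>"
  shows "det w = 1"
proof -
  let ?G = "image_group x" and ?E = "monodromy_image x"
  interpret E: group ?G using quotient_iso_image(3)[OF x] .
  define \<sigma> where "\<sigma> a = (\<Sum>H\<in>\<A>. snd a H)" for a :: "(complex^2^2) \<times> ((complex^2) set \<Rightarrow> complex)"
  have \<sigma>_mult: "\<sigma> (a \<otimes>\<^bsub>?G\<^esub> b) = \<sigma> a + \<sigma> b" if "a \<in> ?E" for a b
  proof -
    obtain u f v g where ab: "a = (u, f)" "b = (v, g)" by (cases a, cases b)
    have "u \<in> W" using monodromy_image_carrier(1)[OF that[unfolded ab] x] .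
    then have "(\<Sum>H\<in>\<A>. g (pre u H)) = (\<Sum>H\<in>\<A>. g H)"
      by (rule sum.reindex_bij_betw[OF bij_betw_pre])
    then show ?thesis by (simp add: \<sigma>_def ab sum.distrib)
  qed
  have "(w, f) [^]\<^bsub>?G\<^esub> k \<in> ?E \<and> \<sigma> ((w, f) [^]\<^bsub>?G\<^esub> k) = of_nat k * \<sigma> (w, f)" for k :: nat
  proof (induction k)
    case 0
    show ?case using E.one_closed by (simp add: \<sigma>_def)
  next
    case (Suc k)
    have "(w, f) [^]\<^bsub>?G\<^esub> Suc k \<in> carrier ?G" using g by (intro E.nat_pow_closed) simp
    then show ?case using Suc \<sigma>_mult by (simp add: algebra_simps)
  qed
  from this[of n] have "of_nat n * \<sigma> (w, f) = 0" using n(2) by (simp add: \<sigma>_def)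
  then have sum0: "(\<Sum>H\<in>\<A>. f H) = 0" using n(1) by (simp add: \<sigma>_def)
  have "(\<Prod>H\<in>\<A>. wedge (generator H) (w *v x))
      = (\<Prod>H\<in>\<A>. exp (2 * pi * \<i> * f H) * wedge (generator H) x)"
    using monodromy_image_exp[OF g x] by (rule prod.cong[OF refl])
  also have "\<dots> = exp (2 * pi * \<i> * (\<Sum>H\<in>\<A>. f H)) * (\<Prod>H\<in>\<A>. wedge (generator H) x)"
    using finite_arrangement by (simp add: prod.distrib exp_sum sum_distrib_left)
  finally have "det w * (\<Prod>H\<in>\<A>. wedge (generator H) x) = (\<Prod>H\<in>\<A>. wedge (generator H) x)"
    using discriminant_character[OF monodromy_image_carrier(1)[OF g x], of x] sum0 by simp
  moreover have "(\<Prod>H\<in>\<A>. wedge (generator H) x) \<noteq> 0"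
    using wedge_nonzero[OF x] finite_arrangement by simp
  ultimately show ?thesis by simp
qed

text \<open>Repeated squaring reduces a torsion element to one over a matrix \<open>w\<close> with \<open>w ** w = mat 1\<close> and
  determinant one.  Over \<open>mat 1\<close> there are only translations.  Over \<open>mat (- 1)\<close> each linear form makes
  half a turn up to full turns, so the number of turns is not zero, and squaring doubles it.\<close>

lemma torsion_free_image_group:
  assumes x: "x \<in> X"
    and two_power: "\<And>w. w \<in> W \<Longrightarrow> det w = 1 \<Longrightarrow> \<exists>k::nat. w [^]\<^bsub>GW\<^esub> (2 ^ k :: nat) = mat 1"
  shows "torsion_free (image_group x)"
proof -
  let ?G = "image_group x" and ?E = "monodromy_image x"
  interpret E: group ?G using quotient_iso_image(3)[OF x] .
  interpret GW: group GW by (rule group_W)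
  have translation: "f = (\<lambda>_. 0)"
    if f: "(mat 1, f) \<in> ?E" "n > 0" "(mat 1, f) [^]\<^bsub>?G\<^esub> (n::nat) = \<one>\<^bsub>?G\<^esub>" for f n
  proof -
    have "(mat 1, f) [^]\<^bsub>?G\<^esub> (k::nat) = (mat 1, \<lambda>H. of_nat k * f H)" for k
      by (induction k) (simp_all add: pre_one algebra_simps)
    from this[of n] show ?thesis using f(2,3) by (auto simp: fun_eq_iff)
  qed
  have "(w, f) = \<one>\<^bsub>?G\<^esub>"
    if "(w, f) \<in> ?E" "n > 0" "(w, f) [^]\<^bsub>?G\<^esub> (n::nat) = \<one>\<^bsub>?G\<^esub>" "w [^]\<^bsub>GW\<^esub> (2 ^ k :: nat) = mat 1"
    for w f n and k :: nat
    using that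
  proof (induction k arbitrary: w f)
    case 0
    then have "w = mat 1" using monodromy_image_carrier(1)[OF 0(1) x] by simp
    then show ?case using translation[of f n] 0 by simp
  next
    case (Suc k)
    note g = Suc.prems
    have w: "w \<in> W" using monodromy_image_carrier(1)[OF g(1) x] .
    have det: "det w = 1" using torsion_imp_det_1[OF x g(1-3)] .
    let ?h = "\<lambda>H. f H + f (pre w H)"
    have gg: "(w, f) \<otimes>\<^bsub>?G\<^esub> (w, f) = (w ** w, ?h)" by simp
    have c: "(w, f) \<in> carrier ?G" using g(1) by simp
    have "(w ** w, ?h) = \<one>\<^bsub>?G\<^esub>"
    proof (rule Suc.IH)
      show "(w ** w, ?h) \<in> ?E" using E.m_closed[OF c c] gg by simp
      have "(w ** w, ?h) [^]\<^bsub>?G\<^esub> n = ((w, f) [^]\<^bsub>?G\<^esub> (2::nat)) [^]\<^bsub>?G\<^esub> n"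
        using c gg by (simp add: numeral_2_eq_2 pre_one)
      also have "\<dots> = ((w, f) [^]\<^bsub>?G\<^esub> n) [^]\<^bsub>?G\<^esub> (2::nat)"
        using c by (simp add: E.nat_pow_pow mult.commute)
      finally show "(w ** w, ?h) [^]\<^bsub>?G\<^esub> n = \<one>\<^bsub>?G\<^esub>" using g(3) by (metis E.nat_pow_one)
      have "w ** w = w [^]\<^bsub>GW\<^esub> (2::nat)" using w by (simp add: numeral_2_eq_2)
      then show "(w ** w) [^]\<^bsub>GW\<^esub> (2 ^ k :: nat) = mat 1"
        using w g(4) by (simp add: GW.nat_pow_pow)
    qed (use g in auto)
    then have ww: "w ** w = mat 1" and f2: "\<And>H. f H + f (pre w H) = 0"
      by (simp_all add: fun_eq_iff)
    show ?case
    proof (cases "w = mat 1")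
      case True
      then show ?thesis using translation[of f n] g by simp
    next
      case False
      then have w1: "w = mat (- 1)" using involution_det_1[OF w ww det] by simp
      obtain H where H: "H \<in> \<A>" using has_reflection by blast
      have "f H = 0" using f2[of H] pre_scalar[OF arrangement_line[OF H], of "- 1"] by (simp add: w1)
      then have "wedge (generator H) (w *v x) = wedge (generator H) x"
        using monodromy_image_exp[OF g(1) x H] by simp
      then have "- wedge (generator H) x = wedge (generator H) x"
        by (simp add: w1 mat_mult_vec wedge_def)
      then have "wedge (generator H) x = 0" by simp
      then show ?thesis using wedge_nonzero[OF x H] by simp
    qed
  qed
  note trivial = this
  show ?thesis
    unfolding torsion_free_def
  proof (intro ballI allI impI)
    fix a and n :: nat
    assume a: "a \<in> carrier ?G" "n > 0 \<and> a [^]\<^bsub>?G\<^esub> n = \<one>\<^bsub>?G\<^esub>"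
    obtain w f where wf: "a = (w, f)" by (cases a)
    have g: "(w, f) \<in> ?E" "n > 0" "(w, f) [^]\<^bsub>?G\<^esub> n = \<one>\<^bsub>?G\<^esub>" using a wf by auto
    obtain k :: nat where "w [^]\<^bsub>GW\<^esub> (2 ^ k :: nat) = mat 1"
      using two_power[OF monodromy_image_carrier(1)[OF g(1) x] torsion_imp_det_1[OF x g]] by blast
    with g show "a = \<one>\<^bsub>?G\<^esub>" unfolding wf by (rule trivial)
  qed
qed

theorem bieberbach_braid_mod_pure_commutators:
  assumes "x \<in> X" "m > 0" "\<And>c. mat c \<in> W \<longleftrightarrow> c ^ m = 1" "card \<A> \<ge> 3"
    and "\<pi> \<in> epi GW \<Phi>" "kernel GW \<Phi> \<pi> = {w \<in> W. \<exists>c. w = mat c}" "group \<Phi>" "finite (carrier \<Phi>)"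
    and "\<And>w. w \<in> W \<Longrightarrow> det w = 1 \<Longrightarrow> \<exists>k::nat. w [^]\<^bsub>GW\<^esub> (2 ^ k :: nat) = mat 1"
  shows "bieberbach_group (braid_mod_pure_commutators W x) (card \<A>) \<Phi>"
  using bieberbach_group_iso[OF quotient_iso_image[OF assms(1)]]
    crystallographic_image_group[OF assms(1-8)] torsion_free_image_group[OF assms(1,9)]
  by (simp add: bieberbach_group_def)

end

section \<open>Permutations of four letters and cube roots of unity\<close>

text \<open>The orbits of \<open>f\<close> have one or three elements, and four is not a multiple of three.\<close>

lemma order3_on_four_has_fixed_point:
  assumes C: "card C = 4" and f: "\<And>a. a \<in> C \<Longrightarrow> f a \<in> C" and f3: "\<And>a. a \<in> C \<Longrightarrow> f (f (f a)) = a"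
  shows "\<exists>a\<in>C. f a = a"
proof (rule ccontr)
  assume no: "\<not> (\<exists>a\<in>C. f a = a)"
  have inj: "a = b" if "a \<in> C" "b \<in> C" "f a = f b" for a b using f3 that by metis
  obtain a where a: "a \<in> C" using C by fastforce
  have fin: "finite C" using C card.infinite by fastforce
  have "card {a, f a, f (f a)} \<le> 3" by (simp add: card_insert_if)
  then have "\<not> C \<subseteq> {a, f a, f (f a)}" using card_mono[of "{a, f a, f (f a)}" C] C by auto
  then obtain d where d: "d \<in> C" "d \<noteq> a" "d \<noteq> f a" "d \<noteq> f (f a)" by blast
  have dist: "a \<noteq> f a" "f a \<noteq> f (f a)" "a \<noteq> f (f a)"
    using no a f f3 by metis+
  have "card {a, f a, f (f a), d} = 4" using d dist by simp
  moreover have "{a, f a, f (f a), d} \<subseteq> C" using a d f by simp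
  ultimately have "C = {a, f a, f (f a), d}" using C fin card_subset_eq by metis
  moreover have "f d \<in> C" using d f by blast
  moreover have "f d \<noteq> d" using no d by blast
  ultimately have "f d = a \<or> f d = f a \<or> f d = f (f a)" by blast
  then show False
  proof (elim disjE)
    assume "f d = a"
    then have "f d = f (f (f a))" using f3 a by simp
    then show False using inj[of d "f (f a)"] d a f by blast
  next
    assume "f d = f a" then show False using inj[of d a] d a by blast
  next
    assume "f d = f (f a)" then show False using inj[of d "f a"] d a f by blast
  qed
qed

text \<open>An involution of four letters with a fixed point is the identity or a transposition.\<close>

lemma even_involution_with_fixed_point:
  assumes p: "p permutes {1..4::nat}" "evenperm p" and pp: "\<And>a. p (p a) = a"
    and i: "i \<in> {1..4}" "p i = i"
  shows "p = id"
proof (rule ccontr)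
  assume "p \<noteq> id"
  then obtain a where a: "p a \<noteq> a" by (auto simp: fun_eq_iff)
  then have aS: "a \<in> {1..4}" "p a \<in> {1..4}" using p(1) by (metis permutes_not_in, metis permutes_in_image permutes_not_in)
  have ia: "i \<noteq> a" "i \<noteq> p a" using a i(2) pp by metis+
  have "p x = Transposition.transpose a (p a) x" for x
  proof (cases "x = a \<or> x = p a \<or> x = i \<or> x \<notin> {1..4}")
    case True
    then show ?thesis using i a aS ia pp permutes_not_in[OF p(1), of x] by (auto simp: Transposition.transpose_def)
  next
    case False
    have "p x \<noteq> a" "p x \<noteq> p a" "p x \<noteq> i" using False pp i(2) by metis+
    moreover have "p x \<in> {1..4}" using False permutes_in_image[OF p(1)] by blast
    moreover have "{1..4} = {a, p a, i, x}"
    proof (rule card_subset_eq[symmetric])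
      have "card {a, p a, i, x} = 4" using a ia False by auto
      then show "card {a, p a, i, x} = card {1..4::nat}" by simp
    qed (use aS i False in auto)
    ultimately have "p x = x" by blast
    then show ?thesis using False by (simp add: Transposition.transpose_def)
  qed
  then have "p = Transposition.transpose a (p a)" by (rule ext)
  then have "evenperm (Transposition.transpose a (p a))" using p(2) by metis
  then show False using a by (simp add: evenperm_swap)
qed

lemma cube_roots_of_unity:
  fixes z w :: complex
  assumes w: "w ^ 3 = 1" "w \<noteq> 1" and z: "z ^ 3 = 1"
  obtains k :: nat where "z = w ^ k"
proof -
  have "(w - 1) * (1 + w + w\<^sup>2) = 0" using w(1) by (simp add: algebra_simps power2_eq_square power3_eq_cube)
  then have s: "1 + w + w\<^sup>2 = 0" using w(2) by simp
  have "(z - 1) * (z - w) * (z - w\<^sup>2) = 0" 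
  proof -
    have "(z - 1) * (z - w) * (z - w\<^sup>2) = z ^ 3 - (1 + w + w\<^sup>2) * z\<^sup>2 + w * (1 + w + w\<^sup>2) * z - w ^ 3"
      by (simp add: algebra_simps power2_eq_square power3_eq_cube)
    then show ?thesis using s w(1) z by simp
  qed
  then have "z = 1 \<or> z = w \<or> z = w\<^sup>2" by auto
  then show thesis using that[of 0] that[of 1] that[of 2] by auto
qed

section \<open>Tetrahedral groups\<close>

context matrix_group
begin

abbreviation act :: "complex^2^2 \<Rightarrow> (complex^2) set \<Rightarrow> (complex^2) set" where
  "act w H \<equiv> (*v) w ` H"

lemma act_mult: "act (u ** w) H = act u (act w H)"
  by (simp add: image_image matrix_vector_mul_assoc)

lemma act_one: "act (mat 1) H = H" by simp

lemma act_minv: "w \<in> W \<Longrightarrow> act (minv w) (act w H) = H" "w \<in> W \<Longrightarrow> act w (act (minv w) H) = H"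
  by (simp_all add: image_image minv_vec)

lemma is_line_act: "w \<in> W \<Longrightarrow> is_line H \<Longrightarrow> is_line (act w H)"
  using image_eq_pre is_line_pre minv(1) by metis

lemma act_inj: "w \<in> W \<Longrightarrow> act w H = act w K \<Longrightarrow> H = K"
  using act_minv(1) by metis

text \<open>A generator maps the finite family injectively into itself, so it permutes the family; the
  permutations of the family form a group.\<close>

lemma act_closed_generated:
  assumes gen: "generate GL S = W" and fin: "finite C"
    and S: "\<And>s H. s \<in> S \<Longrightarrow> H \<in> C \<Longrightarrow> act s H \<in> C" and w: "w \<in> W"
  shows "act w ` C = C"
proof -
  have "S \<subseteq> generate GL S" by (auto intro: generate.incl)
  then have SW: "S \<subseteq> W" using gen by simp
  have onto: "act s ` C = C" if "s \<in> S" for s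
    using S[OF that] act_inj[of s] that SW fin by (intro endo_inj_surj) (auto simp: inj_on_def)
  have "w \<in> generate GL S" using w gen by simp
  then show ?thesis
  proof (induction rule: generate.induct)
    case (inv s)
    have "act (minv s) ` act s ` C = (\<lambda>H. H) ` C"
      unfolding image_image[of "act (minv s)"] using act_minv(1)[of s] inv SW by (intro image_cong) auto
    then show ?case using onto[OF inv] by (simp add: minv_def)
  next
    case (eng u w)
    have "act (u ** w) ` C = act u ` act w ` C" unfolding image_image[of "act u"] act_mult ..
    then show ?case using eng.IH by simp
  qed (use onto in auto)
qed

end

text \<open>The family \<open>C\<close> consists of the reflecting lines of the reflections of order three.  The number \<open>m\<close>
  is an upper bound for the number of scalars in the group, and turns out to be this number.\<close>

locale tetrahedral_group = rank2_reflection_group +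
  fixes C :: "(complex^2) set set" and m :: nat
  assumes card_C: "card C = 4"
    and line_C: "H \<in> C \<Longrightarrow> is_line H"
    and act_C: "w \<in> W \<Longrightarrow> H \<in> C \<Longrightarrow> act w H \<in> C"
    and cubic_C: "H \<in> C \<Longrightarrow> \<exists>r\<in>W. reflection_along r H \<and> r ** r ** r = mat 1"
    and scalar_pow: "mat c \<in> W \<Longrightarrow> c ^ m = 1" and m_dvd: "m dvd 4" and card_W: "card W = 12 * m"
begin

lemma m_pos: "m > 0" using m_dvd by (cases m) auto

lemma scalar_pow4: "mat c \<in> W \<Longrightarrow> c ^ 4 = 1"
  using scalar_pow m_dvd by (metis dvdE power_mult power_one)

lemma finite_C: "finite C" using card_C card.infinite by fastforce

lemma C_in_arrangement: "H \<in> C \<Longrightarrow> H \<in> \<A>"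
  using cubic_C arrangement_iff by blast

lemma det_reflection:
  assumes "r \<in> W" "reflection_along r H" shows "det r \<noteq> 1"
proof
  assume "det r = 1"
  then have "r = mat 1"
    using double_eigenvalue_imp_scalar[OF assms(1), of "generator H" 1] generator[of H] assms(2)
    by (simp add: reflection_along_rank2)
  then show False using assms(2) by (simp add: reflection_along_rank2)
qed

text \<open>Multiplied with a power of a reflection of order three along \<open>H\<close>, the element \<open>u\<close> becomes a scalar.
  This scalar is the eigenvalue of \<open>u\<close> on \<open>H\<close>, so its cube is one; its fourth power is one as well.\<close>

lemma cube_one_fixes_line_pointwise:
  assumes u: "u \<in> W" "u ** u ** u = mat 1" and H: "H \<in> C" "act u H = H" and v: "v \<in> H"
  shows "u *v v = v"
proof -
  obtain r where r: "r \<in> W" "reflection_along r H" "r ** r ** r = mat 1" using cubic_C[OF H(1)] by blast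
  define h where "h = generator H"
  have h: "h \<noteq> 0" "h \<in> H" "line h = H" using generator[OF line_C[OF H(1)]] by (auto simp: h_def)
  have "u *v h \<in> H" using H(2) h(2) by blast
  then obtain \<mu> where \<mu>: "u *v h = \<mu> *s h" using line_memD[of "u *v h" h] h by auto
  have cube: "w [^]\<^bsub>GW\<^esub> (3::nat) = w ** w ** w" for w by (simp add: numeral_3_eq_3)
  have "\<mu> ^ 3 *s h = h" using eigenvector_pow[OF \<mu>, of 3] u(2) by (simp add: cube)
  then have \<mu>3: "\<mu> ^ 3 = 1" using h(1) by (auto simp: vec2_eq_iff)
  have dr: "det r ^ 3 = 1" "det r \<noteq> 1" using det_pow[of r 3] r det_reflection by (simp_all add: cube)
  have du: "det u ^ 3 = 1" using det_pow[of u 3] u by (simp add: cube)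
  have "(\<mu>\<^sup>2 * (det u)\<^sup>2) ^ 3 = (\<mu> ^ 3)\<^sup>2 * (det u ^ 3)\<^sup>2"
    by (simp add: power2_eq_square power3_eq_cube algebra_simps)
  then have "(\<mu>\<^sup>2 * (det u)\<^sup>2) ^ 3 = 1" using \<mu>3 du by simp
  then obtain k where k: "\<mu>\<^sup>2 * (det u)\<^sup>2 = det r ^ k" using cube_roots_of_unity[OF dr] by metis
  \<comment> \<open>The exponent \<open>k\<close> is chosen such that the determinant of \<open>y\<close> is the square of its eigenvalue.\<close>
  define y where "y = u ** (r [^]\<^bsub>GW\<^esub> k)"
  have y: "y \<in> W" using u r by (simp add: y_def mult_W pow_W)
  have "r *v h = 1 *s h" using r(2) h(2) by (simp add: reflection_along_rank2)
  from eigenvector_pow[OF this, of k] have "y *v h = \<mu> *s h"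
    using \<mu> by (simp add: y_def matrix_vector_mul_assoc[symmetric])
  moreover have "det y = \<mu>\<^sup>2"
  proof -
    have "det u * (\<mu>\<^sup>2 * (det u)\<^sup>2) = \<mu>\<^sup>2 * det u ^ 3"
      by (simp add: power2_eq_square power3_eq_cube algebra_simps)
    then show ?thesis using du by (simp add: y_def det_mul det_pow k[symmetric])
  qed
  ultimately have "y = mat \<mu>" using double_eigenvalue_imp_scalar[OF y h(1)] by blast
  then have "\<mu> ^ 4 = 1" using scalar_pow4 y by simp
  then have "\<mu> = 1" using \<mu>3 by (simp add: eval_nat_numeral)
  then have "u *v h = h" using \<mu> by simp
  moreover obtain c where "v = c *s h" using line_memD[of v h] v h by auto
  ultimately show ?thesis by (simp add: vector_scalar_commute)
qed

text \<open>The orbits on the four lines have length one or three.\<close>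

lemma cube_one_fixes_some_line:
  assumes u: "u \<in> W" "u ** u ** u = mat 1"
  obtains H where "H \<in> C" "\<And>v. v \<in> H \<Longrightarrow> u *v v = v"
proof -
  have "act u (act u (act u H)) = H" for H using u(2) by (metis act_mult act_one)
  then obtain H where "H \<in> C" "act u H = H"
    using order3_on_four_has_fixed_point[OF card_C, of "act u"] act_C[OF u(1)] by blast
  then show thesis using that cube_one_fixes_line_pointwise[OF u] by blast
qed

text \<open>The reflection fixes one of the four lines pointwise, and its fixed space is \<open>K\<close>.\<close>

lemma cubic_reflection_line:
  assumes r: "r \<in> W" "reflection_along r K" "r ** r ** r = mat 1"
  shows "K \<in> C"
proof -
  obtain H where H: "H \<in> C" "\<And>v. v \<in> H \<Longrightarrow> r *v v = v" using cube_one_fixes_some_line[OF r(1,3)] by blast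
  then have "H \<subseteq> K" using reflection_fixed_space[OF r(2)] by blast
  obtain h where h: "h \<in> H" "h \<noteq> 0" using is_line_nonzero[OF line_C[OF H(1)]] by blast
  have "is_line K" "h \<in> K" using r(2) h \<open>H \<subseteq> K\<close> by (auto simp: reflection_along_rank2)
  then have "H = K"
    using line_unique[OF line_C[OF H(1)] h] line_unique[of K h] h(2) by simp
  then show ?thesis using H by simp
qed

text \<open>Such an element has the double eigenvalue one.\<close>

lemma cube_one_det_one:
  assumes u: "u \<in> W" "u ** u ** u = mat 1" "det u = 1" shows "u = mat 1"
proof -
  obtain H where H: "H \<in> C" "\<And>v. v \<in> H \<Longrightarrow> u *v v = v" using cube_one_fixes_some_line[OF u(1,2)] by blast
  then show ?thesis
    using double_eigenvalue_imp_scalar[OF u(1), of "generator H" 1] generator[OF line_C[OF H(1)]] u(3) by simp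
qed

text \<open>The order of the group is three times a power of two, and there is no element of order three
  with determinant one.\<close>

lemma det_1_imp_two_power:
  assumes w: "w \<in> W" "det w = 1" shows "\<exists>k::nat. w [^]\<^bsub>GW\<^esub> (2 ^ k :: nat) = mat 1"
proof -
  interpret GW: group GW by (rule group_W)
  have "m \<in> {1, 2, 4}"
  proof -
    have "m \<le> 4" using m_dvd dvd_imp_le by fastforce
    moreover have "m \<noteq> 3" using m_dvd by (auto simp: dvd_def) presburger
    ultimately show ?thesis using m_pos by auto
  qed
  then obtain k where k: "card W = 2 ^ k * 3"
    using card_W that[of 2] by (elim insertE emptyE) (force intro: that[of 2] that[of 3] that[of 4])+
  define u where "u = w [^]\<^bsub>GW\<^esub> (2 ^ k :: nat)"
  have u: "u \<in> W" using w by (simp add: u_def pow_W)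
  have "u ** u ** u = u [^]\<^bsub>GW\<^esub> (3::nat)" by (simp add: numeral_3_eq_3)
  also have "\<dots> = mat 1" using pow_card_W[OF w(1)] w(1) k by (simp add: u_def GW.nat_pow_pow)
  finally have "u = mat 1" using cube_one_det_one u w(2) by (simp add: u_def det_pow)
  then show ?thesis unfolding u_def by blast
qed

lemma fixes_C_imp_scalar:
  assumes "\<And>H. H \<in> C \<Longrightarrow> act w H = H" obtains c where "w = mat c"
proof -
  have "3 \<le> card C" using card_C by simp
  then obtain B where "B \<subseteq> C" "card B = 3" by (rule obtain_subset_with_card_n)
  then obtain H1 H2 H3 where H: "H1 \<in> C" "H2 \<in> C" "H3 \<in> C" "H1 \<noteq> H2" "H1 \<noteq> H3" "H2 \<noteq> H3"
    by (auto simp: card_3_iff)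
  then show thesis
    using three_invariant_lines_imp_scalar[of H1 H2 H3 w] line_C assms that by blast
qed

text \<open>A numbering of the four lines, by which the action on them becomes an action on \<open>{1..4}\<close>.\<close>

definition label :: "nat \<Rightarrow> (complex^2) set" where
  "label = (SOME b. bij_betw b {1..4} C)"

lemma label: "bij_betw label {1..4} C"
proof -
  have "\<exists>b. bij_betw b {1..4::nat} C" using finite_C card_C by (intro finite_same_card_bij) auto
  then show ?thesis unfolding label_def by (rule someI_ex)
qed

definition perm :: "complex^2^2 \<Rightarrow> nat \<Rightarrow> nat" where
  "perm w i = (if i \<in> {1..4} then inv_into {1..4} label (act w (label i)) else i)"

lemma label_in: "i \<in> {1..4} \<Longrightarrow> label i \<in> C" using label by (auto simp: bij_betw_def)

lemma label_perm:
  assumes "w \<in> W" "i \<in> {1..4}" shows "label (perm w i) = act w (label i)" "perm w i \<in> {1..4}"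
proof -
  have "act w (label i) \<in> label ` {1..4}" using act_C[OF assms(1) label_in[OF assms(2)]] label by (simp add: bij_betw_def)
  then show "label (perm w i) = act w (label i)" "perm w i \<in> {1..4}"
    using assms(2) f_inv_into_f[of "act w (label i)" label "{1..4}"]
      inv_into_into[of "act w (label i)" label "{1..4}"]
    by (simp_all add: perm_def del: atLeastAtMost_iff)
qed

lemma label_eq_iff: "i \<in> {1..4} \<Longrightarrow> j \<in> {1..4} \<Longrightarrow> label i = label j \<longleftrightarrow> i = j"
  using label by (auto simp: bij_betw_def inj_on_def)

lemma perm_mult: "u \<in> W \<Longrightarrow> w \<in> W \<Longrightarrow> perm (u ** w) = perm u \<circ> perm w"
proof
  fix i assume uw: "u \<in> W" "w \<in> W"
  show "perm (u ** w) i = (perm u \<circ> perm w) i"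
  proof (cases "i \<in> {1..4}")
    case True
    have "label (perm (u ** w) i) = label (perm u (perm w i))"
      using True uw label_perm mult_W by (simp add: act_mult del: atLeastAtMost_iff)
    then show ?thesis using label_eq_iff label_perm(2) uw mult_W True by (metis comp_apply)
  qed (auto simp: perm_def)
qed

lemma perm_one: "perm (mat 1) = id"
  using label_eq_iff label_perm[OF one_W] by (fastforce simp: perm_def)

lemma perm_permutes: "w \<in> W \<Longrightarrow> perm w permutes {1..4}"
proof (rule bij_imp_permutes)
  assume w: "w \<in> W"
  have "inj_on (perm w) {1..4}"
    using label_perm[OF w] label_eq_iff act_inj[OF w] by (metis inj_onI)
  moreover have "perm w ` {1..4} \<subseteq> {1..4}" using label_perm(2)[OF w] by blast
  ultimately show "bij_betw (perm w) {1..4} {1..4}"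
    by (simp add: bij_betw_def endo_inj_surj)
qed (auto simp: perm_def)

lemma perm_eq_id_iff: "w \<in> W \<Longrightarrow> perm w = id \<longleftrightarrow> (\<exists>c. w = mat c)"
proof
  assume w: "w \<in> W" "perm w = id"
  have "act w H = H" if H: "H \<in> C" for H
  proof -
    obtain i where "i \<in> {1..4}" "H = label i" using H label unfolding bij_betw_def by blast
    then show ?thesis using label_perm(1)[OF w(1), of i] w(2) by simp
  qed
  then obtain c where "w = mat c" by (rule fixes_C_imp_scalar)
  then show "\<exists>c. w = mat c" by (rule exI)
next
  assume w: "w \<in> W" "\<exists>c. w = mat c"
  then obtain c where c: "w = mat c" by blast
  have "c \<noteq> 0" using scalar_in_W_nonzero w c by blast
  have "act w H = H" if H: "is_line H" for H
  proof -
    define h where "h = c *s generator H"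
    have h0: "h \<noteq> 0" using generator(1)[OF H] \<open>c \<noteq> 0\<close> by (auto simp: h_def vec2_eq_iff)
    have hw: "h = w *v generator H" by (simp add: h_def c mat_mult_vec)
    have hH: "h \<in> H" unfolding h_def by (rule is_line_scale[OF H generator(3)[OF H]])
    have hact: "h \<in> act w H" unfolding hw by (rule imageI[OF generator(3)[OF H]])
    show ?thesis
      using line_unique[OF is_line_act[OF w(1) H] hact h0] line_unique[OF H hH h0] by simp
  qed
  then have "perm w i = i" for i
    using label_perm[OF w(1), of i] label_eq_iff[of "perm w i" i] line_C label_in by (auto simp: perm_def)
  then show "perm w = id" by auto
qed

lemma perm_permutation: "w \<in> W \<Longrightarrow> permutation (perm w)"
  using perm_permutes permutation_permutes by blast

lemma evenperm_perm_mult: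
  "u \<in> W \<Longrightarrow> w \<in> W \<Longrightarrow> evenperm (perm (u ** w)) \<longleftrightarrow> (evenperm (perm u) \<longleftrightarrow> evenperm (perm w))"
  by (simp add: perm_mult evenperm_comp perm_permutation)

lemma evenperm_perm_generated:
  assumes gen: "generate GL S = W" and S: "\<And>s. s \<in> S \<Longrightarrow> evenperm (perm s)" and w: "w \<in> W"
  shows "evenperm (perm w)"
proof -
  have "S \<subseteq> generate GL S" by (auto intro: generate.incl)
  then have SW: "S \<subseteq> W" using gen by simp
  have "w \<in> generate GL S" using w gen by simp
  then show ?thesis
  proof (induction rule: generate.induct)
    case one then show ?case by (simp add: perm_one)
  next
    case (incl s) then show ?case using S by blast
  next
    case (inv s)
    then have s: "s \<in> W" using SW by blast
    then show ?case using evenperm_perm_mult[OF s minv(1)[OF s]] S[OF inv] minv(3)[OF s]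
      by (simp add: perm_one minv_def)
  next
    case (eng u w)
    then show ?case using gen evenperm_perm_mult by simp
  qed
qed

text \<open>Counting shows that the image is all of the alternating group and that the group contains
  all the scalars that it may contain.\<close>

lemma even_action:
  assumes even: "\<And>w. w \<in> W \<Longrightarrow> evenperm (perm w)"
  shows "perm \<in> epi GW (alt_group 4)" "kernel GW (alt_group 4) perm = {w \<in> W. \<exists>c. w = mat c}"
    "mat c \<in> W \<longleftrightarrow> c ^ m = 1"
proof -
  let ?A = "alt_group 4" and ?S = "{c. mat c \<in> W}"
  have carrier: "perm w \<in> carrier ?A" if "w \<in> W" for w
    using that even perm_permutes by (simp add: alt_group_carrier)
  have hom: "perm \<in> hom GW ?A"
    by (rule homI) (simp_all add: carrier perm_mult alt_group_mult)
  interpret W: group GW by (rule group_W)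
  interpret A: group ?A by (rule alt_group_is_group)
  interpret p: group_hom GW ?A perm using hom by unfold_locales
  show ker: "kernel GW ?A perm = {w \<in> W. \<exists>c. w = mat c}"
    using perm_eq_id_iff by (auto simp: kernel_def alt_group_one)
  let ?I = "?A\<lparr>carrier := perm ` W\<rparr>"
  have "subgroup (perm ` W) ?A" using p.img_is_subgroup by simp
  then interpret I: group ?I by (rule A.subgroup_imp_group)
  interpret pI: group_hom GW ?I perm
    using hom by unfold_locales (auto simp: hom_def)
  have "kernel GW ?I perm = kernel GW ?A perm" by (simp add: kernel_def)
  then have "bij_betw (\<lambda>X. the_elem (perm ` X)) (carrier (GW Mod kernel GW ?A perm)) (perm ` W)"
    using pI.FactGroup_iso_set by (simp add: iso_def)
  then have "card (rcosets\<^bsub>GW\<^esub> kernel GW ?A perm) = card (perm ` W)"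
    using bij_betw_same_card by (fastforce simp: FactGroup_def)
  then have count: "card (perm ` W) * card (kernel GW ?A perm) = 12 * m"
    using W.lagrange[OF p.subgroup_kernel] card_W by (simp add: Coset.order_def)
  have "kernel GW ?A perm = mat ` ?S" unfolding ker by auto
  moreover have "inj_on (mat :: complex \<Rightarrow> complex^2^2) ?S" by (simp add: inj_on_def mat_eq_iff)
  ultimately have cardS: "card (kernel GW ?A perm) = card ?S" by (simp add: card_image)
  have roots: "finite {c::complex. c ^ m = 1}" "card {c::complex. c ^ m = 1} = m"
    using m_pos card_roots_unity_eq[of m] by (auto intro: finite_roots_unity)
  have sub: "?S \<subseteq> {c. c ^ m = 1}" using scalar_pow by blast
  have "card ?S \<le> m" using card_mono[OF roots(1) sub] roots(2) by simp
  have A12: "card (carrier ?A) = 12"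
    using alt_group_card_carrier[of 4] by (simp add: fact_numeral)
  then have finA: "finite (carrier ?A)" using card.infinite by fastforce
  have subA: "perm ` W \<subseteq> carrier ?A" using carrier by blast
  have "card (perm ` W) \<le> 12" using card_mono[OF finA subA] A12 by simp
  have "card ?S = m"
  proof (rule ccontr)
    assume "card ?S \<noteq> m"
    then have "card ?S < m" using \<open>card ?S \<le> m\<close> by simp
    then have "12 * card ?S < 12 * m" by simp
    moreover have "card (perm ` W) * card ?S \<le> 12 * card ?S"
      using \<open>card (perm ` W) \<le> 12\<close> by (rule mult_le_mono1)
    ultimately show False using count[unfolded cardS] by linarith
  qed
  then have "?S = {c. c ^ m = 1}" using card_subset_eq[OF roots(1) sub] roots(2) by simp
  then show "mat c \<in> W \<longleftrightarrow> c ^ m = 1" by blast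
  have "card (perm ` W) = card (carrier ?A)" using count cardS \<open>card ?S = m\<close> m_pos A12 by simp
  then have "perm ` W = carrier ?A" using card_subset_eq[OF finA subA] by simp
  then show "perm \<in> epi GW ?A" using hom by (simp add: epi_def)
qed

lemma finite_alt_group: "finite (carrier (alt_group n))"
  using finite_permutations[of "{1..n}"] by (rule finite_subset[rotated]) (auto simp: alt_group_carrier)

theorem bieberbach_tetrahedral:
  assumes "x \<in> X" "\<And>w. w \<in> W \<Longrightarrow> evenperm (perm w)"
  shows "bieberbach_group (braid_mod_pure_commutators W x) (card \<A>) (alt_group 4)"
proof -
  have "C \<subseteq> \<A>" using C_in_arrangement by blast
  then have "card \<A> \<ge> 3" using card_mono[OF finite_arrangement, of C] card_C by simp
  then show ?thesis
    using even_action[OF assms(2)] det_1_imp_two_power m_pos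
    by (intro bieberbach_braid_mod_pure_commutators[OF assms(1), of m perm])
       (auto simp: alt_group_is_group finite_alt_group)
qed

end

section \<open>Scalars and invariants\<close>

lemma form2_scale:
  assumes "form2 d f" shows "f (c *s v) = c ^ d * f v"
proof -
  obtain a where a: "\<And>v. f v = (\<Sum>i\<le>d. a i * (v$1)^i * (v$2)^(d - i))" using assms by (auto simp: form2_def)
  have "a i * ((c *s v)$1)^i * ((c *s v)$2)^(d - i) = c ^ d * (a i * (v$1)^i * (v$2)^(d - i))"
    if "i \<le> d" for i
  proof -
    have "c ^ i * c ^ (d - i) = c ^ d" using that by (simp add: power_add[symmetric])
    then show ?thesis by (simp add: power_mult_distrib mult.assoc mult.left_commute)
  qed
  then show ?thesis unfolding a sum_distrib_left by (intro sum.cong) auto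
qed

lemma polyfun2_coordinate: "polyfun2 (\<lambda>v. v$1)" "polyfun2 (\<lambda>v. v$2)"
  unfolding polyfun2_def
  by (intro exI[of _ "1::nat"] exI[of _ "\<lambda>i j. if i = 1 \<and> j = 0 then 1 else 0"], simp)
     (intro exI[of _ "1::nat"] exI[of _ "\<lambda>i j. if i = 0 \<and> j = 1 then 1 else 0"], simp)

text \<open>A scalar \<open>c\<close> multiplies forms of degree \<open>d\<close> by \<open>c ^ d\<close>, and algebraic independence excludes that the
  basic invariants are zero.\<close>

lemma scalar_pow_degree:
  assumes "has_invariant_degrees W d e" "mat c \<in> W"
  shows "c ^ d = 1" "c ^ e = 1"
proof -
  obtain f g where fg: "form2 d f" "form2 e g" "invariant_function W f" "invariant_function W g"
      "\<And>q. polyfun2 q \<Longrightarrow> (\<forall>v. q (vector [f v, g v]) = 0) \<Longrightarrow> (\<forall>u. q u = 0)"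
    using assms(1) unfolding has_invariant_degrees_def by blast
  have pow: "c ^ k = 1" if "form2 k h" "invariant_function W h" "h v \<noteq> 0" for k h v
    using form2_scale[OF that(1), of c v] that(2,3) assms(2)
    by (metis invariant_function_def mat_mult_vec mult_cancel_right1)
  have "\<exists>v. f v \<noteq> 0"
  proof (rule ccontr)
    assume "\<not> (\<exists>v. f v \<noteq> 0)"
    then have "\<forall>u::complex^2. u$1 = 0" using fg(5)[OF polyfun2_coordinate(1)] by simp
    from this[rule_format, of "vector [1, 0]"] show False by simp
  qed
  then show "c ^ d = 1" using pow fg by blast
  have "\<exists>v. g v \<noteq> 0"
  proof (rule ccontr)
    assume "\<not> (\<exists>v. g v \<noteq> 0)"
    then have "\<forall>u::complex^2. u$2 = 0" using fg(5)[OF polyfun2_coordinate(2)] by simp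
    from this[rule_format, of "vector [0, 1]"] show False by simp
  qed
  then show "c ^ e = 1" using pow fg by blast
qed

section \<open>Generating reflections\<close>

lemma lines_subset_eq:
  assumes "is_line H" "is_line K" "H \<subseteq> K" shows "H = K"
proof -
  obtain h where "h \<in> H" "h \<noteq> 0" using is_line_nonzero[OF assms(1)] by blast
  then show ?thesis using line_unique[OF assms(1), of h] line_unique[OF assms(2), of h] assms(3) by (metis subsetD)
qed

lemma is_line_subspace: "is_line H \<Longrightarrow> vec.subspace H \<and> vec.dim H = 1"
  using hyperplane_iff_is_line[of H] by (simp add: hyperplane_def)

lemma lines_Int:
  assumes "is_line H" "is_line K" "H \<noteq> K" shows "H \<inter> K = {0}"
proof -
  have "v = 0" if "v \<in> H" "v \<in> K" for v
    using line_unique[OF assms(1) that(1)] line_unique[OF assms(2) that(2)] assms(3) by auto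
  moreover have "0 \<in> H" "0 \<in> K" using assms by (auto simp: is_line_def line_def wedge_def)
  ultimately show ?thesis by blast
qed

context matrix_group
begin

lemma act_reflection:
  assumes "reflection_along (r :: complex^2^2) H" shows "act r H = H"
  using assms by (auto simp: reflection_along_rank2 image_iff)

lemma det_pow_generated:
  assumes gen: "generate GL S = W" and S: "\<And>s. s \<in> S \<Longrightarrow> det s ^ n = 1" and w: "w \<in> W"
  shows "det w ^ n = 1"
proof -
  have "S \<subseteq> generate GL S" by (auto intro: generate.incl)
  then have SW: "S \<subseteq> W" using gen by simp
  have "w \<in> generate GL S" using w gen by simp
  then show ?thesis
  proof (induction rule: generate.induct)
    case (inv s)
    have "det (minv s) * det s = 1" using minv(2)[of s] inv SW by (metis det_I det_mul subsetD)
    then have "det (minv s) ^ n * det s ^ n = 1" by (simp add: power_mult_distrib[symmetric])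
    then show ?case using S[OF inv] by (simp add: minv_def)
  next
    case (eng u w)
    then show ?case by (simp add: det_mul power_mult_distrib)
  qed (use S in auto)
qed

lemma no_invariant_line:
  assumes irr: "irreducible_linear_group W" and gen: "generate GL S = W" and H: "is_line H"
  shows "\<exists>s\<in>S. act s H \<noteq> H"
proof (rule ccontr)
  assume "\<not> (\<exists>s\<in>S. act s H \<noteq> H)"
  then have "act w ` {H} = {H}" if "w \<in> W" for w
    using act_closed_generated[OF gen, of "{H}" w] that by auto
  then have "\<forall>w\<in>W. act w H \<subseteq> H" by auto
  then have "H = {0} \<or> H = UNIV"
    using irr is_line_subspace[OF H] unfolding irreducible_linear_group_def by blast
  moreover have "H \<noteq> {0}" using is_line_nonzero[OF H] by auto
  moreover have "H \<noteq> UNIV"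
  proof
    assume "H = UNIV"
    then have "\<forall>v. wedge (generator H) v = 0" using generator(2)[OF H] by (auto simp: line_def)
    then show False using exists_wedge_1[OF generator(1)[OF H]] by (metis zero_neq_one)
  qed
  ultimately show False by blast
qed

end

context rank2_reflection_group
begin

lemma cubic_reflection_conj:
  assumes r: "r \<in> W" "reflection_along r H" "r ** r ** r = mat 1" and g: "g \<in> W"
  shows "\<exists>r'\<in>W. reflection_along r' (act g H) \<and> r' ** r' ** r' = mat 1"
proof -
  \<comment> \<open>This is the conjugate of \<open>r\<close> by \<open>g\<close>, in the form in which preimages of lines appear.\<close>
  define r' where "r' = minv (minv g) ** r ** minv g"
  have g': "minv g \<in> W" "minv (minv g) \<in> W" using g minv(1) by blast+
  have "reflection_along r' (act g H)"
    using reflection_along_pre[OF g'(1) r(1,2)] image_eq_pre[OF g] by (simp add: r'_def)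
  moreover have "r' \<in> W" using g' r by (simp add: r'_def mult_W)
  moreover have "r' ** r' ** r' = mat 1"
    unfolding matrix_eq
  proof
    fix v
    have "r *v (r *v (r *v u)) = u" for u using r(3) by (simp add: matrix_vector_mul_assoc matrix_mul_assoc)
    then show "r' ** r' ** r' *v v = mat 1 *v v"
      by (simp add: r'_def matrix_vector_mul_assoc[symmetric] minv_vec g g')
  qed
  ultimately show ?thesis by blast
qed

text \<open>The power has the eigenvalue one and determinant one.\<close>

lemma pow_eq_1_of_fixed_line:
  assumes r: "r \<in> W" "reflection_along r H" and n: "det r ^ n = 1"
  shows "r [^]\<^bsub>GW\<^esub> n = mat 1"
proof -
  have h: "generator H \<noteq> 0" "r *v generator H = 1 *s generator H"
    using generator[of H] r(2) by (auto simp: reflection_along_rank2)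
  show ?thesis
    using double_eigenvalue_imp_scalar[OF pow_W[OF r(1)] h(1), of n 1] eigenvector_pow[OF h(2), of n] n
    by (simp add: det_pow)
qed

end

lemma reflection_imp_rank2_reflection_group:
  assumes "complex_reflection_group W" "s \<in> W" "reflection s"
  shows "rank2_reflection_group W"
  using assms by unfold_locales (auto simp: reflecting_hyperplanes_def reflection_def)

lemma (in tetrahedral_group) evenperm_perm_cube:
  assumes "w \<in> W" "perm (w ** w ** w) = id" shows "evenperm (perm w)"
  using evenperm_perm_mult[of "w ** w" w] evenperm_perm_mult[of w w] assms mult_W by auto

section \<open>The group \<open>G\<^sub>4\<close>\<close>

text \<open>Let \<open>H\<close> be the line of \<open>t\<close>.  By the braid relation, both \<open>t s\<close> and \<open>t\<^sup>2 s\<^sup>2\<close> conjugate \<open>t\<close> to \<open>s\<close>, so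
  they map \<open>H\<close> to the line of \<open>s\<close>.  It follows that \<open>s\<close> and \<open>t\<close> permute \<open>H\<close>, \<open>s H\<close>, \<open>s\<^sup>2 H\<close> and the line of
  \<open>s\<close>, which are distinct by irreducibility.  All determinants are cube roots of unity, so every
  reflection has order three and its line is one of these four.\<close>

theorem bieberbach_G4:
  assumes G4: "is_G4 W" and x: "x \<in> hyperplane_complement W"
  shows "bieberbach_group (braid_mod_pure_commutators W x) 4 (alt_group 4)"
proof -
  obtain s t where st: "reflection s" "reflection t" and gen: "generate GL {s, t} = W"
      and s3: "s ** s ** s = mat 1" and t3: "t ** t ** t = mat 1" and braid: "s ** t ** s = t ** s ** t"
    using G4 unfolding is_G4_def by blast
  have W: "complex_reflection_group W" "irreducible_linear_group W" "has_invariant_degrees W 4 6" "card W = 24"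
    using G4 unfolding is_G4_def by blast+
  have "{s, t} \<subseteq> generate GL {s, t}" by (auto intro: generate.incl)
  then have stW: "s \<in> W" "t \<in> W" using gen by auto
  interpret rank2_reflection_group W
    using reflection_imp_rank2_reflection_group[OF W(1) stW(1) st(1)] .
  obtain H Hs where H: "reflection_along t H" and Hs: "reflection_along s Hs"
    using st by (auto simp: reflection_def)
  have lines: "is_line H" "is_line Hs" using H Hs by (auto simp: reflection_along_rank2)
  have fixed: "t *v v = v \<longleftrightarrow> v \<in> H" "s *v v = v \<longleftrightarrow> v \<in> Hs" for v
    using reflection_fixed_space[OF H] reflection_fixed_space[OF Hs] by blast+
  have sss: "s *v (s *v (s *v v)) = v" and ttt: "t *v (t *v (t *v v)) = v"
    and sts: "s *v (t *v (s *v v)) = t *v (s *v (t *v v))" for v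
    using s3 t3 braid by (simp_all add: matrix_vector_mul_assoc matrix_mul_assoc)
  have act3: "act s (act s (act s K)) = K" "act t (act t (act t K)) = K" for K
    using s3 t3 by (metis act_mult act_one)+
  define H1 where "H1 = act s H"
  define H2 where "H2 = act s H1"
  have l: "is_line H1" "is_line H2" using lines stW by (simp_all add: H1_def H2_def is_line_act)
  have tH: "act t H = H" and sHs: "act s Hs = Hs" using act_reflection[OF H] act_reflection[OF Hs] .
  have tH1: "act t H1 = Hs"
  proof (rule lines_subset_eq[OF is_line_act[OF stW(2) l(1)] lines(2)])
    show "act t H1 \<subseteq> Hs"
      unfolding H1_def image_image using sts by (auto simp flip: fixed)
  qed
  have ttH2: "act t (act t H2) = Hs"
  proof (rule lines_subset_eq[OF is_line_act[OF stW(2) is_line_act[OF stW(2) l(2)]] lines(2)])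
    show "act t (act t H2) \<subseteq> Hs"
    proof
      fix y assume "y \<in> act t (act t H2)"
      \<comment> \<open>It suffices that \<open>s t s y = s t y\<close>, since \<open>s t\<close> is injective.\<close>
      then obtain v where v: "v \<in> H" "y = t *v (t *v (s *v (s *v v)))" by (auto simp: H1_def H2_def)
      then have "v = s *v (t *v y)" by (simp add: sss ttt)
      moreover have "t *v v = v" using fixed v by blast
      ultimately have "s *v (t *v (s *v y)) = s *v (t *v y)" using sts by metis
      then have "s *v y = y" using minv_vec(1)[OF stW(1)] minv_vec(1)[OF stW(2)] by metis
      then show "y \<in> Hs" using fixed by blast
    qed
  qed
  have tHs: "act t Hs = H2" using act3(2)[of H2] ttH2 by simp
  have tH2: "act t H2 = H1" using act_inj[OF stW(2)] ttH2 tH1 by metis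
  have sH2: "act s H2 = H" using act3(1) by (simp add: H1_def H2_def)
  have ne: "H \<noteq> Hs" "H1 \<noteq> H"
    using no_invariant_line[OF W(2) gen lines(1)] tH sHs by (auto simp: H1_def)
  have ne': "H1 \<noteq> Hs" "H2 \<noteq> Hs" "H2 \<noteq> H" "H2 \<noteq> H1"
  proof -
    show 1: "H1 \<noteq> Hs"
    proof
      assume "H1 = Hs"
      then have "act s H = act s Hs" using sHs by (simp add: H1_def)
      then show False using act_inj[OF stW(1)] ne(1) by blast
    qed
    show "H2 \<noteq> Hs"
    proof
      assume "H2 = Hs"
      then have "act s H1 = act s Hs" using sHs by (simp only: H2_def)
      then show False using act_inj[OF stW(1)] 1 by blast
    qed
    show 2: "H2 \<noteq> H" using sH2 ne(2) H1_def by metis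
    show "H2 \<noteq> H1"
    proof
      assume "H2 = H1"
      then have "act s H1 = act s H" by (simp only: H2_def[symmetric] H1_def[symmetric])
      then show False using act_inj[OF stW(1)] ne(2) by blast
    qed
  qed
  define C where "C = {H, H1, H2, Hs}"
  have card_C: "card C = 4" using ne ne' by (auto simp: C_def)
  have stC: "act g K \<in> C" if "g \<in> {s, t}" "K \<in> C" for g K
  proof -
    have "act s H = H1" "act s H1 = H2" by (simp_all only: H1_def H2_def)
    then have "act s ` C \<subseteq> C" "act t ` C \<subseteq> C"
      unfolding C_def image_insert by (simp_all only: tH sHs tH1 tHs tH2 sH2) blast+
    then show ?thesis using that by blast
  qed
  interpret tetrahedral_group W C 2
  proof
    show "card C = 4" by (rule card_C)
    show "is_line K" if "K \<in> C" for K using that lines l by (auto simp: C_def)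
    show "act w K \<in> C" if "w \<in> W" "K \<in> C" for w K
    proof -
      have "finite C" by (simp add: C_def)
      from act_closed_generated[OF gen this stC that(1)] have "act w ` C = C" .
      then show ?thesis using that(2) by blast
    qed
    show "\<exists>r\<in>W. reflection_along r K \<and> r ** r ** r = mat 1" if "K \<in> C" for K
    proof -
      have "\<exists>g\<in>W. H = act g H" by (rule bexI[OF _ one_W]) simp
      moreover have "\<exists>g\<in>W. H1 = act g H" by (rule bexI[OF _ stW(1)]) (rule H1_def)
      moreover have "\<exists>g\<in>W. H2 = act g H"
        by (rule bexI[OF _ mult_W[OF stW(1,1)]]) (simp only: act_mult H1_def H2_def)
      moreover have "\<exists>g\<in>W. Hs = act g H"
        by (rule bexI[OF _ mult_W[OF stW(2,1)]]) (simp only: act_mult H1_def[symmetric] tH1)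
      ultimately obtain g where "g \<in> W" "K = act g H" using \<open>K \<in> C\<close> unfolding C_def by blast
      then show ?thesis using cubic_reflection_conj[OF stW(2) H t3] by blast
    qed
    show "c ^ 2 = 1" if "mat c \<in> W" for c
    proof -
      have c: "c ^ 4 = 1" "c ^ 6 = 1" using scalar_pow_degree[OF W(3) that] .
      have "c ^ 6 = c ^ 4 * c ^ 2" by (simp add: power_add[symmetric])
      then show ?thesis using c by simp
    qed
  qed (simp_all add: W)
  have even: "evenperm (perm s)" "evenperm (perm t)"
    using evenperm_perm_cube[OF stW(1)] evenperm_perm_cube[OF stW(2)] by (simp_all add: s3 t3 perm_one)
  have "evenperm (perm w)" if "w \<in> W" for w
    by (rule evenperm_perm_generated[OF gen _ that]) (use even in blast)
  moreover have "\<A> = C"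
  proof
    have "det s ^ 3 = 1" "det t ^ 3 = 1"
      using s3 t3 by (metis det_I det_mul power3_eq_cube)+
    then have det3: "det w ^ 3 = 1" if "w \<in> W" for w using det_pow_generated[OF gen _ that] by blast
    show "\<A> \<subseteq> C"
    proof
      fix K assume "K \<in> \<A>"
      then obtain r where r: "r \<in> W" "reflection_along r K" using arrangement_iff by blast
      have "r ** r ** r = mat 1"
        using pow_eq_1_of_fixed_line[OF r det3[OF r(1)]] by (simp add: numeral_3_eq_3)
      then show "K \<in> C" using cubic_reflection_line r by blast
    qed
    show "C \<subseteq> \<A>" using C_in_arrangement by blast
  qed
  ultimately show ?thesis using bieberbach_tetrahedral[OF x] card_C by simp
qed

section \<open>The group \<open>G\<^sub>6\<close>\<close>

text \<open>Both maps swap \<open>a\<close> with the same letter, and then they swap the remaining two letters.\<close>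

lemma free_involutions_on_four_agree:
  assumes C: "card C = 4" "a \<in> C"
    and f: "\<And>c. c \<in> C \<Longrightarrow> f c \<in> C \<and> f (f c) = c \<and> f c \<noteq> c"
    and g: "\<And>c. c \<in> C \<Longrightarrow> g c \<in> C \<and> g (g c) = c \<and> g c \<noteq> c"
    and eq: "f a = g a" and c: "c \<in> C"
  shows "f c = g c"
proof (cases "c = a \<or> c = f a")
  case True
  then show ?thesis using f g eq C(2) by metis
next
  case False
  have fin: "finite C" using C(1) card.infinite by fastforce
  have "f c \<noteq> a" "f c \<noteq> f a" using False f[OF c] f[OF C(2)] by metis+
  moreover have "g c \<noteq> a" "g c \<noteq> f a" using False g[OF c] g[OF C(2)] eq by metis+
  ultimately have "f c \<notin> {a, f a, c}" "g c \<notin> {a, f a, c}" using f[OF c] g[OF c] by blast+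
  moreover have "card (C - {a, f a, c}) = 1"
  proof -
    have "card {a, f a, c} = 3" using False f[OF C(2)] by auto
    moreover have "{a, f a, c} \<subseteq> C" using f C(2) c by auto
    ultimately show ?thesis using card_Diff_subset[of "{a, f a, c}" C] C(1) by simp
  qed
  ultimately show ?thesis using f[OF c] g[OF c] by (metis DiffI card_1_singletonE singletonD)
qed

context tetrahedral_group
begin

definition involutive_reflections :: "(complex^2^2) set" where
  "involutive_reflections = {r \<in> W. reflection r \<and> r ** r = mat 1}"

lemma reflection_not_scalar:
  assumes "reflection_along (r :: complex^2^2) H" shows "r \<noteq> mat c"
proof
  assume c: "r = mat c"
  have r: "r \<noteq> mat 1" "is_line H" "r *v generator H = generator H"
    using assms generator[of H] by (auto simp: reflection_along_rank2)
  then have "(c - 1) *s generator H = 0" by (simp add: c mat_mult_vec vector_sub_rdistrib)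
  then have "c = 1" using generator(1)[OF r(2)] by (auto simp: vec2_eq_iff)
  then show False using r(1) c by simp
qed

text \<open>An involutive reflection that preserved one of the four lines would, as an even permutation,
  preserve all of them and hence be scalar.\<close>

lemma involutive_reflection_moves:
  assumes even: "\<And>w. w \<in> W \<Longrightarrow> evenperm (perm w)"
    and r: "r \<in> involutive_reflections" and H: "H \<in> C"
  shows "act r H \<noteq> H"
proof
  assume fixH: "act r H = H"
  have rW: "r \<in> W" and rr: "r ** r = mat 1" using r by (auto simp: involutive_reflections_def)
  have "H \<in> label ` {1..4}" using H label by (simp add: bij_betw_def)
  then obtain i where i: "i \<in> {1..4}" "label i = H" by (metis imageE)
  have "perm r i = i" using label_perm[OF rW i(1)] label_eq_iff[OF _ i(1)] fixH i(2) by simp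
  moreover have "perm r (perm r a) = a" for a
    using perm_mult[OF rW rW] rr perm_one by (metis comp_apply id_apply)
  ultimately have "perm r = id"
    using even_involution_with_fixed_point[OF perm_permutes[OF rW] even[OF rW]] i(1) by blast
  then show False
    using perm_eq_id_iff[OF rW] reflection_not_scalar r by (auto simp: involutive_reflections_def reflection_def)
qed

lemma act_involution: "r ** r = mat 1 \<Longrightarrow> act r (act r K) = K"
  by (metis act_mult act_one)

text \<open>The reflections \<open>r\<close> and \<open>r'\<close> permute the four lines in the same way, so \<open>r ** r'\<close> is scalar.\<close>

lemma involutive_reflection_determined:
  assumes even: "\<And>w. w \<in> W \<Longrightarrow> evenperm (perm w)"
    and r: "r \<in> involutive_reflections" "r' \<in> involutive_reflections"
    and H: "H \<in> C" "act r H = act r' H"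
  shows "\<exists>c. c\<^sup>2 = 1 \<and> r = mat c ** r'"
proof -
  have W: "r \<in> W" "r' \<in> W" "r ** r = mat 1" "r' ** r' = mat 1"
    using r by (auto simp: involutive_reflections_def)
  have "act r K = act r' K" if "K \<in> C" for K
  proof (rule free_involutions_on_four_agree[where f = "act r" and g = "act r'", OF card_C H(1) _ _ H(2) that])
    show "act r L \<in> C \<and> act r (act r L) = L \<and> act r L \<noteq> L" if "L \<in> C" for L
      using act_C[OF W(1) that] act_involution[OF W(3)] involutive_reflection_moves[OF even r(1) that] by simp
    show "act r' L \<in> C \<and> act r' (act r' L) = L \<and> act r' L \<noteq> L" if "L \<in> C" for L
      using act_C[OF W(2) that] act_involution[OF W(4)] involutive_reflection_moves[OF even r(2) that] by simp
  qed
  then have "act (r ** r') K = K" if "K \<in> C" for K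
    using act_C[OF W(2) that] act_involution[OF W(4)] by (simp add: act_mult)
  then obtain c where c: "r ** r' = mat c" by (rule fixes_C_imp_scalar)
  have "r = (r ** r') ** r'" using W(4) by (simp add: matrix_mul_assoc[symmetric])
  then have rc: "r = mat c ** r'" using c by simp
  have "mat c ** r' = r' ** mat c"
    unfolding matrix_eq by (simp add: matrix_vector_mul_assoc[symmetric] mat_mult_vec vector_scalar_commute)
  then have "r ** r = mat c ** (mat c ** (r' ** r'))" unfolding rc by (metis matrix_mul_assoc)
  then have "mat (c * c) = (mat 1 :: complex^2^2)" using W by (simp add: mat_mult_mat)
  then show ?thesis using rc by (auto simp: mat_eq_iff power2_eq_square)
qed

text \<open>The line of \<open>- r\<close> is the eigenspace of \<open>r\<close> for the eigenvalue \<open>- 1\<close>.\<close>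

lemma neg_involutive_reflection:
  assumes r: "r \<in> involutive_reflections" and neg: "mat (- 1) \<in> W"
  shows "mat (- 1) ** r \<in> involutive_reflections"
proof -
  have rW: "r \<in> W" "r ** r = mat 1" using r by (auto simp: involutive_reflections_def)
  obtain H where H: "reflection_along r H" using r by (auto simp: involutive_reflections_def reflection_def)
  have nv: "mat (- 1) ** r *v v = - (r *v v)" for v
    by (simp add: matrix_vector_mul_assoc[symmetric] mat_mult_vec)
  have "r \<noteq> mat 1" using H by (simp add: reflection_along_rank2)
  then obtain u where u: "r *v u \<noteq> u" by (auto simp: matrix_eq)
  define v where "v = r *v u - u"
  have v: "v \<noteq> 0" "r *v v = - v"
    using u rW(2) by (simp_all add: v_def matrix_vector_mult_diff_distrib matrix_vector_mul_assoc)
  have "mat (- 1) ** r \<noteq> mat 1"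
  proof
    assume e: "mat (- 1) ** r = mat 1"
    have "r *v w = - w" for w
    proof -
      have "- (r *v w) = w" using nv[of w] e by simp
      then show ?thesis by (metis minus_minus)
    qed
    then have "r = mat (- 1)" unfolding matrix_eq by (simp add: mat_mult_vec)
    then show False using reflection_not_scalar[OF H] by blast
  qed
  moreover have "mat (- 1) ** r *v y = y" if y: "y \<in> line v" for y
  proof -
    obtain c where "y = c *s v" using line_memD[OF y v(1)] by blast
    then have "r *v y = - y" using v(2) by (simp add: vector_scalar_commute)
    then show ?thesis by (simp add: nv)
  qed
  moreover have "mat (- 1) ** r \<in> W" using neg rW mult_W by blast
  ultimately have "reflection_along (mat (- 1) ** r) (line v)"
    using v(1) invertible_W by (simp add: reflection_along_rank2 is_line_line)
  moreover have "(mat (- 1) ** r) ** (mat (- 1) ** r) = mat 1"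
    unfolding matrix_eq
  proof
    fix u
    have "r *v (- y) = - (r *v y)" for y using matrix_vector_mult_diff_distrib[of r 0 y] by simp
    then show "(mat (- 1) ** r) ** (mat (- 1) ** r) *v u = mat 1 *v u"
      unfolding matrix_vector_mul_assoc[of "mat (- 1) ** r", symmetric] nv
      by (simp add: matrix_vector_mul_assoc rW(2))
  qed
  ultimately show ?thesis
    using \<open>mat (- 1) ** r \<in> W\<close> by (auto simp: involutive_reflections_def reflection_def)
qed

lemma involutive_reflection_conj:
  assumes r: "r \<in> involutive_reflections" and uw: "u \<in> W" "w \<in> W" "u ** w = mat 1"
  shows "u ** r ** w \<in> involutive_reflections"
proof -
  have rW: "r \<in> W" "r ** r = mat 1" using r by (auto simp: involutive_reflections_def)
  obtain H where H: "reflection_along r H" using r by (auto simp: involutive_reflections_def reflection_def)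
  have "u = u ** (w ** minv w)" using minv(3)[OF uw(2)] by simp
  also have "\<dots> = minv w" unfolding matrix_mul_assoc uw(3) by simp
  finally have u: "u = minv w" .
  have "reflection_along (u ** r ** w) (pre w H)"
    unfolding u using uw(2) rW(1) H by (rule reflection_along_pre)
  moreover have "(u ** r ** w) ** (u ** r ** w) = mat 1"
    unfolding matrix_eq
  proof
    fix v
    have "r *v (r *v y) = y" for y using rW(2) by (simp add: matrix_vector_mul_assoc)
    then show "(u ** r ** w) ** (u ** r ** w) *v v = mat 1 *v v"
      unfolding u by (simp add: matrix_vector_mul_assoc[symmetric] minv_vec[OF uw(2)])
  qed
  ultimately show ?thesis
    using uw rW mult_W unfolding involutive_reflections_def reflection_def by blast
qed

text \<open>The product of two involutive reflections along the same line fixes the line pointwise and has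
  determinant one, so it is trivial.\<close>

lemma card_lines_of_involutive_reflections:
  "card {K. \<exists>r\<in>involutive_reflections. reflection_along r K} = card involutive_reflections"
proof -
  let ?fix = "\<lambda>r. {v. r *v v = (v :: complex^2)}"
  have "{K. \<exists>r\<in>involutive_reflections. reflection_along r K} = ?fix ` involutive_reflections"
  proof
    show "{K. \<exists>r\<in>involutive_reflections. reflection_along r K} \<subseteq> ?fix ` involutive_reflections"
      using reflection_fixed_space by (auto simp: image_iff)
    show "?fix ` involutive_reflections \<subseteq> {K. \<exists>r\<in>involutive_reflections. reflection_along r K}"
    proof
      fix K assume "K \<in> ?fix ` involutive_reflections"
      then obtain r where r: "r \<in> involutive_reflections" "K = ?fix r" by blast
      then obtain H where H: "reflection_along r H" by (auto simp: involutive_reflections_def reflection_def)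
      then have "K = H" using reflection_fixed_space[OF H] r(2) by simp
      then show "K \<in> {K. \<exists>r\<in>involutive_reflections. reflection_along r K}" using r(1) H by blast
    qed
  qed
  moreover have "inj_on ?fix involutive_reflections"
  proof (rule inj_onI)
    fix r r' assume r: "r \<in> involutive_reflections" "r' \<in> involutive_reflections" "?fix r = ?fix r'"
    then have W: "r \<in> W" "r' \<in> W" "r ** r = mat 1" "r' ** r' = mat 1"
      by (auto simp: involutive_reflections_def)
    obtain H H' where HH: "reflection_along r H" "reflection_along r' H'"
      using r by (auto simp: involutive_reflections_def reflection_def)
    then have "H' = H"
      using reflection_fixed_space[OF HH(1)] reflection_fixed_space[OF HH(2)] r(3) by simp
    have h: "generator H \<noteq> 0" "r *v generator H = generator H" "r' *v generator H = generator H"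
      using HH generator[of H] by (auto simp: reflection_along_rank2 \<open>H' = H\<close>)
    have "det r * det r = 1" "det r' * det r' = 1" using W by (metis det_I det_mul)+
    then have "det r = - 1" "det r' = - 1"
      using det_reflection[OF W(1) HH(1)] det_reflection[OF W(2) HH(2)] by (auto simp: square_eq_1_iff)
    then have "r ** r' = mat 1"
      using double_eigenvalue_imp_scalar[OF mult_W[OF W(1,2)] h(1), of 1] h
      by (simp add: det_mul matrix_vector_mul_assoc[symmetric])
    have "r = r ** (r' ** r')" using W(4) by simp
    also have "\<dots> = (r ** r') ** r'" by (rule matrix_mul_assoc)
    finally show "r = r'" using \<open>r ** r' = mat 1\<close> by simp
  qed
  ultimately show ?thesis by (simp add: card_image)
qed

text \<open>The other three lines are the images of a given one under three involutive reflections, and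
  each involutive reflection is one of these up to sign.\<close>

lemma card_involutive_reflections:
  assumes even: "\<And>w. w \<in> W \<Longrightarrow> evenperm (perm w)" and neg: "mat (- 1) \<in> W"
    and H: "H \<in> C" and S: "S \<subseteq> involutive_reflections" "(\<lambda>r. act r H) ` S = C - {H}"
    and inj: "inj_on (\<lambda>r. act r H) S"
  shows "card involutive_reflections = 6"
proof -
  let ?n = "\<lambda>r. mat (- 1) ** r :: complex^2^2"
  have nv: "?n r *v v = - (r *v v)" for r v
    by (simp add: matrix_vector_mul_assoc[symmetric] mat_mult_vec)
  have card_S: "card S = 3"
    using card_image[OF inj] S(2) card_C finite_C H by simp
  then have finS: "finite S" using card.infinite by fastforce
  have inj_n: "inj_on ?n S"
  proof (rule inj_onI)
    fix r r' assume "?n r = ?n r'"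
    then have "r *v v = r' *v v" for v using nv[of r v] nv[of r' v] by simp
    then show "r = r'" by (simp add: matrix_eq)
  qed
  have act_n: "act (?n r) H = act r H" if "r \<in> S" for r
  proof -
    have "is_line (act r H)" using that S(1) H line_C is_line_act by (auto simp: involutive_reflections_def)
    then have "- v \<in> act r H" if "v \<in> act r H" for v using is_line_scale[of "act r H" v "- 1"] that by simp
    then have "uminus ` act r H = act r H" by (intro equalityI subsetI) (blast, metis imageI minus_minus)
    then show ?thesis by (simp add: nv image_image)
  qed
  have "involutive_reflections = S \<union> ?n ` S"
  proof
    show "S \<union> ?n ` S \<subseteq> involutive_reflections" using S(1) neg_involutive_reflection[OF _ neg] by blast
    show "involutive_reflections \<subseteq> S \<union> ?n ` S"
    proof
      fix r assume r: "r \<in> involutive_reflections"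
      then have "act r H \<in> C - {H}"
        using involutive_reflection_moves[OF even r H] act_C H by (auto simp: involutive_reflections_def)
      then have "act r H \<in> (\<lambda>r. act r H) ` S" using S(2) by simp
      then obtain r' where r': "r' \<in> S" "act r H = act r' H" by (rule imageE) simp
      then obtain c where "c\<^sup>2 = 1" "r = mat c ** r'"
        using involutive_reflection_determined[OF even r _ H] S(1) by blast
      then show "r \<in> S \<union> ?n ` S" using r'(1) by (auto simp: power2_eq_1_iff)
    qed
  qed
  moreover have "S \<inter> ?n ` S = {}"
  proof (rule ccontr)
    assume "S \<inter> ?n ` S \<noteq> {}"
    then obtain r r' where r: "r \<in> S" "r' \<in> S" "r = ?n r'" by blast
    then have "act r H = act r' H" using act_n[of r'] by simp
    then have "r = r'" using inj r(1,2) by (simp add: inj_on_def)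
    then have anti: "r *v v = - (r *v v)" for v using nv[of r' v] r(3) by metis
    have z: "r *v v = 0" for v using anti[of v] by (simp add: vec2_eq_iff complex_eq_iff)
    have "r \<in> involutive_reflections" using r(1) S(1) by (rule subsetD[rotated])
    then have "r \<in> W" by (simp add: involutive_reflections_def)
    moreover have "vector [1, 0] \<noteq> (0 :: complex^2)" by (simp add: vec2_eq_iff)
    ultimately show False using W_vec_eq_0 z by blast
  qed
  ultimately show ?thesis
    using card_Un_disjoint[OF finS finite_imageI[OF finS], of ?n] card_image[OF inj_n] card_S by simp
qed

end

text \<open>Let \<open>H\<close> be the line of \<open>t\<close>.  The element \<open>z = (s t)\<^sup>3\<close> is central, so it preserves \<open>H\<close>; this
  determines how \<open>s\<close> permutes the lines \<open>H\<close>, \<open>s H\<close>, \<open>t s H\<close> and \<open>t\<^sup>2 s H\<close>.  They are distinct because otherwise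
  the group would preserve \<open>H\<close> or the pair \<open>H\<close>, \<open>s H\<close>.  Since \<open>z\<close> permutes them trivially and \<open>t\<close> has order
  three, both generators act as even permutations.  All determinants are sixth roots of unity, so each
  reflection is involutive or has a square of order three; in the second case its line is one of
  the four.  The involutive reflections contribute six more lines.\<close>

theorem bieberbach_G6:
  assumes G6: "is_G6 W" and x: "x \<in> hyperplane_complement W"
  shows "bieberbach_group (braid_mod_pure_commutators W x) 10 (alt_group 4)"
proof -
  obtain s t where st: "reflection s" "reflection t" and gen: "generate GL {s, t} = W"
      and s2: "s ** s = mat 1" and t3: "t ** t ** t = mat 1"
      and braid: "s ** t ** s ** t ** s ** t = t ** s ** t ** s ** t ** s"
    using G6 unfolding is_G6_def by blast
  have W: "complex_reflection_group W" "irreducible_linear_group W" "primitive_rank2 W"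
      "has_invariant_degrees W 4 12" "card W = 48"
    using G6 unfolding is_G6_def by blast+
  have "{s, t} \<subseteq> generate GL {s, t}" by (auto intro: generate.incl)
  then have stW: "s \<in> W" "t \<in> W" using gen by auto
  interpret rank2_reflection_group W
    using reflection_imp_rank2_reflection_group[OF W(1) stW(1) st(1)] .
  obtain H where H: "reflection_along t H" using st by (auto simp: reflection_def)
  have line: "is_line H" using H by (auto simp: reflection_along_rank2)
  have fixed: "t *v v = v \<longleftrightarrow> v \<in> H" for v using reflection_fixed_space[OF H] by blast
  have act2: "act s (act s K) = K" for K using s2 by (metis act_mult act_one)
  have act3: "act t (act t (act t K)) = K" for K using t3 by (metis act_mult act_one)
  define z where "z = s ** t ** s ** t ** s ** t"
  have zW: "z \<in> W" using stW by (simp add: z_def mult_W)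
  have zt: "t ** z = z ** t"
  proof -
    have "t ** z = (t ** s ** t ** s ** t ** s) ** t" by (simp add: z_def matrix_mul_assoc)
    then show ?thesis unfolding braid[symmetric] by (simp add: z_def)
  qed
  have zs: "s ** z = z ** s"
  proof -
    have "z ** s = s ** (t ** s ** t ** s ** t ** s)" by (simp add: z_def matrix_mul_assoc)
    then show ?thesis unfolding braid[symmetric] by (simp add: z_def)
  qed
  have zH: "act z H = H"
  proof (rule lines_subset_eq[OF is_line_act[OF zW line] line])
    show "act z H \<subseteq> H"
    proof clarify
      fix v assume "v \<in> H"
      then have "t *v v = v" using fixed by blast
      then have "t *v (z *v v) = z *v v" using zt by (metis matrix_vector_mul_assoc)
      then show "z *v v \<in> H" using fixed by blast
    qed
  qed
  define H1 where "H1 = act s H"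
  define H2 where "H2 = act t H1"
  define H3 where "H3 = act t H2"
  have l: "is_line H1" "is_line H2" "is_line H3"
    using line stW by (simp_all add: H1_def H2_def H3_def is_line_act)
  have tH: "act t H = H" using act_reflection[OF H] .
  have sH1: "act s H1 = H" unfolding H1_def by (rule act2)
  have tH3: "act t H3 = H1" unfolding H3_def H2_def by (rule act3)
  have sH2: "act s H2 = H3"
  proof -
    have "act s (act t (act s H2)) = act z H"
      unfolding z_def act_mult tH H2_def H1_def ..
    then have "act s (act t (act s H2)) = act s H1" by (simp only: zH sH1)
    then have "act t (act s H2) = H1" using act_inj[OF stW(1)] by blast
    then have "act t (act s H2) = act t H3" by (simp only: tH3)
    then show ?thesis using act_inj[OF stW(2)] by blast
  qed
  have sH3: "act s H3 = H2" unfolding sH2[symmetric] by (rule act2)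
  have ne1: "H1 \<noteq> H"
  proof
    assume "H1 = H"
    then have "act s H = H" by (simp only: H1_def)
    then show False using no_invariant_line[OF W(2) gen line] tH by blast
  qed
  have ne2: "H2 \<noteq> H1"
  proof
    assume e: "H2 = H1"
    have C: "act g K \<in> {H, H1}" if g: "g \<in> {s, t}" and K: "K \<in> {H, H1}" for g K
    proof -
      have sub: "act s ` {H, H1} \<subseteq> {H, H1}" "act t ` {H, H1} \<subseteq> {H, H1}"
        unfolding image_insert by (simp_all only: sH1 tH H1_def[symmetric] H2_def[symmetric] e) blast+
      consider "g = s" | "g = t" using g by blast
      then show ?thesis
      proof cases
        case 1
        show ?thesis unfolding 1 by (rule subsetD[OF sub(1) imageI[OF K]])
      next
        case 2
        show ?thesis unfolding 2 by (rule subsetD[OF sub(2) imageI[OF K]])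
      qed
    qed
    have "{act w H, act w H1} = {H, H1}" if "w \<in> W" for w
      using act_closed_generated[OF gen _ C that] by simp
    then have "vec.subspace H \<and> vec.dim H = 1 \<and> vec.subspace H1 \<and> vec.dim H1 = 1
        \<and> H \<inter> H1 = {0} \<and> (\<forall>w\<in>W. {act w H, act w H1} = {H, H1})"
      using is_line_subspace[OF line] is_line_subspace[OF l(1)] lines_Int[OF line l(1)] ne1 by simp
    then show False using W(3) unfolding primitive_rank2_def by blast
  qed
  have ne3: "H3 \<noteq> H1" "H3 \<noteq> H2" "H2 \<noteq> H" "H3 \<noteq> H"
  proof -
    have inj: "act t K \<noteq> act t L" if "K \<noteq> L" for K L using act_inj[OF stW(2)] that by blast
    show "H3 \<noteq> H2" using inj[OF ne2] unfolding H3_def[symmetric] H2_def[symmetric] .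
    show "H3 \<noteq> H1" using inj[OF \<open>H3 \<noteq> H2\<close>] unfolding tH3 H3_def[symmetric] by blast
    show "H2 \<noteq> H" using inj[OF ne1] unfolding tH H2_def[symmetric] .
    show "H3 \<noteq> H" using inj[OF \<open>H2 \<noteq> H\<close>] unfolding tH H3_def[symmetric] .
  qed
  define C where "C = {H, H1, H2, H3}"
  have card_C: "card C = 4" using ne1 ne2 ne3 by (auto simp: C_def)
  have stC: "act g K \<in> C" if "g \<in> {s, t}" "K \<in> C" for g K
  proof -
    have "act s H = H1" "act t H1 = H2" "act t H2 = H3" by (simp_all only: H1_def H2_def H3_def)
    then have "act s ` C \<subseteq> C" "act t ` C \<subseteq> C"
      unfolding C_def image_insert by (simp_all only: tH sH1 sH2 sH3 tH3) blast+
    then show ?thesis using that by blast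
  qed
  have closed: "act w K \<in> C" if "w \<in> W" "K \<in> C" for w K
  proof -
    have "finite C" by (simp add: C_def)
    from act_closed_generated[OF gen this stC that(1)] have "act w ` C = C" .
    then show ?thesis using that(2) by blast
  qed
  have orbit: "\<exists>g\<in>W. K = act g H" if "K \<in> C" for K
  proof -
    have "\<exists>g\<in>W. H = act g H" by (rule bexI[OF _ one_W]) simp
    moreover have "\<exists>g\<in>W. H1 = act g H" by (rule bexI[OF _ stW(1)]) (rule H1_def)
    moreover have "\<exists>g\<in>W. H2 = act g H"
      by (rule bexI[OF _ mult_W[OF stW(2,1)]]) (simp only: act_mult H1_def H2_def)
    moreover have "\<exists>g\<in>W. H3 = act g H"
      by (rule bexI[OF _ mult_W[OF stW(2) mult_W[OF stW(2,1)]]]) (simp only: act_mult H1_def H2_def H3_def)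
    ultimately show ?thesis using that unfolding C_def by blast
  qed
  interpret tetrahedral_group W C 4
  proof
    show "card C = 4" by (rule card_C)
    show "is_line K" if "K \<in> C" for K using that line l by (auto simp: C_def)
    show "act w K \<in> C" if "w \<in> W" "K \<in> C" for w K using closed that .
    show "\<exists>r\<in>W. reflection_along r K \<and> r ** r ** r = mat 1" if "K \<in> C" for K
      using orbit[OF that] cubic_reflection_conj[OF stW(2) H t3] by blast
    show "c ^ 4 = 1" if "mat c \<in> W" for c using scalar_pow_degree(1)[OF W(4) that] .
  qed (simp_all add: W)
  \<comment> \<open>The element \<open>z\<close> is central, so it preserves the lines of the orbit of \<open>H\<close>.\<close>
  have "act z K = K" if "K \<in> C" for K
  proof -
    have "act z H1 = H1" unfolding H1_def act_mult[symmetric] zs[symmetric] unfolding act_mult zH ..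
    then have "act z H2 = H2" unfolding H2_def act_mult[symmetric] zt[symmetric] unfolding act_mult by simp
    then have "act z H3 = H3" unfolding H3_def act_mult[symmetric] zt[symmetric] unfolding act_mult by simp
    show ?thesis using that zH \<open>act z H1 = H1\<close> \<open>act z H2 = H2\<close> \<open>act z H3 = H3\<close>
      unfolding C_def by blast
  qed
  then obtain c where "z = mat c" by (rule fixes_C_imp_scalar)
  then have "perm z = id" using perm_eq_id_iff[OF zW] by blast
  moreover have "z = (s ** t) ** (s ** t) ** (s ** t)" by (simp add: z_def matrix_mul_assoc)
  ultimately have "evenperm (perm (s ** t))" using evenperm_perm_cube[OF mult_W[OF stW]] by simp
  moreover have et: "evenperm (perm t)" using evenperm_perm_cube[OF stW(2)] by (simp add: t3 perm_one)
  ultimately have es: "evenperm (perm s)" using evenperm_perm_mult[OF stW] by simp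
  have even: "evenperm (perm w)" if "w \<in> W" for w
    by (rule evenperm_perm_generated[OF gen _ that]) (use es et in blast)
  have neg: "mat (- 1) \<in> W" using even_action(3)[OF even, of "- 1"] by simp
  let ?D = "{K. \<exists>r\<in>involutive_reflections. reflection_along r K}"
  have "\<A> = C \<union> ?D"
  proof
    have "det s ^ 2 = 1" "det t ^ 3 = 1"
      using s2 t3 by (metis det_I det_mul power2_eq_square, metis det_I det_mul power3_eq_cube)
    then have "det s ^ 6 = 1" "det t ^ 6 = 1"
      using power_mult[of "det s" 2 3] power_mult[of "det t" 3 2] by simp_all
    then have det6: "det w ^ 6 = 1" if "w \<in> W" for w using det_pow_generated[OF gen _ that] by blast
    show "\<A> \<subseteq> C \<union> ?D"
    proof
      fix K assume "K \<in> \<A>"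
      then obtain r where r: "r \<in> W" "reflection_along r K" using arrangement_iff by blast
      have "r [^]\<^bsub>GW\<^esub> (6::nat) = mat 1" using pow_eq_1_of_fixed_line[OF r det6[OF r(1)]] .
      then have r6: "(r ** r) ** (r ** r) ** (r ** r) = mat 1"
        by (simp add: eval_nat_numeral matrix_mul_assoc)
      show "K \<in> C \<union> ?D"
      proof (cases "r ** r = mat 1")
        case True
        then show ?thesis using r by (auto simp: involutive_reflections_def reflection_def)
      next
        case False
        then have "reflection_along (r ** r) K"
          using r(2) invertible_W[OF mult_W[OF r(1,1)]]
          by (auto simp: reflection_along_rank2 matrix_vector_mul_assoc[symmetric])
        then show ?thesis using cubic_reflection_line[OF mult_W[OF r(1,1)] _ r6] by blast
      qed
    qed
    show "C \<union> ?D \<subseteq> \<A>"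
      using C_in_arrangement arrangement_iff by (auto simp: involutive_reflections_def)
  qed
  moreover have "C \<inter> ?D = {}"
    using involutive_reflection_moves[OF even] act_reflection by blast
  moreover have "card ?D = 6"
    unfolding card_lines_of_involutive_reflections
  proof (rule card_involutive_reflections[OF even neg])
    show HC: "H \<in> C" by (simp add: C_def)
    \<comment> \<open>These are the conjugates of \<open>s\<close> by the powers of \<open>t\<close>, which fix \<open>H\<close>.\<close>
    define S where "S = {s, t ** s ** (t ** t), (t ** t) ** s ** t}"
    have sI: "s \<in> involutive_reflections" using st stW s2 by (simp add: involutive_reflections_def)
    have "t ** s ** (t ** t) \<in> involutive_reflections" "(t ** t) ** s ** t \<in> involutive_reflections"
      using stW mult_W t3 by (intro involutive_reflection_conj[OF sI]; simp add: matrix_mul_assoc)+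
    then show "S \<subseteq> involutive_reflections" using sI by (simp add: S_def)
    have a: "act s H = H1" "act (t ** s ** (t ** t)) H = H2" "act ((t ** t) ** s ** t) H = H3"
      unfolding act_mult tH by (simp_all only: H1_def H2_def H3_def)
    show "(\<lambda>r. act r H) ` S = C - {H}"
      unfolding S_def C_def image_insert a using ne1 ne3 by blast
    show "inj_on (\<lambda>r. act r H) S"
    proof (rule inj_onI)
      fix r r' assume rr: "r \<in> S" "r' \<in> S" and e: "act r H = act r' H"
      have "r = s \<or> r = t ** s ** (t ** t) \<or> r = (t ** t) ** s ** t"
        and "r' = s \<or> r' = t ** s ** (t ** t) \<or> r' = (t ** t) ** s ** t"
        using rr by (simp_all only: S_def insert_iff empty_iff simp_thms)
      then show "r = r'"
        using e by (elim disjE) (simp_all only: a ne2 ne3 ne2[symmetric] ne3[symmetric] simp_thms)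
    qed
  qed
  moreover have "finite ?D" using \<open>card ?D = 6\<close> card.infinite by fastforce
  ultimately have "card \<A> = 10" using card_Un_disjoint[OF finite_C, of ?D] card_C by simp
  then show ?thesis using bieberbach_tetrahedral[OF x even] by simp
qed

theorem corollary3p4:
  fixes W :: "(complex^2^2) set" and x :: "complex^2"
  assumes "x \<in> hyperplane_complement W"
  shows "(is_G4 W \<longrightarrow> bieberbach_group (braid_mod_pure_commutators W x) 4 (alt_group 4))
       \<and> (is_G6 W \<longrightarrow> bieberbach_group (braid_mod_pure_commutators W x) 10 (alt_group 4))"
  using bieberbach_G4 bieberbach_G6 assms by blast

end
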